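(* Let $(R,\mathfrak m)$ be a commutative Artinian local ring with $\mathfrak m^3=0$ and residue field $k$; set $e=\nu(\mathfrak m)$ and $a=\dim_k\operatorname{Soc}(R)$. Let $M$, $N$ be non-free finitely generated $R$-modules satisfying $\mathfrak m^2M=\mathfrak m^2N=0$. If there exists an integer $j>0$ such that $$\operatorname{Tor}^R_j(M,N)=\operatorname{Tor}^R_{j+1}(M,N)=\operatorname{Tor}^R_{j+2}(M,N)=0,$$ then the following hold: (1) $\gamma(M)$ and $\gamma(N)$ are positive integers. (2) $\dfrac{b_{i+1}(M)}{b_i(M)}=\gamma(N)$ and $\dfrac{b_{i+1}(N)}{b_i(N)}=\gamma(M)$ for all $i$ with $0\le i\le j+1$. (3) $\gamma(M)=\gamma(M_i)$ and $\gamma(N)=\gamma(N_i)$ for all $i$ with $0\le i\le j$. (4) $\gamma(M)+\gamma(N)=e$ and $\gamma(M)\gamma(N)=a$.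
   Context: For a finitely generated $R$-module $L$: $\nu(L)$ is its minimal number of generators, $\lambda(L)$ its length, $b_i(L)$ its $i$-th Betti number (rank of the $i$-th free module in a minimal free resolution), and $L_i$ its $i$-th syzygy in a minimal free resolution (with $L_0=L$). For a nonzero $R$-module $L$ of finite length, $\gamma(L)=\frac{\lambda(L)}{\nu(L)}-1=\frac{\lambda(\mathfrak m L)}{\nu(L)}$, a rational number. $\operatorname{Soc}(R)$ is the socle $\{x\in R: \mathfrak m x=0\}$. *)

theory Defs
  imports Complex_Main "HOL-Library.FuncSet" "HOL-Library.Poly_Mapping"
begin

text \<open>
  The ring is a type of class \<^class>\<open>comm_ring_1\<close>; an \<open>R\<close>-module is a type of class
  \<^class>\<open>ab_group_add\<close> with a scalar multiplication \<open>s\<close> satisfying \<^locale>\<open>module\<close>, and its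
  submodules are the sets \<open>S\<close> with \<^term>\<open>module.subspace s S\<close>.  The ring itself is the
  module with scalar multiplication \<^term>\<open>(*)\<close>, so its ideals are its submodules.
  Invariants of modules take the pair \<open>s S\<close>, so that they also apply to submodules
  (syzygies, ideals); the whole module is \<open>s UNIV\<close>.
\<close>

section \<open>Ideals and local rings\<close>

abbreviation is_ideal :: "'a::comm_ring_1 set \<Rightarrow> bool"
  where "is_ideal I \<equiv> module.subspace (*) I"

definition maximal_ideal :: "'a::comm_ring_1 set \<Rightarrow> bool"
  where "maximal_ideal I \<longleftrightarrow> is_ideal I \<and> I \<noteq> UNIV \<and>
           (\<forall>J. is_ideal J \<longrightarrow> I \<subseteq> J \<longrightarrow> J = I \<or> J = UNIV)"

definition local_ring :: "'a::comm_ring_1 set \<Rightarrow> bool"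
  where "local_ring \<mm> \<longleftrightarrow> maximal_ideal \<mm> \<and> (\<forall>I. maximal_ideal I \<longrightarrow> I = \<mm>)"

definition artinian_ring :: "'a::comm_ring_1 itself \<Rightarrow> bool"
  where "artinian_ring _ \<longleftrightarrow>
           (\<forall>I :: nat \<Rightarrow> 'a set. (\<forall>n. is_ideal (I n) \<and> I (Suc n) \<subseteq> I n) \<longrightarrow>
              (\<exists>n. \<forall>k\<ge>n. I k = I n))"

definition ideal_smult ::
    "('a::comm_ring_1 \<Rightarrow> 'b::ab_group_add \<Rightarrow> 'b) \<Rightarrow> 'a set \<Rightarrow> 'b set \<Rightarrow> 'b set"
  where "ideal_smult s I S = module.span s {s r x |r x. r \<in> I \<and> x \<in> S}"

fun ideal_power :: "'a::comm_ring_1 set \<Rightarrow> nat \<Rightarrow> 'a set"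
  where
    "ideal_power I 0 = UNIV"
  | "ideal_power I (Suc n) = ideal_smult (*) I (ideal_power I n)"

definition socle :: "'a::comm_ring_1 set \<Rightarrow> 'a set"
  where "socle \<mm> = {x. \<forall>r\<in>\<mm>. r * x = 0}"


section \<open>Quotients and dimension over the residue field\<close>

definition coset :: "'b::ab_group_add set \<Rightarrow> 'b \<Rightarrow> 'b set"
  where "coset B x = (\<lambda>b. x + b) ` B"

definition quotient_set :: "'b::ab_group_add set \<Rightarrow> 'b set \<Rightarrow> 'b set set"
  where "quotient_set A B = coset B ` A"

text \<open>
  \<^term>\<open>quotient_set UNIV \<mm>\<close> is the residue field \<open>k\<close>.  It acts on a submodule \<open>V\<close> with
  \<open>\<mm> V = 0\<close> through representatives, the choice of which does not matter.
\<close>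

definition residue_act ::
    "('a::comm_ring_1 \<Rightarrow> 'b::ab_group_add \<Rightarrow> 'b) \<Rightarrow> 'a set \<Rightarrow> 'b \<Rightarrow> 'b"
  where "residue_act s C x = s (SOME r. r \<in> C) x"

definition residue_basis ::
    "('a::comm_ring_1 \<Rightarrow> 'b::ab_group_add \<Rightarrow> 'b) \<Rightarrow> 'a set \<Rightarrow> 'b set \<Rightarrow> 'b set \<Rightarrow> bool"
  where "residue_basis s \<mm> V B \<longleftrightarrow> finite B \<and> B \<subseteq> V \<and>
           (\<forall>x\<in>V. \<exists>!c. c \<in> B \<rightarrow>\<^sub>E quotient_set UNIV \<mm> \<and> x = (\<Sum>b\<in>B. residue_act s (c b) b))"

definition residue_dim ::
    "('a::comm_ring_1 \<Rightarrow> 'b::ab_group_add \<Rightarrow> 'b) \<Rightarrow> 'a set \<Rightarrow> 'b set \<Rightarrow> nat"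
  where "residue_dim s \<mm> V = (THE n. \<exists>B. residue_basis s \<mm> V B \<and> card B = n)"


section \<open>Generators, freeness and length\<close>

definition finitely_generated ::
    "('a::comm_ring_1 \<Rightarrow> 'b::ab_group_add \<Rightarrow> 'b) \<Rightarrow> 'b set \<Rightarrow> bool"
  where "finitely_generated s S \<longleftrightarrow> (\<exists>B. finite B \<and> module.span s B = S)"

definition min_gens :: "('a::comm_ring_1 \<Rightarrow> 'b::ab_group_add \<Rightarrow> 'b) \<Rightarrow> 'b set \<Rightarrow> nat"
  where "min_gens s S = (LEAST n. \<exists>B. finite B \<and> card B = n \<and> module.span s B = S)"

definition free_module :: "('a::comm_ring_1 \<Rightarrow> 'b::ab_group_add \<Rightarrow> 'b) \<Rightarrow> 'b set \<Rightarrow> bool"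
  where "free_module s S \<longleftrightarrow> (\<exists>B. \<not> module.dependent s B \<and> module.span s B = S)"

definition composition_series ::
    "('a::comm_ring_1 \<Rightarrow> 'b::ab_group_add \<Rightarrow> 'b) \<Rightarrow> 'b set \<Rightarrow> nat \<Rightarrow> (nat \<Rightarrow> 'b set) \<Rightarrow> bool"
  where "composition_series s S n C \<longleftrightarrow>
           C 0 = {0} \<and> C n = S \<and> (\<forall>i\<le>n. module.subspace s (C i)) \<and>
           (\<forall>i<n. C i \<subset> C (Suc i) \<and>
              (\<forall>T. module.subspace s T \<longrightarrow> \<not> (C i \<subset> T \<and> T \<subset> C (Suc i))))"

text \<open>All composition series of a module of finite length have the same length.\<close>

definition module_length :: "('a::comm_ring_1 \<Rightarrow> 'b::ab_group_add \<Rightarrow> 'b) \<Rightarrow> 'b set \<Rightarrow> nat"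
  where "module_length s S = (LEAST n. \<exists>C. composition_series s S n C)"

definition gamma :: "('a::comm_ring_1 \<Rightarrow> 'b::ab_group_add \<Rightarrow> 'b) \<Rightarrow> 'b set \<Rightarrow> rat"
  where "gamma s S = of_nat (module_length s S) / of_nat (min_gens s S) - 1"


section \<open>Free modules on a set and free resolutions\<close>

definition pm_scale :: "'a::comm_ring_1 \<Rightarrow> ('x \<Rightarrow>\<^sub>0 'a) \<Rightarrow> ('x \<Rightarrow>\<^sub>0 'a)"
  where "pm_scale r f = Poly_Mapping.map ((*) r) f"

lemma lookup_pm_scale [simp]:
  "Poly_Mapping.lookup (pm_scale r f) x = r * Poly_Mapping.lookup f x"
  by (simp add: pm_scale_def Poly_Mapping.map.rep_eq when_def)

lemma module_pm_scale: "module (pm_scale :: 'a::comm_ring_1 \<Rightarrow> ('x \<Rightarrow>\<^sub>0 'a) \<Rightarrow> _)"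
  by (unfold_locales; rule poly_mapping_eqI) (simp_all add: lookup_add algebra_simps)

lemma module_mult: "module ((*) :: 'a::comm_ring_1 \<Rightarrow> 'a \<Rightarrow> 'a)"
  by unfold_locales (simp_all add: algebra_simps)

definition free_on :: "'x set \<Rightarrow> ('x \<Rightarrow>\<^sub>0 'a::comm_ring_1) set"
  where "free_on A = {f. Poly_Mapping.keys f \<subseteq> A}"

text \<open>
  A resolution \<open>\<dots> \<rightarrow> F\<^sub>2 \<rightarrow> F\<^sub>1 \<rightarrow> F\<^sub>0 \<rightarrow> M \<rightarrow> 0\<close> by free modules of finite rank.  \<open>F\<^sub>i\<close> is
  \<open>R\<^sup>n\<close> with \<open>n = res_rank X i\<close>, realised inside the free module on \<^typ>\<open>nat\<close>;
  \<open>res_aug X : F\<^sub>0 \<rightarrow> M\<close>, and \<open>res_diff X i : F\<^sub>i \<rightarrow> F\<^sub>i\<^sub>-\<^sub>1\<close> for \<open>i \<ge> 1\<close> (\<open>res_diff X 0\<close> is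
  not used).  The maps are linear on the whole ambient type, which is no restriction, but
  only their restrictions to the \<open>F\<^sub>i\<close> matter.
\<close>

record (overloaded) ('a, 'b) resolution =
  res_rank :: "nat \<Rightarrow> nat"
  res_aug :: "(nat \<Rightarrow>\<^sub>0 'a) \<Rightarrow> 'b"
  res_diff :: "nat \<Rightarrow> (nat \<Rightarrow>\<^sub>0 'a) \<Rightarrow> (nat \<Rightarrow>\<^sub>0 'a)"

definition res_mod :: "('a::comm_ring_1, 'b) resolution \<Rightarrow> nat \<Rightarrow> (nat \<Rightarrow>\<^sub>0 'a) set"
  where "res_mod X i = free_on {..<res_rank X i}"

definition free_resolution ::
    "('a::comm_ring_1 \<Rightarrow> 'b::ab_group_add \<Rightarrow> 'b) \<Rightarrow> ('a, 'b) resolution \<Rightarrow> bool"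
  where "free_resolution s X \<longleftrightarrow>
           module_hom pm_scale s (res_aug X) \<and>
           (\<forall>i\<ge>1. module_hom pm_scale pm_scale (res_diff X i)) \<and>
           res_aug X ` res_mod X 0 = UNIV \<and>
           res_diff X 1 ` res_mod X 1 = {v \<in> res_mod X 0. res_aug X v = 0} \<and>
           (\<forall>i\<ge>1. res_diff X (Suc i) ` res_mod X (Suc i) = {v \<in> res_mod X i. res_diff X i v = 0})"

definition minimal_free_resolution ::
    "'a set \<Rightarrow> ('a::comm_ring_1 \<Rightarrow> 'b::ab_group_add \<Rightarrow> 'b) \<Rightarrow> ('a, 'b) resolution \<Rightarrow> bool"
  where "minimal_free_resolution \<mm> s X \<longleftrightarrow> free_resolution s X \<and>
           (\<forall>i. res_diff X (Suc i) ` res_mod X (Suc i) \<subseteq> ideal_smult pm_scale \<mm> (res_mod X i))"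

text \<open>
  Every finitely generated module over a Noetherian local ring has a minimal free
  resolution, and it is unique up to isomorphism; hence the choices below do not matter.
\<close>

definition min_res ::
    "'a set \<Rightarrow> ('a::comm_ring_1 \<Rightarrow> 'b::ab_group_add \<Rightarrow> 'b) \<Rightarrow> ('a, 'b) resolution"
  where "min_res \<mm> s = (SOME X. minimal_free_resolution \<mm> s X)"

definition betti :: "'a set \<Rightarrow> ('a::comm_ring_1 \<Rightarrow> 'b::ab_group_add \<Rightarrow> 'b) \<Rightarrow> nat \<Rightarrow> nat"
  where "betti \<mm> s i = res_rank (min_res \<mm> s) i"

text \<open>
  For \<open>i \<ge> 1\<close> the syzygy \<open>M\<^sub>i\<close> is the image of \<open>F\<^sub>i\<close> in \<open>F\<^sub>i\<^sub>-\<^sub>1\<close>.  As \<open>M\<^sub>0 = M\<close> lives in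
  another type, the case \<open>i = 0\<close> is made in \<open>gamma_syzygy\<close>.
\<close>

definition syzygy ::
    "'a set \<Rightarrow> ('a::comm_ring_1 \<Rightarrow> 'b::ab_group_add \<Rightarrow> 'b) \<Rightarrow> nat \<Rightarrow> (nat \<Rightarrow>\<^sub>0 'a) set"
  where "syzygy \<mm> s i = res_diff (min_res \<mm> s) i ` res_mod (min_res \<mm> s) i"

definition gamma_syzygy ::
    "'a set \<Rightarrow> ('a::comm_ring_1 \<Rightarrow> 'b::ab_group_add \<Rightarrow> 'b) \<Rightarrow> nat \<Rightarrow> rat"
  where "gamma_syzygy \<mm> s i =
           (if i = 0 then gamma s UNIV else gamma pm_scale (syzygy \<mm> s i))"


section \<open>Tensor products and Tor\<close>

text \<open>
  \<open>S \<otimes> T\<close> is the free module on \<open>S \<times> T\<close> modulo the submodule generated by the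
  bilinearity relations.
\<close>

definition tensor_rels ::
    "('a::comm_ring_1 \<Rightarrow> 'x::ab_group_add \<Rightarrow> 'x) \<Rightarrow> 'x set \<Rightarrow>
     ('a \<Rightarrow> 'y::ab_group_add \<Rightarrow> 'y) \<Rightarrow> 'y set \<Rightarrow> (('x \<times> 'y) \<Rightarrow>\<^sub>0 'a) set"
  where "tensor_rels s S t T =
    (let e = (\<lambda>x y. Poly_Mapping.single (x, y) (1::'a)) in
     module.span pm_scale
       ({e (x + x') y - e x y - e x' y |x x' y. x \<in> S \<and> x' \<in> S \<and> y \<in> T} \<union>
        {e x (y + y') - e x y - e x y' |x y y'. x \<in> S \<and> y \<in> T \<and> y' \<in> T} \<union>
        {e (s r x) y - pm_scale r (e x y) |r x y. x \<in> S \<and> y \<in> T} \<union>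
        {e x (t r y) - pm_scale r (e x y) |r x y. x \<in> S \<and> y \<in> T}))"

text \<open>
  The linear map with \<open>(x, y) \<mapsto> (d x, y)\<close> on basis elements; it induces \<open>d \<otimes> 1\<close> on
  the tensor products.
\<close>

definition tensor_lift ::
    "('x \<Rightarrow> 'z) \<Rightarrow> (('x \<times> 'y) \<Rightarrow>\<^sub>0 'a::comm_ring_1) \<Rightarrow> (('z \<times> 'y) \<Rightarrow>\<^sub>0 'a)"
  where "tensor_lift d f =
           (\<Sum>(x, y)\<in>Poly_Mapping.keys f.
              Poly_Mapping.single (d x, y) (Poly_Mapping.lookup f (x, y)))"

text \<open>
  For a free resolution \<open>F\<close> of \<open>M\<close>, a submodule of \<open>F\<^sub>i \<otimes> N\<close> is given by its preimage in
  the free module on \<open>F\<^sub>i \<times> N\<close>, a submodule containing the relations of \<open>F\<^sub>i \<otimes> N\<close>.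
  The following are the preimages of the kernel of \<open>F\<^sub>i \<otimes> N \<rightarrow> F\<^sub>i\<^sub>-\<^sub>1 \<otimes> N\<close> (everything for
  \<open>i = 0\<close>) and of the image of \<open>F\<^sub>i\<^sub>+\<^sub>1 \<otimes> N \<rightarrow> F\<^sub>i \<otimes> N\<close>.
\<close>

definition tensor_cycles ::
    "('a::comm_ring_1, 'b) resolution \<Rightarrow> ('a \<Rightarrow> 'c::ab_group_add \<Rightarrow> 'c) \<Rightarrow> nat \<Rightarrow>
     (((nat \<Rightarrow>\<^sub>0 'a) \<times> 'c) \<Rightarrow>\<^sub>0 'a) set"
  where "tensor_cycles X t i =
    {z \<in> free_on (res_mod X i \<times> UNIV).
       i = 0 \<or> tensor_lift (res_diff X i) z \<in> tensor_rels pm_scale (res_mod X (i - 1)) t UNIV}"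

definition tensor_boundaries ::
    "('a::comm_ring_1, 'b) resolution \<Rightarrow> ('a \<Rightarrow> 'c::ab_group_add \<Rightarrow> 'c) \<Rightarrow> nat \<Rightarrow>
     (((nat \<Rightarrow>\<^sub>0 'a) \<times> 'c) \<Rightarrow>\<^sub>0 'a) set"
  where "tensor_boundaries X t i =
    {tensor_lift (res_diff X (Suc i)) w + r |w r.
       w \<in> free_on (res_mod X (Suc i) \<times> UNIV) \<and> r \<in> tensor_rels pm_scale (res_mod X i) t UNIV}"

definition chosen_res :: "('a::comm_ring_1 \<Rightarrow> 'b::ab_group_add \<Rightarrow> 'b) \<Rightarrow> ('a, 'b) resolution"
  where "chosen_res s = (SOME X. free_resolution s X)"

text \<open>
  The homology at \<open>i\<close> of \<open>F \<otimes> N\<close>, as a set of cosets, for \<open>M\<close> finitely generated over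
  a Noetherian ring (so that \<open>M\<close> has a free resolution of the above kind).
  It does not depend on the choice of \<open>F\<close>, up to isomorphism.  Its zero is the coset of \<open>0\<close>.
\<close>

definition Tor ::
    "('a::comm_ring_1 \<Rightarrow> 'b::ab_group_add \<Rightarrow> 'b) \<Rightarrow> ('a \<Rightarrow> 'c::ab_group_add \<Rightarrow> 'c) \<Rightarrow> nat \<Rightarrow>
     (((nat \<Rightarrow>\<^sub>0 'a) \<times> 'c) \<Rightarrow>\<^sub>0 'a) set set"
  where "Tor s t i =
    quotient_set (tensor_cycles (chosen_res s) t i) (tensor_boundaries (chosen_res s) t i)"

definition Tor_is_zero ::
    "('a::comm_ring_1 \<Rightarrow> 'b::ab_group_add \<Rightarrow> 'b) \<Rightarrow> ('a \<Rightarrow> 'c::ab_group_add \<Rightarrow> 'c) \<Rightarrow> nat \<Rightarrow> bool"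
  where "Tor_is_zero s t i \<longleftrightarrow> Tor s t i = {coset (tensor_boundaries (chosen_res s) t i) 0}"

end

theory Submission
  imports Defs "HOL-Library.Function_Algebras"
begin

text \<open>
  Let \<open>G\<close> be a minimal resolution of \<open>N\<close> with ranks \<open>c\<^sub>q\<close>, and write \<open>M\<^sub>p \<otimes> G\<close> as a complex
  of powers of the syzygy \<open>M\<^sub>p\<close>.  Dimension shifting and the symmetry of Tor make it exact at \<open>i - p\<close>
  for \<open>j \<le> i \<le> j + 2\<close>, as long as \<open>i - p > 0\<close>.  The matrices of \<open>G\<close> have entries in \<open>\<mm>\<close> and
  \<open>\<mm>\<^sup>2 M\<^sub>p = 0\<close>, so exactness forces the cycles and the boundaries to be \<open>\<mm> M\<^sub>p\<close> in each coordinate;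
  comparing lengths at two consecutive places gives \<open>c\<^sub>i\<^sub>+\<^sub>1 / c\<^sub>i = \<gamma>(M\<^sub>p)\<close>, and varying \<open>p\<close> and \<open>i\<close> shows
  that these numbers agree for \<open>i \<ge> 1\<close>.  Exactness at one place also shows \<open>Soc(M\<^sub>p) \<subseteq> \<mm> M\<^sub>p\<close>: a socle
  element, put into one coordinate, is a cycle.  For \<open>p = 1, 2\<close> this yields \<open>\<mm> M\<^sub>p = \<mm>\<^sup>2 F\<^sub>p\<^sub>-\<^sub>1\<close> and
  \<open>Soc(R) = \<mm>\<^sup>2\<close>, where \<open>F\<close> is a minimal resolution of \<open>M\<close>.  Counting lengths in
  \<open>0 \<rightarrow> M\<^sub>p \<rightarrow> F\<^sub>p\<^sub>-\<^sub>1 \<rightarrow> M\<^sub>p\<^sub>-\<^sub>1 \<rightarrow> 0\<close> then gives \<open>b\<^sub>p / b\<^sub>p\<^sub>-\<^sub>1 + \<gamma>(M\<^sub>p\<^sub>-\<^sub>1) = e\<close>, hence also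
  \<open>b\<^sub>1 / b\<^sub>0 = b\<^sub>2 / b\<^sub>1\<close>, and the sum and product formulas.  Finally \<open>\<gamma>(M)\<close> and \<open>\<gamma>(N)\<close> are the rational
  roots of a monic integer polynomial, so they are integers.
\<close>

section \<open>Length of chains of submodules\<close>

text \<open>
  A copy of \<^locale>\<open>module\<close>: names introduced in that locale itself would be hidden by its
  unqualified global interpretation for real vector spaces.
\<close>

locale ring_module = module s for s :: "'a::comm_ring_1 \<Rightarrow> 'b::ab_group_add \<Rightarrow> 'b" (infixr "*s" 75)
begin

definition ssum :: "'b set \<Rightarrow> 'b set \<Rightarrow> 'b set"
  where "ssum A B = {x + y |x y. x \<in> A \<and> y \<in> B}"

lemma subspace_ssum:
  assumes A: "subspace A" and B: "subspace B"
  shows "subspace (ssum A B)"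
proof (rule subspaceI)
  show "0 \<in> ssum A B"
    using subspace_0[OF A] subspace_0[OF B] by (force simp: ssum_def)
  fix x y assume "x \<in> ssum A B" "y \<in> ssum A B"
  then obtain a b a' b' where "x = a + b" "y = a' + b'" "a \<in> A" "b \<in> B" "a' \<in> A" "b' \<in> B"
    by (auto simp: ssum_def)
  then have "x + y = (a + a') + (b + b')" "a + a' \<in> A" "b + b' \<in> B"
    using subspace_add[OF A] subspace_add[OF B] by (auto simp: algebra_simps)
  then show "x + y \<in> ssum A B" by (force simp: ssum_def)
next
  fix c x assume "x \<in> ssum A B"
  then obtain a b where "x = a + b" "a \<in> A" "b \<in> B" by (auto simp: ssum_def)
  then have "c *s x = c *s a + c *s b" "c *s a \<in> A" "c *s b \<in> B"
    using subspace_scale[OF A] subspace_scale[OF B] by (auto simp: scale_right_distrib)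
  then show "c *s x \<in> ssum A B" by (force simp: ssum_def)
qed

lemma ssum_upper1: "subspace B \<Longrightarrow> A \<subseteq> ssum A B"
  unfolding ssum_def using subspace_0 by force

lemma ssum_upper2: "subspace A \<Longrightarrow> B \<subseteq> ssum A B"
  unfolding ssum_def using subspace_0 by force

lemma ssum_least: "subspace C \<Longrightarrow> A \<subseteq> C \<Longrightarrow> B \<subseteq> C \<Longrightarrow> ssum A B \<subseteq> C"
  unfolding ssum_def using subspace_add by blast

text \<open>Encodes that \<open>B / A\<close> is a simple module; pairs of nested submodules stand
  in for quotient modules.\<close>

definition covers :: "'b set \<Rightarrow> 'b set \<Rightarrow> bool"
  where "covers A B \<longleftrightarrow> subspace A \<and> subspace B \<and> A \<subset> B \<and>
           (\<forall>T. subspace T \<longrightarrow> A \<subseteq> T \<longrightarrow> T \<subseteq> B \<longrightarrow> T = A \<or> T = B)"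

text \<open>\<open>chain_length A B n\<close> says that the quotient \<open>B / A\<close> has length
  \<open>n\<close>. The relative form serves \<open>S / \<mm> S\<close> and \<open>\<mm> S\<close>
  alike.\<close>

inductive chain_length :: "'b set \<Rightarrow> 'b set \<Rightarrow> nat \<Rightarrow> bool" for A
  where
    refl: "subspace A \<Longrightarrow> chain_length A A 0"
  | step: "chain_length A B n \<Longrightarrow> covers B C \<Longrightarrow> chain_length A C (Suc n)"

lemma chain_length_subspace:
  "chain_length A B n \<Longrightarrow> subspace A \<and> subspace B \<and> A \<subseteq> B"
  by (induction rule: chain_length.induct) (auto simp: covers_def)

lemma chain_length_trans:
  "chain_length B C m \<Longrightarrow> chain_length A B n \<Longrightarrow> chain_length A C (n + m)"
  by (induction rule: chain_length.induct) (auto intro: chain_length.step)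

text \<open>Second isomorphism theorem: under \<open>Y \<inter> C \<subseteq> X\<close> the modular
  law gives \<open>Y \<inter> (X + C) = X\<close>, so \<open>(Y + C) / (X + C)\<close> is a copy of
  \<open>Y / X\<close>.\<close>

lemma covers_ssum:
  assumes cov: "covers X Y" and C: "subspace C" and sub: "Y \<inter> C \<subseteq> X"
  shows "covers (ssum X C) (ssum Y C)"
proof -
  have X: "subspace X" and Y: "subspace Y" and XY: "X \<subset> Y"
    and max: "\<And>T. subspace T \<Longrightarrow> X \<subseteq> T \<Longrightarrow> T \<subseteq> Y \<Longrightarrow> T = X \<or> T = Y"
    using cov by (auto simp: covers_def)
  have XC: "subspace (ssum X C)" and YC: "subspace (ssum Y C)"
    using X Y C by (auto intro: subspace_ssum)
  have le: "ssum X C \<subseteq> ssum Y C"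
    using XY by (auto simp: ssum_def)
  have mod: "z \<in> X" if zY: "z \<in> Y" and zX: "z \<in> ssum X C" for z
  proof -
    obtain x c where xc: "z = x + c" "x \<in> X" "c \<in> C"
      using zX by (auto simp: ssum_def)
    have "c = z - x" using xc by simp
    then have "c \<in> Y" using subspace_diff[OF Y zY] xc XY by blast
    then show ?thesis using xc sub subspace_add[OF X] by blast
  qed
  obtain y where y: "y \<in> Y" "y \<notin> X" using XY by blast
  have ne: "ssum X C \<noteq> ssum Y C"
    using y mod ssum_upper1[OF C, of Y] by blast
  have "T = ssum X C \<or> T = ssum Y C"
    if T: "subspace T" "ssum X C \<subseteq> T" "T \<subseteq> ssum Y C" for T
  proof -
    have CT: "C \<subseteq> T" using T(2) ssum_upper2[OF X] by blast
    have XT: "X \<subseteq> T" using T(2) ssum_upper1[OF C] by blast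
    have dec: "T \<subseteq> ssum (T \<inter> Y) C"
    proof
      fix z assume z: "z \<in> T"
      then obtain y c where yc: "z = y + c" "y \<in> Y" "c \<in> C"
        using T(3) by (auto simp: ssum_def)
      have "y = z - c" using yc by simp
      then have "y \<in> T" using subspace_diff[OF T(1) z] yc CT by blast
      then show "z \<in> ssum (T \<inter> Y) C" using yc by (auto simp: ssum_def)
    qed
    have "T \<inter> Y = X \<or> T \<inter> Y = Y"
      using max[of "T \<inter> Y"] subspace_inter[OF T(1) Y] XT XY by blast
    then show ?thesis
    proof
      assume "T \<inter> Y = X" then show ?thesis using dec T(2) by auto
    next
      assume "T \<inter> Y = Y"
      then have "Y \<subseteq> T" by blast
      then show ?thesis using ssum_least[OF T(1) _ CT, of Y] T(3) by blast
    qed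
  qed
  then show ?thesis using XC YC le ne unfolding covers_def by blast
qed

lemma chain_length_ssum:
  assumes "chain_length X Y n" "subspace C" "Y \<inter> C \<subseteq> X"
  shows "chain_length (ssum X C) (ssum Y C) n"
  using assms
proof (induction rule: chain_length.induct)
  case refl
  then show ?case by (intro chain_length.refl subspace_ssum)
next
  case (step B n D)
  then have sub: "D \<inter> C \<subseteq> B" "B \<inter> C \<subseteq> X"
    using chain_length_subspace[OF step.hyps(1)] by (auto simp: covers_def)
  show ?case
    using step sub covers_ssum by (blast intro: chain_length.step)
qed

lemma ssum_absorb: "subspace A \<Longrightarrow> subspace B \<Longrightarrow> A \<subseteq> B \<Longrightarrow> ssum A B = B"
  using ssum_least[of B A B] ssum_upper2[of A B] by blast

text \<open>Additivity of length, by induction along the chain. If \<open>C\<close> is not inside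
  the penultimate term \<open>B\<close>, then \<open>B + C = D\<close>, the step
  \<open>D / B\<close> becomes \<open>C / (C \<inter> B)\<close>, and adding \<open>C\<close> moves
  the part from \<open>C \<inter> B\<close> to \<open>B\<close> to a chain from \<open>C\<close> to
  \<open>D\<close>.\<close>

lemma chain_length_split:
  assumes "chain_length A B n" "subspace C" "A \<subseteq> C" "C \<subseteq> B"
  shows "\<exists>k l. chain_length A C k \<and> chain_length C B l \<and> k + l = n"
  using assms
proof (induction arbitrary: C rule: chain_length.induct)
  case refl
  then have "C = A" by blast
  then show ?case using chain_length.refl refl by auto
next
  case (step B n D)
  have B: "subspace A" "subspace B" "A \<subseteq> B"
    using chain_length_subspace[OF step.hyps(1)] by auto
  have D: "subspace D" "B \<subset> D"
    and max: "\<And>T. subspace T \<Longrightarrow> B \<subseteq> T \<Longrightarrow> T \<subseteq> D \<Longrightarrow> T = B \<or> T = D"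
    using step.hyps(2) by (auto simp: covers_def)
  show ?case
  proof (cases "C \<subseteq> B")
    case True
    then obtain k l where "chain_length A C k" "chain_length C B l" "k + l = n"
      using step by blast
    then show ?thesis using chain_length.step[OF _ step.hyps(2)] by (metis add_Suc_right)
  next
    case False
    note C = \<open>subspace C\<close>
    have BC: "ssum B C = D"
      using max[of "ssum B C"] subspace_ssum[OF B(2) C] ssum_upper1[OF C, of B] ssum_upper2[OF B(2), of C]
        ssum_least[OF D(1), of B C] False D step.prems by blast
    have int: "subspace (C \<inter> B)" using subspace_inter[OF C B(2)] .
    have cov: "covers (C \<inter> B) C"
      unfolding covers_def
    proof (intro conjI allI impI int C)
      show "C \<inter> B \<subset> C" using False by blast
      fix T assume T: "subspace T" "C \<inter> B \<subseteq> T" "T \<subseteq> C"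
      have "T = C \<inter> B" if "T \<subseteq> B" using T that by blast
      moreover have "T = C" if "\<not> T \<subseteq> B"
      proof -
        have "ssum B T = D"
          using max[of "ssum B T"] subspace_ssum[OF B(2) T(1)] ssum_upper1[OF T(1), of B]
            ssum_upper2[OF B(2), of T] ssum_least[OF D(1), of B T] that D step.prems T by blast
        have "C \<subseteq> T"
        proof
          fix c assume c: "c \<in> C"
          then have "c \<in> ssum B T" using \<open>ssum B T = D\<close> step.prems by blast
          then obtain b t where bt: "c = b + t" "b \<in> B" "t \<in> T" by (auto simp: ssum_def)
          have "b = c - t" using bt by simp
          then have "b \<in> C" using subspace_diff[OF C c] bt T by blast
          then show "c \<in> T" using bt T subspace_add[OF T(1)] by blast
        qed
        then show ?thesis using T by blast
      qed
      ultimately show "T = C \<inter> B \<or> T = C" by blast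
    qed
    obtain k l where kl: "chain_length A (C \<inter> B) k" "chain_length (C \<inter> B) B l" "k + l = n"
      using step.IH[OF int] B step.prems by blast
    have "chain_length (ssum (C \<inter> B) C) (ssum B C) l"
      using chain_length_ssum[OF kl(2) C] by blast
    then have "chain_length C D l"
      using BC ssum_absorb[OF int C] by simp
    moreover have "chain_length A C (Suc k)" using chain_length.step[OF kl(1) cov] .
    ultimately show ?thesis using kl(3) by (metis add_Suc)
  qed
qed

lemma chain_length_0_iff: "chain_length A B 0 \<longleftrightarrow> subspace A \<and> A = B"
  by (auto elim: chain_length.cases intro: chain_length.refl)

lemma chain_length_covers:
  assumes "chain_length A B n" "covers A B" shows "n = 1"
  using assms
proof (cases rule: chain_length.cases)
  case refl then show ?thesis using assms by (auto simp: covers_def)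
next
  case (step C m)
  have C: "subspace C" "A \<subseteq> C" "C \<subset> B"
    using chain_length_subspace[OF step(2)] step(3) by (auto simp: covers_def)
  then have "C = A" using assms(2) unfolding covers_def by blast
  moreover have "m = 0"
    using step(2) unfolding \<open>C = A\<close>
  proof (cases rule: chain_length.cases)
    case (step D k)
    then show ?thesis using chain_length_subspace[OF step(2)] by (auto simp: covers_def)
  qed
  ultimately show ?thesis using step by simp
qed

text \<open>Jordan-Hoelder for lengths: splitting one chain at the penultimate term \<open>C\<close>
  of the other leaves an upper part of length 1 by \<open>chain_length_covers\<close>, and induction
  applies below \<open>C\<close>.\<close>

theorem chain_length_unique:
  "chain_length A B n \<Longrightarrow> chain_length A B m \<Longrightarrow> n = m"
proof (induction n arbitrary: B m)
  case 0
  then have "A = B" by (simp add: chain_length_0_iff)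
  show ?case using 0(2)
  proof (cases rule: chain_length.cases)
    case (step C k)
    then show ?thesis using \<open>A = B\<close> chain_length_subspace[OF step(2)] by (auto simp: covers_def)
  qed simp
next
  case (Suc n)
  from Suc.prems(2) show ?case
  proof (cases rule: chain_length.cases)
    case refl
    from Suc.prems(1) show ?thesis
    proof (cases rule: chain_length.cases)
      case (step C)
      then show ?thesis using \<open>B = A\<close> chain_length_subspace[OF step(1)] by (auto simp: covers_def)
    qed
  next
    case (step C k)
    have C: "subspace C" "A \<subseteq> C" "C \<subseteq> B"
      using chain_length_subspace[OF step(2)] step(3) by (auto simp: covers_def)
    obtain p q where pq: "chain_length A C p" "chain_length C B q" "p + q = Suc n"
      using chain_length_split[OF Suc.prems(1) C] by blast
    have "q = 1" using chain_length_covers pq(2) step(3) by blast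
    then have "p = n" using pq by simp
    then have "n = k" using Suc.IH pq(1) step(2) by blast
    then show ?thesis using step by simp
  qed
qed

lemma chain_length_composition_series:
  "(\<exists>C. composition_series s S n C) \<longleftrightarrow> chain_length {0} S n"
proof
  assume "\<exists>C. composition_series s S n C"
  then obtain C where C: "C 0 = {0}" "C n = S" "\<And>i. i \<le> n \<Longrightarrow> subspace (C i)"
      "\<And>i. i < n \<Longrightarrow> C i \<subset> C (Suc i)"
      "\<And>i T. i < n \<Longrightarrow> subspace T \<Longrightarrow> \<not> (C i \<subset> T \<and> T \<subset> C (Suc i))"
    by (auto simp: composition_series_def)
  have "chain_length {0} (C i) i" if "i \<le> n" for i
    using that
  proof (induction i)
    case 0 then show ?case using C by (simp add: chain_length_0_iff subspace_single_0)
  next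
    case (Suc i)
    then have "covers (C i) (C (Suc i))"
      using C(3)[of i] C(3)[of "Suc i"] C(4)[of i] C(5)[of i] unfolding covers_def by auto
    then show ?case using Suc by (auto intro: chain_length.step)
  qed
  then show "chain_length {0} S n" using C by blast
next
  assume "chain_length {0} S n"
  then show "\<exists>C. composition_series s S n C"
  proof (induction rule: chain_length.induct)
    case refl
    then show ?case by (intro exI[of _ "\<lambda>_. {0}"]) (auto simp: composition_series_def)
  next
    case (step B n D)
    then obtain C where C: "composition_series s B n C" by blast
    have "composition_series s D (Suc n) (C(Suc n := D))"
      using C step.hyps(2) unfolding composition_series_def covers_def
      by (auto simp: less_Suc_eq le_Suc_eq)
    then show ?case by blast
  qed
qed

lemma module_length_eq:
  assumes "chain_length {0} S n" shows "module_length s S = n"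
  unfolding module_length_def chain_length_composition_series
  using assms chain_length_unique by (metis LeastI)

text \<open>Each step of the chain is generated, over the previous term, by any one new
  element.\<close>

lemma chain_length_span:
  assumes "chain_length A S n"
  shows "\<exists>B. finite B \<and> card B \<le> n \<and> S = ssum A (span B)"
  using assms
proof (induction rule: chain_length.induct)
  case refl
  have "A = ssum A (span {})" by (auto simp: ssum_def)
  then show ?case by (metis card.empty finite.emptyI order.refl)
next
  case (step C n D)
  then obtain B where B: "finite B" "card B \<le> n" "C = ssum A (span B)" by blast
  obtain x where x: "x \<in> D" "x \<notin> C" using step.hyps(2) by (auto simp: covers_def)
  have A: "subspace A" using chain_length_subspace[OF step.hyps(1)] by blast
  have D: "subspace D" "C \<subseteq> D" using step.hyps(2) by (auto simp: covers_def)
  let ?T = "ssum A (span (insert x B))"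
  have T: "subspace ?T" by (simp add: A subspace_ssum)
  have "C \<subseteq> ?T"
    unfolding B(3) ssum_def using span_mono[of B "insert x B"] by blast
  moreover have "x \<in> ?T"
    using ssum_upper2[OF A, of "span (insert x B)"] span_base[of x "insert x B"] by blast
  moreover have "?T \<subseteq> D"
  proof (rule ssum_least[OF D(1)])
    show "A \<subseteq> D" using chain_length_subspace[OF step.hyps(1)] D by blast
    have "B \<subseteq> C" unfolding B(3) using ssum_upper2[OF A, of "span B"] span_superset[of B] by auto
    then show "span (insert x B) \<subseteq> D" using D x by (intro span_minimal) auto
  qed
  ultimately have "D = ?T" using step.hyps(2) T x unfolding covers_def by blast
  moreover have "finite (insert x B)" "card (insert x B) \<le> Suc n"
    using B by (auto simp: card_insert_if)
  ultimately show ?case by blast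
qed

end

section \<open>Lengths under homomorphisms\<close>

lemma module_hom_subspace_vimage:
  assumes f: "module_hom s1 s2 f" and S: "module.subspace s1 S" and A: "module.subspace s2 A"
  shows "module.subspace s1 {x \<in> S. f x \<in> A}"
proof -
  interpret module_hom s1 s2 f by fact
  interpret m1: ring_module s1 ..
  interpret m2: ring_module s2 ..
  show ?thesis
    using S A by (auto simp: m1.subspace_def m2.subspace_def add scale zero)
qed

lemma covers_vimage:
  assumes f: "module_hom s1 s2 f" and S: "module.subspace s1 S"
    and cov: "ring_module.covers s2 A B" and surj: "B \<subseteq> f ` S"
  shows "ring_module.covers s1 {x \<in> S. f x \<in> A} {x \<in> S. f x \<in> B}"
proof -
  interpret module_hom s1 s2 f by fact
  interpret m1: ring_module s1 ..
  interpret m2: ring_module s2 ..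
  have A: "m2.subspace A" and B: "m2.subspace B" and AB: "A \<subset> B"
    and max: "\<And>T. m2.subspace T \<Longrightarrow> A \<subseteq> T \<Longrightarrow> T \<subseteq> B \<Longrightarrow> T = A \<or> T = B"
    using cov by (auto simp: m2.covers_def)
  show ?thesis
    unfolding m1.covers_def
  proof (intro conjI allI impI)
    show "m1.subspace {x \<in> S. f x \<in> A}" "m1.subspace {x \<in> S. f x \<in> B}"
      using module_hom_subspace_vimage[OF f S] A B by auto
    show "{x \<in> S. f x \<in> A} \<subset> {x \<in> S. f x \<in> B}"
      using AB surj by blast
    fix T assume T: "m1.subspace T" "{x \<in> S. f x \<in> A} \<subseteq> T" "T \<subseteq> {x \<in> S. f x \<in> B}"
    have fT: "m2.subspace (f ` T)" using subspace_image[OF T(1)] .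
    have "A \<subseteq> f ` T" using surj T(2) AB by blast
    then have "f ` T = A \<or> f ` T = B" using max[OF fT] T(3) by blast
    moreover have "{x \<in> S. f x \<in> B} \<subseteq> T" if fTB: "f ` T = B"
    proof
      fix x assume x: "x \<in> {x \<in> S. f x \<in> B}"
      then obtain t where t: "t \<in> T" "f x = f t" using fTB by auto
      then have "x - t \<in> {x \<in> S. f x \<in> A}"
        using x T(3) m1.subspace_diff[OF S] m2.subspace_0[OF A] by (auto simp: diff)
      then have "x - t + t \<in> T" using m1.subspace_add[OF T(1)] T(2) t by blast
      then show "x \<in> T" by simp
    qed
    ultimately show "T = {x \<in> S. f x \<in> A} \<or> T = {x \<in> S. f x \<in> B}"
      using T by blast
  qed
qed

text \<open>Surjectivity onto \<open>B\<close> identifies the quotient of the two preimages with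
  \<open>B / A\<close>. This and its counterpart for images do the work of short exact
  sequences.\<close>

lemma chain_length_vimage:
  assumes f: "module_hom s1 s2 f" and S: "module.subspace s1 S"
    and "ring_module.chain_length s2 A B n" and "B \<subseteq> f ` S"
  shows "ring_module.chain_length s1 {x \<in> S. f x \<in> A} {x \<in> S. f x \<in> B} n"
proof -
  interpret module_hom s1 s2 f by fact
  interpret m1: ring_module s1 ..
  interpret m2: ring_module s2 ..
  show ?thesis using assms(3,4)
  proof (induction rule: m2.chain_length.induct)
    case refl
    then show ?case using module_hom_subspace_vimage[OF f S] by (intro m1.chain_length.refl) auto
  next
    case (step B n C)
    then have "B \<subseteq> f ` S" by (auto simp: m2.covers_def)
    then show ?case
      using step covers_vimage[OF f S] by (blast intro: m1.chain_length.step)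
  qed
qed

text \<open>The last assumption puts the part of the kernel inside \<open>B\<close> into
  \<open>A\<close>, so \<open>f\<close> is injective on \<open>B / A\<close> and every step stays
  proper and simple.\<close>

lemma chain_length_image:
  assumes f: "module_hom s1 s2 f" and "ring_module.chain_length s1 A B n"
    and "\<And>x. x \<in> B \<Longrightarrow> f x = 0 \<Longrightarrow> x \<in> A"
  shows "ring_module.chain_length s2 (f ` A) (f ` B) n"
proof -
  interpret module_hom s1 s2 f by fact
  interpret m1: ring_module s1 ..
  interpret m2: ring_module s2 ..
  show ?thesis using assms(2,3)
  proof (induction rule: m1.chain_length.induct)
    case refl
    then show ?case by (intro m2.chain_length.refl subspace_image)
  next
    case (step B n C)
    have B: "m1.subspace B" "A \<subseteq> B" using m1.chain_length_subspace[OF step.hyps(1)] by auto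
    have C: "m1.subspace C" "B \<subset> C"
      and max: "\<And>T. m1.subspace T \<Longrightarrow> B \<subseteq> T \<Longrightarrow> T \<subseteq> C \<Longrightarrow> T = B \<or> T = C"
      using step.hyps(2) by (auto simp: m1.covers_def)
    have pre: "x \<in> T" if pre: "x \<in> C" "f x \<in> f ` T" "m1.subspace T" "B \<subseteq> T" "T \<subseteq> C" for x T
    proof -
      obtain b where b: "b \<in> T" "f x = f b" using pre by blast
      then have "x - b \<in> A"
        using pre m1.subspace_diff[OF C(1)] by (intro step.prems) (auto simp: diff)
      then have "x - b + b \<in> T" using m1.subspace_add[OF pre(3)] B b pre by blast
      then show ?thesis by simp
    qed
    have "m2.covers (f ` B) (f ` C)"
      unfolding m2.covers_def
    proof (intro conjI allI impI)
      show "m2.subspace (f ` B)" "m2.subspace (f ` C)" using B C by (auto intro: subspace_image)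
      show "f ` B \<subset> f ` C" using C pre[OF _ _ B(1)] by blast
      fix U assume U: "m2.subspace U" "f ` B \<subseteq> U" "U \<subseteq> f ` C"
      let ?T = "{x \<in> C. f x \<in> U}"
      have "?T = B \<or> ?T = C"
        using max[of ?T] module_hom_subspace_vimage[OF f C(1) U(1)] U C by blast
      moreover have "f ` ?T = U" using U by blast
      ultimately show "U = f ` B \<or> U = f ` C" by auto
    qed
    moreover have "m2.chain_length (f ` A) (f ` B) n"
      using step C by blast
    ultimately show ?case by (blast intro: m2.chain_length.step)
  qed
qed

section \<open>Local rings with vanishing cube of the maximal ideal\<close>

interpretation rg: ring_module "(*) :: 'a::comm_ring_1 \<Rightarrow> 'a \<Rightarrow> 'a"
  by (simp add: ring_module.intro module_mult)

interpretation pm: ring_module "pm_scale :: 'a::comm_ring_1 \<Rightarrow> ('x \<Rightarrow>\<^sub>0 'a) \<Rightarrow> ('x \<Rightarrow>\<^sub>0 'a)"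
  by (simp add: ring_module.intro module_pm_scale)

text \<open>As a simp rule it loops with associativity in \<open>algebra_simps\<close>.\<close>

declare rg.scale_scale [simp del]

locale cube_zero_ring =
  fixes \<mm> :: "'a::comm_ring_1 set"
  assumes artinian: "artinian_ring TYPE('a)"
    and local: "local_ring \<mm>"
    and cube_zero: "ideal_power \<mm> 3 = {0}"
begin

lemma ideal_mm: "rg.subspace \<mm>"
  using local by (simp add: local_ring_def maximal_ideal_def)

lemma mult_mm: "x \<in> \<mm> \<Longrightarrow> r * x \<in> \<mm>"
  using rg.subspace_scale[OF ideal_mm] .

lemma mult_mm': "x \<in> \<mm> \<Longrightarrow> x * r \<in> \<mm>"
  using mult_mm[of x r] by (simp add: mult.commute)

lemma add_mm: "x \<in> \<mm> \<Longrightarrow> y \<in> \<mm> \<Longrightarrow> x + y \<in> \<mm>"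
  using rg.subspace_add[OF ideal_mm] .

lemma diff_mm: "x \<in> \<mm> \<Longrightarrow> y \<in> \<mm> \<Longrightarrow> x - y \<in> \<mm>"
  using rg.subspace_diff[OF ideal_mm] .

lemma zero_mm: "0 \<in> \<mm>"
  using rg.subspace_0[OF ideal_mm] .

lemma one_notin_mm: "1 \<notin> \<mm>"
proof
  assume "1 \<in> \<mm>"
  then have "\<mm> = UNIV" using mult_mm[of 1] by auto
  then show False using local by (simp add: local_ring_def maximal_ideal_def)
qed

lemma mult3_eq_0:
  assumes "r1 \<in> \<mm>" "r2 \<in> \<mm>" "r3 \<in> \<mm>" shows "r1 * (r2 * r3) = 0"
proof -
  \<comment> \<open>The trailing factor 1 comes from
    \<open>ideal_power \<mm> 0 = UNIV\<close>.\<close>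
  have "r1 * (r2 * (r3 * 1)) \<in> ideal_power \<mm> 3"
    unfolding numeral_3_eq_3 ideal_power.simps ideal_smult_def
    by (rule rg.span_base, use assms in \<open>blast intro: rg.span_base\<close>)
  then show ?thesis using cube_zero by simp
qed

text \<open>By maximality \<open>1 = y + k * x\<close> with \<open>y \<in> \<mm>\<close>. Since
  \<open>y\<close> has cube zero, \<open>1 + y + y * y\<close> inverts
  \<open>1 - y = k * x\<close>.\<close>

lemma unit:
  assumes "x \<notin> \<mm>" obtains y where "y * x = 1"
proof -
  let ?J = "rg.ssum \<mm> (rg.span {x})"
  have "rg.subspace ?J" by (simp add: ideal_mm rg.subspace_ssum)
  moreover have "\<mm> \<subseteq> ?J" by (simp add: rg.ssum_upper1)
  moreover have "x \<in> ?J"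
    using rg.ssum_upper2[OF ideal_mm, of "rg.span {x}"] rg.span_base[of x "{x}"] by blast
  ultimately have "?J = UNIV"
    using local assms unfolding local_ring_def maximal_ideal_def by blast
  then have "1 \<in> ?J" by simp
  then obtain y k where y: "y \<in> \<mm>" "1 = y + k * x"
    by (auto simp: rg.ssum_def rg.span_singleton)
  have "y * (y * y) = 0" using mult3_eq_0 y by blast
  moreover have "k * x = 1 - y" using y(2) by (metis add_diff_cancel_left')
  then have "((1 + y + y * y) * k) * x = (1 + y + y * y) * (1 - y)" by (simp add: mult.assoc)
  moreover have "(1 + y + y * y) * (1 - y) = 1 - y * (y * y)" by (simp add: algebra_simps)
  ultimately have "((1 + y + y * y) * k) * x = 1" by simp
  then show thesis using that by blast
qed

lemma ideal_power_1: "ideal_smult (*) \<mm> UNIV = \<mm>"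
proof
  show "ideal_smult (*) \<mm> UNIV \<subseteq> \<mm>"
    unfolding ideal_smult_def by (rule rg.span_minimal[OF _ ideal_mm]) (auto intro: mult_mm')
  show "\<mm> \<subseteq> ideal_smult (*) \<mm> UNIV"
  proof
    fix x assume "x \<in> \<mm>"
    then have "x * 1 \<in> ideal_smult (*) \<mm> UNIV"
      unfolding ideal_smult_def by (blast intro: rg.span_base)
    then show "x \<in> ideal_smult (*) \<mm> UNIV" by simp
  qed
qed

end

section \<open>Generators and lengths of modules over the local ring\<close>

locale cube_zero_module = cube_zero_ring \<mm> + ring_module s
  for \<mm> :: "'a::comm_ring_1 set" and s :: "'a \<Rightarrow> 'b::ab_group_add \<Rightarrow> 'b" (infixr "*s" 75)
begin

abbreviation mS :: "'b set \<Rightarrow> 'b set"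
  where "mS S \<equiv> ideal_smult s \<mm> S"

lemma mS_I: "r \<in> \<mm> \<Longrightarrow> x \<in> S \<Longrightarrow> r *s x \<in> mS S"
  unfolding ideal_smult_def by (blast intro: span_base)

lemma subspace_mS: "subspace (mS S)"
  unfolding ideal_smult_def by (rule subspace_span)

lemma mS_least: "subspace T \<Longrightarrow> (\<And>r x. r \<in> \<mm> \<Longrightarrow> x \<in> S \<Longrightarrow> r *s x \<in> T) \<Longrightarrow> mS S \<subseteq> T"
  unfolding ideal_smult_def by (rule span_minimal) auto

lemma mS_subset: "subspace S \<Longrightarrow> mS S \<subseteq> S"
  by (rule mS_least) (auto intro: subspace_scale)

text \<open>The quotient of \<open>A + R x\<close> by \<open>A\<close> is a copy of the residue
  field: an element \<open>a + k x\<close> outside \<open>A\<close> has \<open>k\<close> outside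
  \<open>\<mm>\<close>, hence a unit, so it gives back \<open>x\<close>.\<close>

lemma covers_add_cyclic:
  assumes A: "subspace A" and x: "x \<notin> A" and mx: "\<And>r. r \<in> \<mm> \<Longrightarrow> r *s x \<in> A"
  shows "covers A (ssum A (span {x}))"
proof -
  let ?B = "ssum A (span {x})"
  have xB: "x \<in> ?B"
    using ssum_upper2[OF A, of "span {x}"] span_base[of x "{x}"] by blast
  have "T = A \<or> T = ?B" if T: "subspace T" "A \<subseteq> T" "T \<subseteq> ?B" for T
  proof (cases "T = A")
    case False
    then obtain y where y: "y \<in> T" "y \<notin> A" using T by blast
    then obtain a k where ak: "y = a + k *s x" "a \<in> A"
      using T by (auto simp: ssum_def span_singleton)
    have "k \<notin> \<mm>" using ak y mx subspace_add[OF A] by blast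
    then obtain w where w: "w * k = 1" using unit by blast
    have "k *s x = y - a" using ak by simp
    moreover have "y - a \<in> T" using y(1) ak(2) T(2) by (intro subspace_diff[OF T(1)]) auto
    ultimately have "k *s x \<in> T" by simp
    then have "w *s (k *s x) \<in> T" using subspace_scale[OF T(1)] by blast
    then have "x \<in> T" using w by simp
    then have "?B \<subseteq> T"
      using ssum_least[OF T(1) T(2)] span_minimal[of "{x}" T] T(1) by blast
    then show ?thesis using T by blast
  qed simp
  moreover have "A \<subseteq> ?B" by (simp add: ssum_upper1)
  ultimately show ?thesis
    using A x xB subspace_ssum[OF A] by (auto simp: covers_def)
qed

lemma span_insert_ssum: "span (insert x B) = ssum (span B) (span {x})"
proof
  have "insert x B \<subseteq> ssum (span B) (span {x})"
    using ssum_upper1[of "span {x}" "span B"] ssum_upper2[of "span B" "span {x}"]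
      span_superset[of B] span_base[of x "{x}"] by auto
  then show "span (insert x B) \<subseteq> ssum (span B) (span {x})"
    by (rule span_minimal) (simp add: subspace_ssum)
  show "ssum (span B) (span {x}) \<subseteq> span (insert x B)"
    using span_mono[of B "insert x B"] span_mono[of "{x}" "insert x B"] by (intro ssum_least) auto
qed

lemma ssum_assoc: "ssum (ssum A B) C = ssum A (ssum B C)"
proof (intro equalityI subsetI)
  fix x assume "x \<in> ssum (ssum A B) C"
  then obtain a b c where "x = a + (b + c)" "a \<in> A" "b \<in> B" "c \<in> C"
    by (auto simp: ssum_def add.assoc)
  then show "x \<in> ssum A (ssum B C)" unfolding ssum_def by blast
next
  fix x assume "x \<in> ssum A (ssum B C)"
  then obtain a b c where "x = (a + b) + c" "a \<in> A" "b \<in> B" "c \<in> C"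
    by (auto simp: ssum_def add.assoc[symmetric])
  then show "x \<in> ssum (ssum A B) C" unfolding ssum_def by blast
qed

text \<open>Of the generators, adjoined one at a time, each either changes nothing or adds one
  simple step.\<close>

lemma chain_length_add_span:
  assumes "finite B" "subspace A" "\<And>x r. x \<in> B \<Longrightarrow> r \<in> \<mm> \<Longrightarrow> r *s x \<in> A"
  shows "\<exists>k\<le>card B. chain_length A (ssum A (span B)) k"
  using assms
proof (induction B)
  case empty
  have "ssum A (span {}) = A" by (auto simp: ssum_def)
  then show ?case using empty by (auto intro: chain_length.refl)
next
  case (insert x B)
  then obtain k where k: "k \<le> card B" "chain_length A (ssum A (span B)) k" by auto
  let ?C = "ssum A (span B)"
  have C: "subspace ?C" "A \<subseteq> ?C" using insert.prems by (auto simp: subspace_ssum ssum_upper1)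
  have eq: "ssum A (span (insert x B)) = ssum ?C (span {x})"
    by (simp only: span_insert_ssum[of x B] ssum_assoc)
  show ?case
  proof (cases "x \<in> ?C")
    case True
    then have "span {x} \<subseteq> ?C" using C by (intro span_minimal) auto
    then have "ssum ?C (span {x}) = ?C"
      using ssum_least[OF C(1)] ssum_upper1[of "span {x}" ?C] by auto
    then show ?thesis using eq k insert.hyps by (intro exI[of _ k]) auto
  next
    case False
    then have "covers ?C (ssum ?C (span {x}))"
      using covers_add_cyclic[OF C(1)] insert.prems C by blast
    then show ?thesis
      using eq k insert.hyps by (intro exI[of _ "Suc k"]) (auto intro: chain_length.step)
  qed
qed

lemma subspace_colon:
  assumes "subspace T" shows "subspace {u. r *s u \<in> T}"
proof (rule subspaceI)
  show "0 \<in> {u. r *s u \<in> T}" using subspace_0[OF assms] by simp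
  fix x y assume "x \<in> {u. r *s u \<in> T}" "y \<in> {u. r *s u \<in> T}"
  then show "x + y \<in> {u. r *s u \<in> T}" using subspace_add[OF assms] by (simp add: scale_right_distrib)
next
  fix c x assume "x \<in> {u. r *s u \<in> T}"
  then have "c *s (r *s x) \<in> T" using subspace_scale[OF assms] by blast
  then show "c *s x \<in> {u. r *s u \<in> T}" by (simp add: mult.commute)
qed

text \<open>Nilpotence carries the proof. Multiplying \<open>S = \<mm> S + span B\<close> by two
  elements of \<open>\<mm>\<close> kills the first summand, so \<open>\<mm>^2 S\<close> lies in the
  span; reinserting this puts \<open>\<mm> S\<close>, and then \<open>S\<close>, there.\<close>

lemma nakayama:
  assumes S: "subspace S" and gen: "S = ssum (mS S) (span B)"
  shows "S = span B"
proof -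
  have BS: "span B \<subseteq> S" using gen ssum_upper2[OF subspace_mS, of "span B"] by blast
  have dec: "\<exists>u v. x = u + v \<and> u \<in> mS S \<and> v \<in> span B" if "x \<in> S" for x
    using gen that by (auto simp: ssum_def)
  have 2: "(r * q) *s x \<in> span B" if r: "r \<in> \<mm>" and q: "q \<in> \<mm>" and x: "x \<in> S" for r q x
  proof -
    obtain u v where uv: "x = u + v" "u \<in> mS S" "v \<in> span B" using dec x by blast
    have "mS S \<subseteq> {u. (r * q) *s u \<in> {0}}"
    proof (rule mS_least[OF subspace_colon])
      fix p y assume "p \<in> \<mm>" "y \<in> S"
      then have "r * q * p = 0" using mult3_eq_0[OF r q] by (metis mult.assoc)
      then show "p *s y \<in> {u. (r * q) *s u \<in> {0}}" by simp
    qed simp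
    then have "(r * q) *s u = 0" using uv by auto
    then have "(r * q) *s x = (r * q) *s v" by (simp add: uv(1) scale_right_distrib)
    then show ?thesis using uv span_scale by metis
  qed
  have 1: "r *s x \<in> span B" if r: "r \<in> \<mm>" and x: "x \<in> S" for r x
  proof -
    obtain u v where uv: "x = u + v" "u \<in> mS S" "v \<in> span B" using dec x by blast
    have "mS S \<subseteq> {u. r *s u \<in> span B}"
    proof (rule mS_least[OF subspace_colon])
      fix p y assume "p \<in> \<mm>" "y \<in> S"
      then show "p *s y \<in> {u. r *s u \<in> span B}" using 2[OF r] by simp
    qed simp
    then show ?thesis using uv by (auto simp: scale_right_distrib intro!: span_add intro: span_scale)
  qed
  have "mS S \<subseteq> span B" by (rule mS_least) (auto intro: 1)
  then show ?thesis using gen BS ssum_least[of "span B" "mS S" "span B"] by auto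
qed

text \<open>Identifies \<nu>(S) with the length of \<open>S / \<mm> S\<close>. The size of a
  generating set bounds that length; conversely the chain yields at most \<open>n\<close> elements
  generating modulo \<open>\<mm> S\<close>, and Nakayama lifts them.\<close>

lemma min_gens_eq:
  assumes S: "subspace S" and n: "chain_length (mS S) S n"
  shows "min_gens s S = n" and "\<exists>B. finite B \<and> card B = n \<and> span B = S"
proof -
  have lower: "n \<le> card B" if B: "finite B" "span B = S" for B
  proof -
    have "r *s x \<in> mS S" if "x \<in> B" "r \<in> \<mm>" for x r
      using that B span_superset[of B] by (auto intro: mS_I)
    then obtain k where "k \<le> card B" "chain_length (mS S) (ssum (mS S) (span B)) k"
      using chain_length_add_span[OF B(1) subspace_mS] by blast
    then show ?thesis
      using chain_length_unique[OF n] ssum_absorb[OF subspace_mS S mS_subset[OF S]] B by simp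
  qed
  obtain B where B: "finite B" "card B \<le> n" "S = ssum (mS S) (span B)"
    using chain_length_span[OF n] by blast
  then have "span B = S" using nakayama[OF S] by blast
  then have "card B = n" using lower B by (simp add: le_antisym)
  then show ex: "\<exists>B. finite B \<and> card B = n \<and> span B = S" using B \<open>span B = S\<close> by blast
  show "min_gens s S = n"
    unfolding min_gens_def using ex lower by (intro Least_equality) auto
qed

lemma min_gens_basis:
  assumes "finitely_generated s S"
  shows "\<exists>B. finite B \<and> card B = min_gens s S \<and> span B = S"
  unfolding min_gens_def
  by (rule LeastI_ex) (use assms in \<open>auto simp: finitely_generated_def\<close>)

lemma min_gens_le: "finite B \<Longrightarrow> span B = S \<Longrightarrow> min_gens s S \<le> card B"
  unfolding min_gens_def by (intro Least_le) auto

text \<open>A coefficient outside \<open>\<mm>\<close> would be a unit, and \<open>b\<close> could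
  be dropped from the generators. This is the source of minimality in the resolutions below.\<close>

lemma min_gens_relation:
  assumes B: "finite B" "card B = min_gens s (span B)"
    and rel: "(\<Sum>b\<in>B. u b *s b) = 0" and b: "b \<in> B"
  shows "u b \<in> \<mm>"
proof (rule ccontr)
  assume "u b \<notin> \<mm>"
  then obtain w where w: "w * u b = 1" using unit by blast
  have "u b *s b + (\<Sum>c\<in>B - {b}. u c *s c) = 0"
    using rel B b by (simp add: sum.remove)
  then have "u b *s b = - (\<Sum>c\<in>B - {b}. u c *s c)" by (simp add: eq_neg_iff_add_eq_0)
  then have "u b *s b \<in> span (B - {b})"
    by (simp only:) (intro span_neg span_sum span_scale span_base)
  then have "(w * u b) *s b \<in> span (B - {b})" using span_scale[of "u b *s b" _ w] by simp
  then have "b \<in> span (B - {b})" using w by simp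
  then have "B \<subseteq> span (B - {b})" using span_superset[of "B - {b}"] by blast
  then have "span (B - {b}) = span B"
    using span_minimal[of B "span (B - {b})"] span_mono[of "B - {b}" B] by auto
  then have "min_gens s (span B) \<le> card (B - {b})" using B by (intro min_gens_le) auto
  then show False using B b by (metis card_Diff1_less not_le)
qed

section \<open>Dimension over the residue field\<close>

lemma residue_act_coset:
  assumes "\<And>q. q \<in> \<mm> \<Longrightarrow> q *s x = 0"
  shows "residue_act s (coset \<mm> r) x = r *s x"
proof -
  have "r \<in> coset \<mm> r" using zero_mm by (force simp: coset_def)
  then have "(SOME q. q \<in> coset \<mm> r) \<in> coset \<mm> r" by (rule someI)
  then obtain q where "(SOME q. q \<in> coset \<mm> r) = r + q" "q \<in> \<mm>" by (auto simp: coset_def)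
  then show ?thesis using assms by (simp add: residue_act_def scale_left_distrib)
qed

lemma coset_eq_iff: "coset \<mm> r = coset \<mm> q \<longleftrightarrow> r - q \<in> \<mm>"
proof
  assume "coset \<mm> r = coset \<mm> q"
  moreover have "r \<in> coset \<mm> r" using zero_mm by (force simp: coset_def)
  ultimately show "r - q \<in> \<mm>" by (auto simp: coset_def)
next
  assume d: "r - q \<in> \<mm>"
  have "coset \<mm> x \<subseteq> coset \<mm> y" if "x - y \<in> \<mm>" for x y
  proof
    fix z assume "z \<in> coset \<mm> x"
    then obtain b where "z = x + b" "b \<in> \<mm>" by (auto simp: coset_def)
    then have "z = y + ((x - y) + b)" "(x - y) + b \<in> \<mm>" using add_mm that by auto
    then show "z \<in> coset \<mm> y" unfolding coset_def by blast
  qed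
  moreover have "q - r \<in> \<mm>" using diff_mm[OF zero_mm d] by simp
  ultimately show "coset \<mm> r = coset \<mm> q" using d by blast
qed

context
  fixes V assumes V: "subspace V" and mV: "\<And>r x. r \<in> \<mm> \<Longrightarrow> x \<in> V \<Longrightarrow> r *s x = 0"
begin

text \<open>Adjoining basis vectors one by one gives a chain from 0 to \<open>V\<close>; uniqueness
  of coordinates makes every step proper.\<close>

lemma residue_basis_chain_length:
  assumes B: "residue_basis s \<mm> V B"
  shows "chain_length {0} V (card B)"
proof -
  have fin: "finite B" and BV: "B \<subseteq> V"
    and uniq: "\<And>x. x \<in> V \<Longrightarrow> \<exists>!c. c \<in> B \<rightarrow>\<^sub>E quotient_set UNIV \<mm> \<and> x = (\<Sum>b\<in>B. residue_act s (c b) b)"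
    using B by (auto simp: residue_basis_def)
  have act: "residue_act s (coset \<mm> r) b = r *s b" if "b \<in> B" for r b
    using residue_act_coset mV BV that by blast
  \<comment> \<open>\<open>f\<close> reduces ring coefficients to the residue field, where
    coordinates are unique; two ring expansions of one vector thus agree modulo
    \<open>\<mm>\<close>.\<close>
  define f where "f u = restrict (\<lambda>b. coset \<mm> (u b)) B" for u :: "'b \<Rightarrow> 'a"
  have f: "f u \<in> B \<rightarrow>\<^sub>E quotient_set UNIV \<mm>"
      "(\<Sum>b\<in>B. residue_act s (f u b) b) = (\<Sum>b\<in>B. u b *s b)" for u
    by (auto simp: f_def quotient_set_def act intro!: sum.cong)
  have cancel: "u b - v b \<in> \<mm>"
    if uv: "(\<Sum>b\<in>B. u b *s b) = (\<Sum>b\<in>B. v b *s b)" and b: "b \<in> B" for u v b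
  proof -
    have "(\<Sum>b\<in>B. u b *s b) \<in> V" using BV by (auto intro!: subspace_sum subspace_scale V)
    then obtain d where d: "\<And>c. c \<in> B \<rightarrow>\<^sub>E quotient_set UNIV \<mm> \<and>
        (\<Sum>b\<in>B. u b *s b) = (\<Sum>b\<in>B. residue_act s (c b) b) \<Longrightarrow> c = d"
      using ex1E[OF uniq[OF \<open>(\<Sum>b\<in>B. u b *s b) \<in> V\<close>], of thesis] by metis
    have "f u = d" using f[of u] by (intro d) simp
    moreover have "f v = d" using f[of v] uv by (intro d) simp
    ultimately have "f u = f v" by simp
    then have "f u b = f v b" by simp
    then show ?thesis using b by (simp add: f_def coset_eq_iff)
  qed
  have "chain_length {0} (span B') (card B')" if "B' \<subseteq> B" for B'
    using finite_subset[OF that fin] that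
  proof (induction B')
    case empty then show ?case by (simp add: chain_length_0_iff)
  next
    case (insert x B')
    have "x \<notin> span B'"
    proof
      assume "x \<in> span B'"
      then obtain u where u: "x = (\<Sum>b\<in>B'. u b *s b)"
        using span_finite[of B'] insert.hyps by auto
      \<comment> \<open>Extending \<open>u\<close> by 0 allows comparing two expansions of
        \<open>x\<close> over \<open>B\<close>; their coefficients at \<open>x\<close> are 0 and 1,
        which would put 1 into \<open>\<mm>\<close>.\<close>
      define v where "v b = (if b \<in> B' then u b else 0)" for b
      have "(\<Sum>b\<in>B. v b *s b) = (\<Sum>b\<in>B'. v b *s b)"
        by (rule sum.mono_neutral_right) (use insert fin in \<open>auto simp: v_def\<close>)
      also have "\<dots> = x" unfolding u by (rule sum.cong) (auto simp: v_def)
      also have "x = (\<Sum>b\<in>B. if b = x then b else 0)"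
        using insert.prems fin by (simp add: sum.delta)
      also have "\<dots> = (\<Sum>b\<in>B. (if b = x then 1 else 0) *s b)"
        by (rule sum.cong) auto
      finally have "v x - (if x = x then 1 else 0) \<in> \<mm>"
        by (rule cancel) (use insert.prems in auto)
      then have "0 - 1 \<in> \<mm>" using insert.hyps by (simp add: v_def)
      then have "0 - (0 - 1) \<in> \<mm>" by (rule diff_mm[OF zero_mm])
      then show False using one_notin_mm by simp
    qed
    then have "covers (span B') (ssum (span B') (span {x}))"
      using insert.prems BV mV by (intro covers_add_cyclic) (auto simp: span_zero)
    then show ?case
      using insert span_insert_ssum[of x B'] by (auto intro: chain_length.step)
  qed
  moreover have "span B = V"
  proof
    show "span B \<subseteq> V" by (rule span_minimal[OF BV V])
    show "V \<subseteq> span B"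
    proof
      fix x assume "x \<in> V"
      then obtain c where c: "c \<in> B \<rightarrow>\<^sub>E quotient_set UNIV \<mm>" "x = (\<Sum>b\<in>B. residue_act s (c b) b)"
        using uniq by blast
      then show "x \<in> span B"
        by (simp only: c(2) residue_act_def) (intro span_sum span_scale span_base)
    qed
  qed
  ultimately show ?thesis by blast
qed

text \<open>Spanning gives existence of coordinates; \<open>min_gens_relation\<close>, applied to
  the difference of two expansions, gives uniqueness modulo \<open>\<mm>\<close>.\<close>

lemma residue_basis_minimal:
  assumes B: "finite B" "span B = V" "card B = min_gens s V"
  shows "residue_basis s \<mm> V B"
  unfolding residue_basis_def
proof (intro conjI ballI)
  show "finite B" by fact
  show BV: "B \<subseteq> V" using B span_superset[of B] by auto
  have act: "residue_act s (coset \<mm> r) b = r *s b" if "b \<in> B" for r b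
    using residue_act_coset mV BV that by blast
  fix x assume x: "x \<in> V"
  then obtain u where u: "x = (\<Sum>b\<in>B. u b *s b)" using span_finite[of B] B by auto
  let ?P = "\<lambda>c. c \<in> B \<rightarrow>\<^sub>E quotient_set UNIV \<mm> \<and> x = (\<Sum>b\<in>B. residue_act s (c b) b)"
  show "\<exists>!c. ?P c"
  proof (rule ex1I)
    show "?P (restrict (\<lambda>b. coset \<mm> (u b)) B)"
      by (auto simp: quotient_set_def act u intro!: sum.cong)
    fix c assume c: "?P c"
    then have "\<forall>b. \<exists>r. b \<in> B \<longrightarrow> c b = coset \<mm> r" by (auto simp: quotient_set_def PiE_iff)
    then obtain v where v: "\<And>b. b \<in> B \<Longrightarrow> c b = coset \<mm> (v b)" by metis
    have "x = (\<Sum>b\<in>B. v b *s b)" using c by (auto simp: v act intro!: sum.cong)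
    then have "(\<Sum>b\<in>B. (v b - u b) *s b) = 0"
      using u by (simp add: scale_left_diff_distrib sum_subtractf)
    then have "v b - u b \<in> \<mm>" if "b \<in> B" for b
      using min_gens_relation[OF B(1), of "\<lambda>b. v b - u b"] B that by simp
    then have "coset \<mm> (v b) = coset \<mm> (u b)" if "b \<in> B" for b
      using that by (simp add: coset_eq_iff)
    then show "c = restrict (\<lambda>b. coset \<mm> (u b)) B"
      using c v by (intro ext) (simp add: PiE_iff extensional_def restrict_def)
  qed
qed

text \<open>As \<open>\<mm> V = 0\<close>, the length of \<open>V\<close> is that of
  \<open>V / \<mm> V\<close>, so \<open>V\<close> has a minimal generating set of size
  \<open>n\<close>, which is a residue basis.\<close>

lemma residue_dim_eq:
  assumes n: "chain_length {0} V n"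
  shows "residue_dim s \<mm> V = n"
proof -
  have "mS V = {0}" using mS_least[of "{0}" V] mV subspace_0[OF subspace_mS] by auto
  then obtain B where B: "finite B" "card B = n" "span B = V" "min_gens s V = n"
    using min_gens_eq[OF V, of n] n by auto
  then have "residue_basis s \<mm> V B" using residue_basis_minimal by simp
  moreover have "card B' = n" if "residue_basis s \<mm> V B'" for B'
    using residue_basis_chain_length[OF that] chain_length_unique n by blast
  ultimately show ?thesis
    unfolding residue_dim_def using B(2) by (intro the_equality) auto
qed

end

end

section \<open>Finite length of the ring\<close>

context cube_zero_ring begin

lemma module_cube_zero: "module s \<Longrightarrow> cube_zero_module \<mm> s"
  by (simp add: cube_zero_module_def cube_zero_ring_axioms ring_module.intro)

sublocale R: cube_zero_module \<mm> "(*)"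
  by (rule module_cube_zero[OF module_mult])

sublocale P: cube_zero_module \<mm> "pm_scale :: 'a \<Rightarrow> ('x \<Rightarrow>\<^sub>0 'a) \<Rightarrow> ('x \<Rightarrow>\<^sub>0 'a)"
  by (rule module_cube_zero[OF module_pm_scale])

text \<open>The descending chain condition as a minimum principle, by iterating a choice of strictly
  smaller ideals.\<close>

lemma ideal_minimal:
  assumes "P I" "\<And>I. P I \<Longrightarrow> is_ideal I"
  shows "\<exists>I. P I \<and> (\<forall>J. P J \<longrightarrow> J \<subseteq> I \<longrightarrow> J = (I :: 'a set))"
proof (rule ccontr)
  assume "\<not> ?thesis"
  then have "\<forall>I. P I \<longrightarrow> (\<exists>J. P J \<and> J \<subset> I)" by blast
  then obtain g where g: "\<And>I. P I \<Longrightarrow> P (g I) \<and> g I \<subset> I" by metis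
  define f where "f n = (g ^^ n) I" for n
  have "P (f n)" for n
    by (induction n) (use assms(1) g in \<open>auto simp: f_def\<close>)
  then have f: "P (f n)" "f (Suc n) \<subset> f n" for n
    using g by (auto simp: f_def)
  then have "\<forall>n. is_ideal (f n) \<and> f (Suc n) \<subseteq> f n" using assms(2) by blast
  then obtain n where n: "\<forall>k\<ge>n. f k = f n"
    using artinian[unfolded artinian_ring_def, THEN spec, of f] by auto
  then have "f (Suc n) = f n" by (blast intro: le_SucI)
  then show False using f(2)[of n] by blast
qed

text \<open>A smallest ideal of infinite length over \<open>W\<close> covers any ideal that is maximal among
  those avoiding a given element outside \<open>W\<close>.\<close>

lemma semisimple_finite_length:
  assumes W: "is_ideal W" and V: "is_ideal V" and WV: "W \<subseteq> V" and mV: "ideal_smult (*) \<mm> V \<subseteq> W"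
  shows "\<exists>n. rg.chain_length W V n"
proof (rule ccontr)
  assume neg: "\<not> ?thesis"
  let ?P = "\<lambda>I. is_ideal I \<and> W \<subseteq> I \<and> I \<subseteq> V \<and> \<not> (\<exists>n. rg.chain_length W I n)"
  obtain I where I: "?P I" and min: "\<And>J. ?P J \<Longrightarrow> J \<subseteq> I \<Longrightarrow> J = I"
    using ideal_minimal[of ?P V] V WV neg by auto
  have "I \<noteq> W" using I rg.chain_length.refl[OF W] by auto
  then obtain x where x: "x \<in> I" "x \<notin> W" using I by blast
  let ?Q = "{J. is_ideal J \<and> W \<subseteq> J \<and> J \<subseteq> I \<and> x \<notin> J}"
  have "\<exists>M\<in>?Q. \<forall>X\<in>?Q. M \<subseteq> X \<longrightarrow> X = M"
  proof (rule subset_Zorn_nonempty)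
    show "?Q \<noteq> {}" using W I x by blast
    fix \<C> assume C: "\<C> \<noteq> {}" "subset.chain ?Q \<C>"
    then have sub: "\<C> \<subseteq> ?Q" and tot: "\<And>A B. A \<in> \<C> \<Longrightarrow> B \<in> \<C> \<Longrightarrow> A \<subseteq> B \<or> B \<subseteq> A"
      by (auto simp: subset.chain_def)
    have "is_ideal (\<Union>\<C>)"
    proof (rule rg.subspaceI)
      show "0 \<in> \<Union>\<C>" using C(1) sub rg.subspace_0 by blast
      fix a b assume "a \<in> \<Union>\<C>" "b \<in> \<Union>\<C>"
      then obtain A B where "A \<in> \<C>" "B \<in> \<C>" "a \<in> A" "b \<in> B" by blast
      then obtain D where "D \<in> \<C>" "a \<in> D" "b \<in> D" using tot by blast
      then show "a + b \<in> \<Union>\<C>" using sub rg.subspace_add by blast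
    next
      fix r a assume "a \<in> \<Union>\<C>"
      then show "r * a \<in> \<Union>\<C>" using sub rg.subspace_scale by blast
    qed
    then show "\<Union>\<C> \<in> ?Q" using C(1) sub by blast
  qed
  then obtain J where J: "is_ideal J" "W \<subseteq> J" "J \<subseteq> I" "x \<notin> J"
    and max: "\<And>X. is_ideal X \<Longrightarrow> W \<subseteq> X \<Longrightarrow> X \<subseteq> I \<Longrightarrow> x \<notin> X \<Longrightarrow> J \<subseteq> X \<Longrightarrow> X = J" by auto
  have mI: "r * y \<in> J" if "r \<in> \<mm>" "y \<in> I" for r y
    using R.mS_I[OF that(1), of y V] mV I J that by blast
  let ?C = "rg.ssum J (rg.span {x})"
  have cyc: "is_ideal (rg.ssum J (rg.span {y}))" "J \<subseteq> rg.ssum J (rg.span {y})"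
      "y \<in> rg.ssum J (rg.span {y})" "rg.ssum J (rg.span {y}) \<subseteq> I" if y: "y \<in> I" for y
  proof -
    show "is_ideal (rg.ssum J (rg.span {y}))" "J \<subseteq> rg.ssum J (rg.span {y})"
      using J by (simp_all add: rg.subspace_ssum rg.ssum_upper1)
    show "y \<in> rg.ssum J (rg.span {y})"
      using rg.ssum_upper2[OF J(1), of "rg.span {y}"] rg.span_base[of y "{y}"] by blast
    show "rg.ssum J (rg.span {y}) \<subseteq> I"
      using I y by (intro rg.ssum_least[OF _ J(3)] rg.span_minimal) auto
  qed
  note C = cyc[OF x(1)]
  have "y \<in> ?C" if y: "y \<in> I" for y
  proof (cases "y \<in> J")
    case False
    let ?D = "rg.ssum J (rg.span {y})"
    note D = cyc[OF y]
    have "x \<in> ?D" using max[of ?D] D False J by blast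
    then obtain z r where zr: "x = z + r * y" "z \<in> J" by (auto simp: rg.ssum_def rg.span_singleton)
    have "r \<notin> \<mm>" using zr mI[of r y] y J(4) rg.subspace_add[OF J(1), of z "r * y"] by auto
    then obtain w where w: "w * r = 1" using unit by blast
    have "r * y = x - z" using zr by simp
    moreover have "x - z \<in> ?C" using C zr by (intro rg.subspace_diff[OF C(1)]) auto
    ultimately have "r * y \<in> ?C" by simp
    then have "w * (r * y) \<in> ?C" using rg.subspace_scale[OF C(1)] by blast
    then show ?thesis using w by (simp add: mult.assoc[symmetric])
  qed (use C in blast)
  then have "I = ?C" using C by blast
  then have "rg.covers J I" using R.covers_add_cyclic[OF J(1) J(4)] mI x by simp
  \<comment> \<open>\<open>J\<close> is strictly below the minimal \<open>I\<close>, so it has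
    finite length over \<open>W\<close>; since \<open>I\<close> covers \<open>J\<close>, the same
    would hold for \<open>I\<close>.\<close>
  moreover have "\<exists>n. rg.chain_length W J n" using min[of J] J I x by blast
  ultimately show False using I rg.chain_length.step by blast
qed

definition \<mm>2 :: "'a set" where "\<mm>2 = ideal_smult (*) \<mm> \<mm>"

lemma ideal_power_2: "ideal_power \<mm> 2 = \<mm>2"
  by (simp add: numeral_2_eq_2 ideal_power_1 \<mm>2_def)

lemma mm2_subset: "\<mm>2 \<subseteq> \<mm>"
  unfolding \<mm>2_def by (rule R.mS_subset[OF ideal_mm])

lemma mm2_mm:
  assumes "r \<in> \<mm>" "x \<in> \<mm>2" shows "r * x = 0"
proof -
  have "\<mm>2 \<subseteq> {x. r * x = 0}"
    unfolding \<mm>2_def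
    by (rule R.mS_least) (auto simp: rg.subspace_def distrib_left mult.left_commute mult3_eq_0 assms)
  then show ?thesis using assms by blast
qed

text \<open>In the filtration \<open>{0} \<subseteq> \<mm>2 \<subseteq> \<mm> \<subseteq> R\<close>
  the two lower layers are killed by \<open>\<mm>\<close>, so the Artinian property gives them
  finite length; the top layer is simple by maximality.\<close>

lemma chain_length_ring: "\<exists>p q. rg.chain_length {0} \<mm>2 p \<and> rg.chain_length \<mm>2 \<mm> q \<and> rg.chain_length \<mm> UNIV 1"
proof -
  have i: "is_ideal \<mm>2" unfolding \<mm>2_def by (rule R.subspace_mS)
  have "\<exists>p. rg.chain_length {0} \<mm>2 p"
    by (rule semisimple_finite_length, simp add: rg.subspace_single_0, rule i, use rg.subspace_0[OF i] in simp)
      (rule R.mS_least, simp_all add: rg.subspace_single_0 mm2_mm)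
  moreover have "\<exists>q. rg.chain_length \<mm>2 \<mm> q"
    by (rule semisimple_finite_length) (use i ideal_mm mm2_subset in \<open>auto simp: \<mm>2_def\<close>)
  moreover have "rg.covers \<mm> UNIV"
    using local by (auto simp: rg.covers_def local_ring_def maximal_ideal_def)
  then have "rg.chain_length \<mm> UNIV 1"
    using rg.chain_length.step[OF rg.chain_length.refl[OF ideal_mm]] by simp
  ultimately show ?thesis by blast
qed

end

section \<open>Balancing Tor\<close>

abbreviation lk :: "('x \<Rightarrow>\<^sub>0 'a::zero) \<Rightarrow> 'x \<Rightarrow> 'a" where "lk \<equiv> Poly_Mapping.lookup"

abbreviation unit_vec :: "'x \<Rightarrow> ('x \<Rightarrow>\<^sub>0 'a::zero_neq_one)" where "unit_vec k \<equiv> Poly_Mapping.single k 1"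

abbreviation free_rank :: "nat \<Rightarrow> (nat \<Rightarrow>\<^sub>0 'a::comm_ring_1) set"
  where "free_rank n \<equiv> free_on {..<n}"

lemma free_on_iff: "v \<in> free_on A \<longleftrightarrow> (\<forall>k. k \<notin> A \<longrightarrow> lk v k = 0)"
  by (auto simp: free_on_def in_keys_iff)

lemma subspace_free_on: "pm.subspace (free_on A)"
  by (auto simp: pm.subspace_def free_on_iff lookup_add)

lemma unit_vec_free_on: "k \<in> A \<Longrightarrow> unit_vec k \<in> free_on A"
  by (auto simp: free_on_iff lookup_single when_def)

lemma free_rank_expand:
  assumes "v \<in> free_rank n"
  shows "v = (\<Sum>k<n. pm_scale (lk v k) (unit_vec k))"
proof (rule poly_mapping_eqI)
  fix j
  have "lk (\<Sum>k<n. pm_scale (lk v k) (unit_vec k)) j = (\<Sum>k<n. if k = j then lk v k else 0)"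
    unfolding lookup_sum by (rule sum.cong) (auto simp: lookup_single when_def)
  also have "\<dots> = lk v j" using assms by (subst sum.delta) (auto simp: free_on_iff)
  finally show "lk v j = lk (\<Sum>k<n. pm_scale (lk v k) (unit_vec k)) j" by simp
qed

lemma module_hom_expand:
  assumes f: "module_hom pm_scale s f" and v: "v \<in> free_rank n"
  shows "f v = (\<Sum>k<n. s (lk v k) (f (unit_vec k)))"
proof -
  interpret module_hom pm_scale s f by fact
  show ?thesis by (subst free_rank_expand[OF v]) (simp add: sum scale)
qed

text \<open>The power \<open>V\<^sup>n\<close>, as functions on \<^typ>\<open>nat\<close> that vanish from \<open>n\<close> on.\<close>

definition pw :: "'v::zero set \<Rightarrow> nat \<Rightarrow> (nat \<Rightarrow> 'v) set"
  where "pw V n = {Z. (\<forall>k<n. Z k \<in> V) \<and> (\<forall>k\<ge>n. Z k = 0)}"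

text \<open>Matrix transposition: a \<open>c\<close>-tuple of vectors, read as the rows of a matrix,
  becomes the tuple of its columns.\<close>

definition transp :: "nat \<Rightarrow> (nat \<Rightarrow> (nat \<Rightarrow>\<^sub>0 'a::comm_ring_1)) \<Rightarrow> nat \<Rightarrow> (nat \<Rightarrow>\<^sub>0 'a)"
  where "transp c U k = (\<Sum>l<c. Poly_Mapping.single l (lk (U l) k))"

lemma lookup_transp: "lk (transp c U k) l = (if l < c then lk (U l) k else 0)"
proof -
  have "lk (transp c U k) l = (\<Sum>i<c. if i = l then lk (U i) k else 0)"
    by (auto simp: transp_def lookup_sum lookup_single when_def intro!: sum.cong)
  then show ?thesis by simp
qed

lemma transp_pw: "U \<in> pw (free_rank n) c \<Longrightarrow> transp c U \<in> pw (free_rank c) n"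
  by (auto simp: pw_def free_on_iff lookup_transp intro!: poly_mapping_eqI)

lemma transp_mem: "transp c U k \<in> free_rank c"
  by (auto simp: free_on_iff lookup_transp)

lemma transp_transp: "U \<in> pw (free_rank n) c \<Longrightarrow> transp n (transp c U) = U"
  by (auto simp: pw_def free_on_iff lookup_transp not_less intro!: ext poly_mapping_eqI)

lemma pw_lift:
  assumes "Z \<in> pw V c" "V \<subseteq> f ` S" "f 0 = 0"
  obtains U where "U \<in> pw S c" "Z = (\<lambda>k. f (U k))"
proof -
  have "\<forall>k. \<exists>u. k < c \<longrightarrow> u \<in> S \<and> Z k = f u" using assms by (fastforce simp: pw_def)
  then obtain u where u: "\<And>k. k < c \<Longrightarrow> u k \<in> S \<and> Z k = f (u k)" by metis
  show thesis
    by (rule that[of "\<lambda>k. if k < c then u k else 0"])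
      (use u assms in \<open>auto simp: pw_def not_less intro!: ext\<close>)
qed

text \<open>The differential of \<open>V \<otimes> F\<close>, under the identification of \<open>V \<otimes> F\<^sub>i\<close> with a power of \<open>V\<close>.\<close>

definition tdiff :: "('a::comm_ring_1 \<Rightarrow> 'v::ab_group_add \<Rightarrow> 'v) \<Rightarrow> ('a, 'b) resolution \<Rightarrow> nat \<Rightarrow>
    (nat \<Rightarrow> 'v) \<Rightarrow> nat \<Rightarrow> 'v"
  where "tdiff s X i Z l = (\<Sum>k<res_rank X i. s (lk (res_diff X i (unit_vec k)) l) (Z k))"

text \<open>Only the inclusion of cycles in boundaries is asked; \<open>tdiff_tdiff\<close> gives
  the other. The index is positive in all uses, since \<open>res_diff X 0\<close> has no
  meaning.\<close>

definition exact_at :: "('a::comm_ring_1 \<Rightarrow> 'v::ab_group_add \<Rightarrow> 'v) \<Rightarrow> 'v set \<Rightarrow>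
    ('a, 'b) resolution \<Rightarrow> nat \<Rightarrow> bool"
  where "exact_at s V X i \<longleftrightarrow> (\<forall>Z\<in>pw V (res_rank X i).
     tdiff s X i Z = (\<lambda>_. 0) \<longrightarrow> (\<exists>W\<in>pw V (res_rank X (Suc i)). Z = tdiff s X (Suc i) W))"

text \<open>The exact sequence \<open>0 \<rightarrow> K \<rightarrow> R^n \<rightarrow> V
  \<rightarrow> 0\<close>.\<close>

definition presentation :: "('a::comm_ring_1 \<Rightarrow> 'v::ab_group_add \<Rightarrow> 'v) \<Rightarrow> 'v set \<Rightarrow> nat \<Rightarrow>
    ((nat \<Rightarrow>\<^sub>0 'a) \<Rightarrow> 'v) \<Rightarrow> (nat \<Rightarrow>\<^sub>0 'a) set \<Rightarrow> bool"
  where "presentation s V n f K \<longleftrightarrow> module_hom pm_scale s f \<and> f ` free_rank n = V \<and>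
           K = {v \<in> free_rank n. f v = 0}"

lemma tdiff_hom:
  assumes "module_hom s t f"
  shows "f (tdiff s X i Z l) = tdiff t X i (\<lambda>k. f (Z k)) l"
proof -
  interpret module_hom s t f by fact
  show ?thesis by (simp add: tdiff_def sum scale)
qed

lemma tdiff_diff:
  assumes "module s"
  shows "tdiff s X i (\<lambda>k. Z k - W k) l = tdiff s X i Z l - tdiff s X i W l"
proof -
  interpret ring_module s using assms by (simp add: ring_module.intro)
  show ?thesis by (simp add: tdiff_def scale_right_diff_distrib sum_subtractf)
qed

section \<open>Complexes over a free resolution and dimension shifting\<close>

locale resolution_of = ring_module s for s :: "'a::comm_ring_1 \<Rightarrow> 'b::ab_group_add \<Rightarrow> 'b" +
  fixes X :: "('a, 'b) resolution"
  assumes resolution: "free_resolution s X"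
begin

abbreviation "F \<equiv> res_mod X"
abbreviation "d \<equiv> res_diff X"
abbreviation "aug \<equiv> res_aug X"
abbreviation "rk \<equiv> res_rank X"

lemma F_def: "F i = free_rank (rk i)"
  by (simp add: res_mod_def)

lemma hom_aug: "module_hom pm_scale s aug"
  using resolution by (simp add: free_resolution_def)

lemma hom_d: "module_hom pm_scale pm_scale (d (Suc i))"
  using resolution by (simp add: free_resolution_def)

lemma aug_surj: "aug ` F 0 = UNIV"
  using resolution by (simp add: free_resolution_def)

lemma ker_aug: "{v \<in> F 0. aug v = 0} = d (Suc 0) ` F (Suc 0)"
  using resolution by (simp add: free_resolution_def)

lemma ker_d: "{v \<in> F (Suc i). d (Suc i) v = 0} = d (Suc (Suc i)) ` F (Suc (Suc i))"
  using resolution by (simp add: free_resolution_def)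

lemma d_mem: "v \<in> F (Suc i) \<Longrightarrow> d (Suc i) v \<in> F i"
  using ker_aug ker_d by (cases i) blast+

lemma d_d: "v \<in> F (Suc (Suc i)) \<Longrightarrow> d (Suc i) (d (Suc (Suc i)) v) = 0"
  using ker_d by blast

lemma aug_d: "v \<in> F (Suc 0) \<Longrightarrow> aug (d (Suc 0) v) = 0"
  using ker_aug by blast

text \<open>Together with the next fact, cuts the resolution into short exact sequences, ready for
  dimension shifting.\<close>

lemma presentation_0: "presentation s UNIV (rk 0) aug (d (Suc 0) ` F (Suc 0))"
  using aug_surj ker_aug hom_aug by (simp add: presentation_def F_def)

lemma presentation_Suc:
  "presentation pm_scale (d (Suc i) ` F (Suc i)) (rk (Suc i)) (d (Suc i)) (d (Suc (Suc i)) ` F (Suc (Suc i)))"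
  using ker_d hom_d by (simp add: presentation_def F_def)

lemma d_unit_vec_mem: "k < rk (Suc i) \<Longrightarrow> d (Suc i) (unit_vec k) \<in> F i"
  by (rule d_mem) (simp add: F_def unit_vec_free_on)

lemma tdiff_pw:
  assumes "module t" "module.subspace t V" "Z \<in> pw V (rk (Suc i))"
  shows "tdiff t X (Suc i) Z \<in> pw V (rk i)"
proof -
  interpret t: ring_module t using assms by (simp add: ring_module.intro)
  have "tdiff t X (Suc i) Z l \<in> V" for l
    unfolding tdiff_def using assms(2,3)
    by (intro t.subspace_sum t.subspace_scale) (auto simp: pw_def)
  moreover have "tdiff t X (Suc i) Z l = 0" if "l \<ge> rk i" for l
    unfolding tdiff_def using d_unit_vec_mem that
    by (intro sum.neutral) (auto simp: F_def free_on_iff)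
  ultimately show ?thesis by (simp add: pw_def)
qed

lemma lookup_d:
  assumes "v \<in> F (Suc i)"
  shows "lk (d (Suc i) v) l = (\<Sum>k<rk (Suc i). lk v k * lk (d (Suc i) (unit_vec k)) l)"
  using module_hom_expand[OF hom_d, of v "rk (Suc i)" i] assms by (simp add: F_def lookup_sum)

lemma tdiff_tdiff:
  assumes "module t"
  shows "tdiff t X (Suc i) (tdiff t X (Suc (Suc i)) Z) l = 0"
proof -
  interpret t: ring_module t using assms by (simp add: ring_module.intro)
  let ?a = "\<lambda>k. lk (d (Suc i) (unit_vec k)) l" and ?b = "\<lambda>m. lk (d (Suc (Suc i)) (unit_vec m))"
  have "tdiff t X (Suc i) (tdiff t X (Suc (Suc i)) Z) l =
      (\<Sum>k<rk (Suc i). \<Sum>m<rk (Suc (Suc i)). t (?b m k * ?a k) (Z m))"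
    by (simp add: tdiff_def t.scale_sum_right mult.commute)
  also have "\<dots> = (\<Sum>m<rk (Suc (Suc i)). \<Sum>k<rk (Suc i). t (?b m k * ?a k) (Z m))"
    by (rule sum.swap)
  also have "\<dots> = (\<Sum>m<rk (Suc (Suc i)). t (lk (d (Suc i) (d (Suc (Suc i)) (unit_vec m))) l) (Z m))"
  proof (rule sum.cong[OF HOL.refl])
    fix m assume "m \<in> {..<rk (Suc (Suc i))}"
    then have "lk (d (Suc i) (d (Suc (Suc i)) (unit_vec m))) l = (\<Sum>k<rk (Suc i). ?b m k * ?a k)"
      using lookup_d[OF d_unit_vec_mem, of m i l] by auto
    then show "(\<Sum>k<rk (Suc i). t (?b m k * ?a k) (Z m)) =
        t (lk (d (Suc i) (d (Suc (Suc i)) (unit_vec m))) l) (Z m)"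
      by (simp only: t.scale_sum_left)
  qed
  also have "\<dots> = 0"
    by (intro sum.neutral ballI) (simp add: d_d F_def unit_vec_free_on)
  finally show ?thesis .
qed

text \<open>\<open>tdiff\<close> combines the rows of the matrix \<open>Z\<close>, which amounts to
  applying \<open>d\<close> to each of its columns.\<close>

lemma d_transp: "d (Suc i) (transp (rk (Suc i)) Z m) = transp (rk i) (tdiff pm_scale X (Suc i) Z) m"
proof (rule poly_mapping_eqI)
  fix l
  let ?v = "transp (rk (Suc i)) Z m"
  have v: "?v \<in> F (Suc i)" by (simp add: F_def transp_mem)
  have "lk (d (Suc i) ?v) l = (\<Sum>k<rk (Suc i). lk (d (Suc i) (unit_vec k)) l * lk (Z k) m)"
    by (simp add: lookup_d[OF v] lookup_transp mult.commute)
  also have "\<dots> = lk (tdiff pm_scale X (Suc i) Z l) m"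
    by (simp add: tdiff_def lookup_sum)
  finally show "lk (d (Suc i) ?v) l = lk (transp (rk i) (tdiff pm_scale X (Suc i) Z) m) l"
    using d_mem[OF v] by (auto simp: lookup_transp F_def free_on_iff)
qed

lemma tdiff_transp:
  assumes "U \<in> pw (F (Suc i)) c"
  shows "tdiff pm_scale X (Suc i) (transp c U) = transp c (\<lambda>k. d (Suc i) (U k))"
proof -
  have U: "transp c U \<in> pw (free_rank c) (rk (Suc i))" "transp (rk (Suc i)) (transp c U) = U"
    using assms by (auto simp: F_def intro: transp_pw transp_transp)
  have T: "tdiff pm_scale X (Suc i) (transp c U) \<in> pw (free_rank c) (rk i)"
    by (rule tdiff_pw[OF module_pm_scale subspace_free_on U(1)])
  have "(\<lambda>k. d (Suc i) (U k)) = transp (rk i) (tdiff pm_scale X (Suc i) (transp c U))"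
    using d_transp[of i "transp c U"] U(2) by auto
  then show ?thesis using transp_transp[OF T] by simp
qed

text \<open>After transposition a cycle splits into \<open>n\<close> separate cycles of the
  resolution, each a boundary by exactness in positive degree.\<close>

lemma exact_free: "exact_at pm_scale (free_rank n) X (Suc i)"
  unfolding exact_at_def
proof (intro ballI impI)
  fix Z assume Z: "Z \<in> pw (free_rank n) (rk (Suc i))" "tdiff pm_scale X (Suc i) Z = (\<lambda>_. 0)"
  let ?V = "transp (rk (Suc i)) Z"
  have "?V m \<in> d (Suc (Suc i)) ` F (Suc (Suc i))" for m
  proof -
    have "d (Suc i) (?V m) = transp (rk i) (\<lambda>_. 0) m" using d_transp[of i Z m] Z(2) by simp
    also have "\<dots> = 0" by (simp add: transp_def)
    finally show ?thesis using transp_mem[of "rk (Suc i)" Z m] unfolding ker_d[symmetric] by (simp add: F_def)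
  qed
  then have "?V \<in> pw (d (Suc (Suc i)) ` F (Suc (Suc i))) n"
    using transp_pw[OF Z(1)] by (simp add: pw_def)
  moreover have "d (Suc (Suc i)) 0 = 0"
    using module_hom.zero[OF hom_d] .
  ultimately obtain U where U: "U \<in> pw (F (Suc (Suc i))) n" "?V = (\<lambda>k. d (Suc (Suc i)) (U k))"
    using pw_lift[of ?V _ n "d (Suc (Suc i))" "F (Suc (Suc i))"] by blast
  have "Z = transp n ?V" using transp_transp[OF Z(1)] by simp
  also have "\<dots> = tdiff pm_scale X (Suc (Suc i)) (transp n U)"
    using tdiff_transp[OF U(1)] U(2) by simp
  finally show "\<exists>W\<in>pw (free_rank n) (rk (Suc (Suc i))). Z = tdiff pm_scale X (Suc (Suc i)) W"
    using transp_pw[of U "rk (Suc (Suc i))" n] U(1) by (auto simp: F_def)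
qed

text \<open>The long exact sequence of \<open>0 \<rightarrow> K \<rightarrow> R^n \<rightarrow> V
  \<rightarrow> 0\<close> tensored with the resolution, with middle term exact by
  \<open>exact_free\<close>. Both directions are the chase along the connecting map.\<close>

lemma exact_at_shift:
  assumes t: "module t" and pres: "presentation t V n f K"
  shows "exact_at t V X (Suc (Suc i)) \<longleftrightarrow> exact_at pm_scale K X (Suc i)"
proof -
  interpret f: module_hom pm_scale t f using pres by (simp add: presentation_def)
  have V: "V = f ` free_rank n" and K: "K = {v \<in> free_rank n. f v = 0}"
    using pres by (auto simp: presentation_def)
  have KF: "pw K c \<subseteq> pw (free_rank n) c" for c by (auto simp: K pw_def)
  have inK: "Z \<in> pw K c" if "Z \<in> pw (free_rank n) c" "\<And>k. f (Z k) = 0" for Z c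
    using that by (auto simp: K pw_def)
  have K0: "f (Z k) = 0" if "Z \<in> pw K c" for Z c k
    using that f.zero by (cases "k < c") (auto simp: K pw_def)
  have diff: "(\<lambda>k. U k - W k) \<in> pw (free_rank n) c"
    if "U \<in> pw (free_rank n) c" "W \<in> pw (free_rank n) c" for U W c
    using that by (auto simp: pw_def intro!: pm.subspace_diff[OF subspace_free_on])
  have subK: "pm.subspace K"
    unfolding K using f.subspace_kernel by (simp add: pm.subspace_def free_on_iff lookup_add f.zero f.add f.scale)
  note td = tdiff_pw[OF module_pm_scale subspace_free_on]
  note tdK = tdiff_pw[OF module_pm_scale subK]
  show ?thesis
  proof
    assume ex: "exact_at t V X (Suc (Suc i))"
    show "exact_at pm_scale K X (Suc i)"
      unfolding exact_at_def
    proof (intro ballI impI)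
      fix Z assume Z: "Z \<in> pw K (rk (Suc i))" "tdiff pm_scale X (Suc i) Z = (\<lambda>_. 0)"
      obtain U where U: "U \<in> pw (free_rank n) (rk (Suc (Suc i)))" "Z = tdiff pm_scale X (Suc (Suc i)) U"
        using exact_free[of n i] Z KF unfolding exact_at_def by blast
      have "(\<lambda>k. f (U k)) \<in> pw V (rk (Suc (Suc i)))" using U(1) by (auto simp: V pw_def f.zero)
      moreover have "tdiff t X (Suc (Suc i)) (\<lambda>k. f (U k)) = (\<lambda>_. 0)"
        using K0[OF Z(1)] by (auto simp: tdiff_hom[OF f.module_hom_axioms, symmetric] U(2)[symmetric])
      ultimately obtain W' where W': "W' \<in> pw V (rk (Suc (Suc (Suc i))))"
          "(\<lambda>k. f (U k)) = tdiff t X (Suc (Suc (Suc i))) W'"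
        using ex unfolding exact_at_def by blast
      then obtain W where W: "W \<in> pw (free_rank n) (rk (Suc (Suc (Suc i))))" "W' = (\<lambda>k. f (W k))"
        using pw_lift[OF W'(1), of f "free_rank n"] V f.zero by blast
      \<comment> \<open>Subtracting the boundary \<open>?D\<close> keeps the differential of
        \<open>U\<close> and moves its coordinates into \<open>K\<close>.\<close>
      let ?D = "tdiff pm_scale X (Suc (Suc (Suc i))) W"
      have "(\<lambda>k. U k - ?D k) \<in> pw K (rk (Suc (Suc i)))"
      proof (rule inK)
        show "(\<lambda>k. U k - ?D k) \<in> pw (free_rank n) (rk (Suc (Suc i)))"
          by (rule diff[OF U(1) td[OF W(1)]])
        show "f (U k - ?D k) = 0" for k
          using fun_cong[OF W'(2), of k] by (simp add: f.diff tdiff_hom[OF f.module_hom_axioms] W(2))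
      qed
      moreover have "Z = tdiff pm_scale X (Suc (Suc i)) (\<lambda>k. U k - ?D k)"
        by (rule ext) (simp add: tdiff_diff[OF module_pm_scale] tdiff_tdiff[OF module_pm_scale] U(2))
      ultimately show "\<exists>W\<in>pw K (rk (Suc (Suc i))). Z = tdiff pm_scale X (Suc (Suc i)) W" by blast
    qed
  next
    assume ex: "exact_at pm_scale K X (Suc i)"
    show "exact_at t V X (Suc (Suc i))"
      unfolding exact_at_def
    proof (intro ballI impI)
      fix Z assume Z: "Z \<in> pw V (rk (Suc (Suc i)))" "tdiff t X (Suc (Suc i)) Z = (\<lambda>_. 0)"
      obtain U where U: "U \<in> pw (free_rank n) (rk (Suc (Suc i)))" "Z = (\<lambda>k. f (U k))"
        using pw_lift[OF Z(1), of f "free_rank n"] V f.zero by blast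
      let ?D = "tdiff pm_scale X (Suc (Suc i)) U"
      have "?D \<in> pw K (rk (Suc i))"
        using inK[OF td[OF U(1)]] fun_cong[OF Z(2)] by (simp add: tdiff_hom[OF f.module_hom_axioms] U(2))
      moreover have "tdiff pm_scale X (Suc i) ?D = (\<lambda>_. 0)"
        using tdiff_tdiff[OF module_pm_scale] by blast
      ultimately obtain W where W: "W \<in> pw K (rk (Suc (Suc i)))" "?D = tdiff pm_scale X (Suc (Suc i)) W"
        using ex unfolding exact_at_def by blast
      \<comment> \<open>\<open>U\<close> and \<open>W\<close> have the same differential, so their
        difference is a cycle over the free module; since \<open>f\<close> kills \<open>W\<close>,
        it still represents \<open>Z\<close>.\<close>
      have "(\<lambda>k. U k - W k) \<in> pw (free_rank n) (rk (Suc (Suc i)))"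
        using diff U(1) W(1) KF by blast
      moreover have "tdiff pm_scale X (Suc (Suc i)) (\<lambda>k. U k - W k) = (\<lambda>_. 0)"
        using fun_cong[OF W(2)] by (auto simp: tdiff_diff[OF module_pm_scale])
      ultimately obtain T where T: "T \<in> pw (free_rank n) (rk (Suc (Suc (Suc i))))"
          "(\<lambda>k. U k - W k) = tdiff pm_scale X (Suc (Suc (Suc i))) T"
        using exact_free[of n "Suc i"] unfolding exact_at_def by blast
      have "Z = tdiff t X (Suc (Suc (Suc i))) (\<lambda>k. f (T k))"
      proof
        fix k
        have "Z k = f (U k - W k)" using K0[OF W(1)] by (simp add: U(2) f.diff)
        also have "\<dots> = tdiff t X (Suc (Suc (Suc i))) (\<lambda>k. f (T k)) k"
          using fun_cong[OF T(2), of k] by (simp add: tdiff_hom[OF f.module_hom_axioms])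
        finally show "Z k = tdiff t X (Suc (Suc (Suc i))) (\<lambda>k. f (T k)) k" .
      qed
      moreover have "(\<lambda>k. f (T k)) \<in> pw V (rk (Suc (Suc (Suc i))))"
        using T(1) by (auto simp: V pw_def f.zero)
      ultimately show "\<exists>W\<in>pw V (rk (Suc (Suc (Suc i)))). Z = tdiff t X (Suc (Suc (Suc i))) W" by blast
    qed
  qed
qed

text \<open>Iterates \<open>exact_at_shift\<close>: passing to the \<open>p\<close>-th syzygy lowers
  the degree by \<open>p\<close>. The case \<open>p = 0\<close> stands apart since the module and
  its syzygies have different types.\<close>

lemma exact_at_syzygy:
  "exact_at s UNIV Y (Suc (i + p)) \<longleftrightarrow>
   (if p = 0 then exact_at s UNIV Y (Suc i) else exact_at pm_scale (d p ` F p) Y (Suc i))"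
  if Y: "resolution_of t Y"
proof (induction p arbitrary: i)
  case (Suc p)
  interpret Y: resolution_of t Y by fact
  have "exact_at s UNIV Y (Suc (i + Suc p)) \<longleftrightarrow>
      (if p = 0 then exact_at s UNIV Y (Suc (Suc i)) else exact_at pm_scale (d p ` F p) Y (Suc (Suc i)))"
    using Suc.IH[of "Suc i"] by simp
  also have "\<dots> \<longleftrightarrow> exact_at pm_scale (d (Suc p) ` F (Suc p)) Y (Suc i)"
  proof (cases p)
    case 0
    then show ?thesis using Y.exact_at_shift[OF module_axioms presentation_0] by simp
  next
    case (Suc q)
    then show ?thesis using Y.exact_at_shift[OF module_pm_scale presentation_Suc] by simp
  qed
  finally show ?case by simp
qed simp

end

text \<open>
  A diagram chase in the double complex of the two resolutions, whose entries are matrix spaces: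
  transposition turns \<^const>\<open>tdiff\<close> for one resolution into the row-wise differential.
\<close>

lemma exact_at_balanced_1:
  fixes sM :: "'a::comm_ring_1 \<Rightarrow> 'b::ab_group_add \<Rightarrow> 'b" and sN :: "'a \<Rightarrow> 'c::ab_group_add \<Rightarrow> 'c"
  assumes "resolution_of sM X" and "resolution_of sN Y"
    and pres: "presentation t V (res_rank X p) f (res_diff X (Suc p) ` res_mod X (Suc p))"
    and ex: "exact_at sN UNIV X (Suc p)"
  shows "exact_at t V Y (Suc 0)"
  unfolding exact_at_def
proof (intro ballI impI)
  interpret X: resolution_of sM X by fact
  interpret Y: resolution_of sN Y by fact
  interpret f: module_hom pm_scale t f using pres by (simp add: presentation_def)
  interpret aug: module_hom pm_scale sN "res_aug Y" by (rule Y.hom_aug)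
  interpret dX: module_hom pm_scale pm_scale "res_diff X (Suc p)" by (rule X.hom_d)
  interpret dY: module_hom pm_scale pm_scale "res_diff Y (Suc 0)" by (rule Y.hom_d)
  have V: "V = f ` X.F p" and K: "X.d (Suc p) ` X.F (Suc p) = {v \<in> X.F p. f v = 0}"
    using pres by (auto simp: presentation_def X.F_def)
  fix Z assume Z: "Z \<in> pw V (Y.rk (Suc 0))" "tdiff t Y (Suc 0) Z = (\<lambda>_. 0)"
  \<comment> \<open>\<open>Z'\<close> lifts the cycle to the free module. Its differential
    \<open>?A\<close> need not vanish, but has coordinates in the next syzygy, which gives
    \<open>U\<close>.\<close>
  obtain Z' where Z': "Z' \<in> pw (X.F p) (Y.rk (Suc 0))" "Z = (\<lambda>k. f (Z' k))"
    using pw_lift[OF Z(1), of f "X.F p"] V f.zero by blast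
  let ?A = "tdiff pm_scale Y (Suc 0) Z'"
  have A: "?A \<in> pw (X.F p) (Y.rk 0)"
    using Y.tdiff_pw[OF module_pm_scale subspace_free_on] Z'(1) by (simp add: X.F_def)
  have "f (?A k) = 0" for k
    using fun_cong[OF Z(2), of k] by (simp add: tdiff_hom[OF f.module_hom_axioms] Z'(2))
  then have "?A \<in> pw (X.d (Suc p) ` X.F (Suc p)) (Y.rk 0)"
    using A unfolding K by (auto simp: pw_def)
  then obtain U where U: "U \<in> pw (X.F (Suc p)) (Y.rk 0)" "?A = (\<lambda>k. X.d (Suc p) (U k))"
    using pw_lift[of ?A _ "Y.rk 0" "X.d (Suc p)" "X.F (Suc p)"] dX.zero by blast
  let ?U = "transp (Y.rk 0) U"
  have trU: "?U \<in> pw (Y.F 0) (X.rk (Suc p))" "transp (X.rk (Suc p)) ?U = U"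
    using U(1) by (simp_all add: X.F_def Y.F_def transp_pw transp_transp)
  have "tdiff pm_scale X (Suc p) ?U = transp (Y.rk 0) ?A"
    using X.tdiff_transp[OF U(1)] U(2) by simp
  also have "\<dots> = (\<lambda>k. Y.d (Suc 0) (transp (Y.rk (Suc 0)) Z' k))"
    using Y.d_transp[of 0 Z'] by auto
  \<comment> \<open>Up to transposition, the differential of \<open>U\<close> comes from
    \<open>Y.d\<close>, which the augmentation kills. This is the cycle of degree
    \<open>Suc p\<close> to which the exactness assumption on \<open>X\<close> applies.\<close>
  finally have "tdiff sN X (Suc p) (\<lambda>k. Y.aug (?U k)) = (\<lambda>_. 0)"
    using Y.aug_d by (auto simp: tdiff_hom[OF aug.module_hom_axioms, symmetric] Y.F_def transp_mem)
  moreover have "(\<lambda>k. Y.aug (?U k)) \<in> pw UNIV (X.rk (Suc p))"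
    using trU(1) by (auto simp: pw_def aug.zero)
  ultimately obtain C' where C': "C' \<in> pw UNIV (X.rk (Suc (Suc p)))"
      "(\<lambda>k. Y.aug (?U k)) = tdiff sN X (Suc (Suc p)) C'"
    using ex unfolding exact_at_def by blast
  obtain C where C: "C \<in> pw (Y.F 0) (X.rk (Suc (Suc p)))" "C' = (\<lambda>k. Y.aug (C k))"
    using pw_lift[OF C'(1), of Y.aug "Y.F 0"] Y.aug_surj aug.zero by blast
  let ?D = "tdiff pm_scale X (Suc (Suc p)) C"
  have D: "?D \<in> pw (Y.F 0) (X.rk (Suc p))"
    using X.tdiff_pw[OF module_pm_scale subspace_free_on] C(1) by (simp add: Y.F_def)
  have "(\<lambda>k. ?U k - ?D k) \<in> pw (Y.d (Suc 0) ` Y.F (Suc 0)) (X.rk (Suc p))"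
  proof -
    have "Y.aug (?U k - ?D k) = 0" for k
      using fun_cong[OF C'(2), of k] by (simp add: aug.diff tdiff_hom[OF aug.module_hom_axioms] C(2))
    moreover have "?U k - ?D k \<in> Y.F 0" if "k < X.rk (Suc p)" for k
      using trU(1) D that by (auto simp: pw_def Y.F_def intro!: pm.subspace_diff[OF subspace_free_on])
    ultimately show ?thesis
      using trU(1) D unfolding Y.ker_aug[symmetric] by (auto simp: pw_def)
  qed
  then obtain W' where W': "W' \<in> pw (Y.F (Suc 0)) (X.rk (Suc p))"
      "(\<lambda>k. ?U k - ?D k) = (\<lambda>k. Y.d (Suc 0) (W' k))"
    using pw_lift[of "\<lambda>k. ?U k - ?D k" _ _ "Y.d (Suc 0)" "Y.F (Suc 0)"] dY.zero by blast
  let ?W = "transp (X.rk (Suc p)) W'"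
  have W: "?W \<in> pw (X.F (Suc p)) (Y.rk (Suc 0))"
    using W'(1) by (simp add: X.F_def Y.F_def transp_pw)
  have tdW: "tdiff pm_scale Y (Suc 0) ?W k = U k - X.d (Suc (Suc p)) (transp (X.rk (Suc (Suc p))) C k)" for k
  proof -
    have "tdiff pm_scale Y (Suc 0) ?W k = transp (X.rk (Suc p)) (\<lambda>k. ?U k - ?D k) k"
      using Y.tdiff_transp[OF W'(1)] W'(2) by simp
    also have "\<dots> = transp (X.rk (Suc p)) ?U k - transp (X.rk (Suc p)) ?D k"
      by (intro poly_mapping_eqI) (simp add: lookup_transp lookup_minus)
    also have "\<dots> = U k - X.d (Suc (Suc p)) (transp (X.rk (Suc (Suc p))) C k)"
      using trU(2) X.d_transp[of "Suc p" C k] by simp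
    finally show ?thesis .
  qed
  \<comment> \<open>\<open>?E\<close> has the same differential as \<open>Z'\<close>, because
    \<open>X.d\<close> kills the contribution of \<open>C\<close>, and \<open>f\<close> kills
    \<open>?E\<close>. So the difference of \<open>Z'\<close> and \<open>?E\<close> is a free cycle
    that still represents \<open>Z\<close>.\<close>
  let ?E = "\<lambda>k. X.d (Suc p) (?W k)"
  have E: "?E \<in> pw (X.F p) (Y.rk (Suc 0))"
    using W X.d_mem dX.zero by (auto simp: pw_def)
  have "tdiff pm_scale Y (Suc 0) ?E k = ?A k" for k
    using X.d_d[of "transp (X.rk (Suc (Suc p))) C k" p] fun_cong[OF U(2), of k]
    by (simp add: tdiff_hom[OF dX.module_hom_axioms, symmetric] tdW dX.diff X.F_def transp_mem)
  then have "tdiff pm_scale Y (Suc 0) (\<lambda>k. Z' k - ?E k) = (\<lambda>_. 0)"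
    by (auto simp: tdiff_diff[OF module_pm_scale])
  moreover have "(\<lambda>k. Z' k - ?E k) \<in> pw (X.F p) (Y.rk (Suc 0))"
    using Z'(1) E by (auto simp: pw_def X.F_def intro!: pm.subspace_diff[OF subspace_free_on])
  ultimately obtain T where T: "T \<in> pw (X.F p) (Y.rk (Suc (Suc 0)))"
      "(\<lambda>k. Z' k - ?E k) = tdiff pm_scale Y (Suc (Suc 0)) T"
    using Y.exact_free[of "X.rk p" 0] unfolding exact_at_def X.F_def by blast
  have "f (?E k) = 0" for k
  proof -
    have "?W k \<in> X.F (Suc p)" by (simp add: X.F_def transp_mem)
    then show ?thesis using K by blast
  qed
  then have "Z k = tdiff t Y (Suc (Suc 0)) (\<lambda>k. f (T k)) k" for k
    using arg_cong[OF fun_cong[OF T(2), of k], of f]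
    by (simp add: f.diff tdiff_hom[OF f.module_hom_axioms] Z'(2))
  moreover have "(\<lambda>k. f (T k)) \<in> pw V (Y.rk (Suc (Suc 0)))"
    using T(1) by (auto simp: V pw_def f.zero)
  ultimately show "\<exists>W\<in>pw V (Y.rk (Suc (Suc 0))). Z = tdiff t Y (Suc (Suc 0)) W" by blast
qed

text \<open>Shifting along \<open>X\<close> reduces degree \<open>Suc p\<close> to degree 1 over the
  \<open>p\<close>-th syzygy, where the chase above applies. Applied twice, it also replaces one
  resolution of a module by another.\<close>

theorem exact_at_balanced:
  assumes X: "resolution_of sM X" and Y: "resolution_of sN Y"
    and ex: "exact_at sN UNIV X (Suc p)"
  shows "exact_at sM UNIV Y (Suc p)"
proof -
  interpret X: resolution_of sM X by fact
  have "if p = 0 then exact_at sM UNIV Y (Suc 0) else exact_at pm_scale (X.d p ` X.F p) Y (Suc 0)"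
  proof (cases p)
    case 0
    then show ?thesis using exact_at_balanced_1[OF X Y X.presentation_0] ex by simp
  next
    case (Suc q)
    then show ?thesis using exact_at_balanced_1[OF X Y X.presentation_Suc] ex by simp
  qed
  then show ?thesis using X.exact_at_syzygy[OF Y, of 0 p] by simp
qed

section \<open>Tor through powers of a module\<close>

text \<open>The isomorphism \<open>R\<^sup>n \<otimes> N \<cong> N\<^sup>n\<close>, on representatives.\<close>

definition tens :: "('a::comm_ring_1 \<Rightarrow> 'c::ab_group_add \<Rightarrow> 'c) \<Rightarrow> (((nat \<Rightarrow>\<^sub>0 'a) \<times> 'c) \<Rightarrow>\<^sub>0 'a) \<Rightarrow>
    nat \<Rightarrow> 'c"
  where "tens t z k = (\<Sum>p\<in>Poly_Mapping.keys z. t (lk z p * lk (fst p) k) (snd p))"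

lemma sum_single: "z = (\<Sum>p\<in>Poly_Mapping.keys z. Poly_Mapping.single p (lk z p))"
proof (rule poly_mapping_eqI)
  fix q
  have "lk (\<Sum>p\<in>Poly_Mapping.keys z. Poly_Mapping.single p (lk z p)) q =
      (\<Sum>p\<in>Poly_Mapping.keys z. if p = q then lk z p else 0)"
    unfolding lookup_sum by (rule sum.cong) (auto simp: lookup_single when_def)
  also have "\<dots> = lk z q" by (subst sum.delta) (auto simp: in_keys_iff)
  finally show "lk z q = lk (\<Sum>p\<in>Poly_Mapping.keys z. Poly_Mapping.single p (lk z p)) q" by simp
qed

locale tensor_power = ring_module t for t :: "'a::comm_ring_1 \<Rightarrow> 'c::ab_group_add \<Rightarrow> 'c"
begin

lemma tens_superset:
  assumes "finite S" "Poly_Mapping.keys z \<subseteq> S"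
  shows "tens t z k = (\<Sum>p\<in>S. t (lk z p * lk (fst p) k) (snd p))"
  unfolding tens_def using assms by (intro sum.mono_neutral_left) (auto simp: in_keys_iff)

lemma tens_hom: "module_hom pm_scale t (\<lambda>z. tens t z k)"
proof (rule module_hom.intro[OF module_pm_scale module_axioms], unfold_locales)
  fix z w :: "((nat \<Rightarrow>\<^sub>0 'a) \<times> 'c) \<Rightarrow>\<^sub>0 'a" and r
  let ?S = "Poly_Mapping.keys z \<union> Poly_Mapping.keys w"
  have "Poly_Mapping.keys (z + w) \<subseteq> ?S" by (rule Poly_Mapping.keys_add)
  then show "tens t (z + w) k = tens t z k + tens t w k"
    by (simp add: tens_superset[of ?S] lookup_add distrib_right scale_left_distrib sum.distrib)
  have "Poly_Mapping.keys (pm_scale r z) \<subseteq> Poly_Mapping.keys z" by (auto simp: in_keys_iff)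
  then show "tens t (pm_scale r z) k = t r (tens t z k)"
    by (simp add: tens_superset[of "Poly_Mapping.keys z"] scale_sum_right mult.assoc)
qed

lemma tens_single: "tens t (Poly_Mapping.single (x, y) c) k = t (c * lk x k) y"
  by (cases "c = 0") (simp_all add: tens_def lookup_single)

text \<open>Well-definedness on the tensor product, checked on the four kinds of generators.\<close>

lemma tens_rels:
  assumes "z \<in> tensor_rels pm_scale S t T"
  shows "tens t z k = 0"
proof -
  interpret h: module_hom pm_scale t "\<lambda>z. tens t z k" by (rule tens_hom)
  have "tensor_rels pm_scale S t T \<subseteq> {z. tens t z k = 0}"
    unfolding tensor_rels_def Let_def
    by (rule pm.span_minimal[OF _ h.subspace_kernel])
      (auto simp: h.diff h.scale tens_single lookup_add scale_left_distrib scale_right_distrib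
        mult.commute)
  then show ?thesis using assms by blast
qed

context
  fixes n :: nat and R
  defines "R \<equiv> tensor_rels pm_scale (free_rank n) t UNIV"
begin

lemma subspace_R: "pm.subspace R"
  unfolding R_def tensor_rels_def Let_def by (rule pm.subspace_span)

lemma R_add_left:
  "x \<in> free_rank n \<Longrightarrow> x' \<in> free_rank n \<Longrightarrow> unit_vec (x + x', y) - unit_vec (x, y) - unit_vec (x', y) \<in> R"
  unfolding R_def tensor_rels_def Let_def by (rule pm.span_base) blast

lemma R_add_right:
  "x \<in> free_rank n \<Longrightarrow> unit_vec (x, y + y') - unit_vec (x, y) - unit_vec (x, y') \<in> R"
  unfolding R_def tensor_rels_def Let_def by (rule pm.span_base) blast

lemma R_scale_left:
  "x \<in> free_rank n \<Longrightarrow> unit_vec (pm_scale r x, y) - pm_scale r (unit_vec (x, y)) \<in> R"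
  unfolding R_def tensor_rels_def Let_def by (rule pm.span_base) blast

lemma R_scale_right:
  "x \<in> free_rank n \<Longrightarrow> unit_vec (x, t r y) - pm_scale r (unit_vec (x, y)) \<in> R"
  unfolding R_def tensor_rels_def Let_def by (rule pm.span_base) blast

text \<open>The additivity relation for \<open>0 + 0\<close> is the negative of this
  element.\<close>

lemma R_zero_left: "unit_vec (0, y) \<in> R"
  using R_add_left[of 0 0 y] pm.subspace_neg[OF subspace_R, of "- unit_vec (0, y)"]
  by (simp add: free_on_iff)

lemma R_zero_right: "x \<in> free_rank n \<Longrightarrow> unit_vec (x, 0) \<in> R"
  using R_add_right[of x 0 0] pm.subspace_neg[OF subspace_R, of "- unit_vec (x, 0)"] by simp

lemma R_sum_left:
  assumes "finite I" "\<And>i. i \<in> I \<Longrightarrow> v i \<in> free_rank n"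
  shows "unit_vec (sum v I, y) - (\<Sum>i\<in>I. unit_vec (v i, y)) \<in> R"
  using assms
proof (induction I)
  case empty
  then show ?case using R_zero_left by simp
next
  case (insert i I)
  have "unit_vec (v i + sum v I, y) - unit_vec (v i, y) - unit_vec (sum v I, y) +
      (unit_vec (sum v I, y) - (\<Sum>i\<in>I. unit_vec (v i, y))) \<in> R"
    using insert by (intro pm.subspace_add[OF subspace_R] R_add_left pm.subspace_sum[OF subspace_free_on]) auto
  then show ?case using insert.hyps by (simp add: algebra_simps)
qed

text \<open>Injectivity of \<open>tens\<close> modulo the relations: \<open>z\<close> is congruent
  to a standard form built from its image. The elements with this property form a submodule, and a
  pure tensor has it by expanding the left factor in unit vectors.\<close>

lemma tens_section:
  assumes "z \<in> free_on (free_rank n \<times> UNIV)"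
  shows "z - (\<Sum>k<n. unit_vec (unit_vec k, tens t z k)) \<in> R"
proof -
  let ?\<sigma> = "\<lambda>f. \<Sum>k<n. unit_vec (unit_vec k :: nat \<Rightarrow>\<^sub>0 'a, f k) :: ((nat \<Rightarrow>\<^sub>0 'a) \<times> 'c) \<Rightarrow>\<^sub>0 'a"
  let ?Q = "{z. z - ?\<sigma> (tens t z) \<in> R}"
  have u: "unit_vec k \<in> free_rank n" if "k < n" for k
    using that by (simp add: unit_vec_free_on)
  have \<sigma>_add: "?\<sigma> (\<lambda>k. f k + g k) - ?\<sigma> f - ?\<sigma> g \<in> R" for f g
    unfolding sum_subtractf[symmetric]
    using u by (intro pm.subspace_sum[OF subspace_R] R_add_right) auto
  have \<sigma>_scale: "?\<sigma> (\<lambda>k. t r (f k)) - pm_scale r (?\<sigma> f) \<in> R" for r f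
    unfolding pm.scale_sum_right sum_subtractf[symmetric]
    using u by (intro pm.subspace_sum[OF subspace_R] R_scale_right) auto
  have Q: "pm.subspace ?Q"
  proof (rule pm.subspaceI)
    have "?\<sigma> (tens t 0) \<in> R"
      using R_zero_right[OF u] by (intro pm.subspace_sum[OF subspace_R]) (simp add: tens_def)
    then show "0 \<in> ?Q" using pm.subspace_neg[OF subspace_R] by simp
    fix z w assume zw: "z \<in> ?Q" "w \<in> ?Q"
    have e: "tens t (z + w) = (\<lambda>k. tens t z k + tens t w k)"
      using module_hom.add[OF tens_hom] by blast
    have "(z - ?\<sigma> (tens t z)) + (w - ?\<sigma> (tens t w)) -
        (?\<sigma> (\<lambda>k. tens t z k + tens t w k) - ?\<sigma> (tens t z) - ?\<sigma> (tens t w)) \<in> R"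
      using zw by (intro pm.subspace_diff[OF subspace_R pm.subspace_add[OF subspace_R] \<sigma>_add]) simp_all
    then show "z + w \<in> ?Q" unfolding mem_Collect_eq e by (simp add: algebra_simps)
  next
    fix r z assume z: "z \<in> ?Q"
    have e: "tens t (pm_scale r z) = (\<lambda>k. t r (tens t z k))"
      using module_hom.scale[OF tens_hom] by blast
    have "pm_scale r (z - ?\<sigma> (tens t z)) -
        (?\<sigma> (\<lambda>k. t r (tens t z k)) - pm_scale r (?\<sigma> (tens t z))) \<in> R"
      using z by (intro pm.subspace_diff[OF subspace_R pm.subspace_scale[OF subspace_R] \<sigma>_scale]) simp
    then show "pm_scale r z \<in> ?Q" unfolding mem_Collect_eq e by (simp add: pm.scale_right_diff_distrib)
  qed
  have gen: "unit_vec (x, y) \<in> ?Q" if x: "x \<in> free_rank n" for x y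
  proof -
    have e: "tens t (unit_vec (x, y)) = (\<lambda>k. t (lk x k) y)" by (simp add: tens_single fun_eq_iff)
    let ?v = "\<lambda>k. pm_scale (lk x k) (unit_vec k)"
    have "unit_vec (sum ?v {..<n}, y) - (\<Sum>k<n. unit_vec (?v k, y)) \<in> R"
      using u by (intro R_sum_left pm.subspace_scale[OF subspace_free_on]) auto
    moreover have "(\<Sum>k<n. unit_vec (?v k, y) - pm_scale (lk x k) (unit_vec (unit_vec k, y))) \<in> R"
      using u by (intro pm.subspace_sum[OF subspace_R] R_scale_left) auto
    moreover have "(\<Sum>k<n. unit_vec (unit_vec k, t (lk x k) y) - pm_scale (lk x k) (unit_vec (unit_vec k, y))) \<in> R"
      using u by (intro pm.subspace_sum[OF subspace_R] R_scale_right) auto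
    ultimately have "(unit_vec (sum ?v {..<n}, y) - (\<Sum>k<n. unit_vec (?v k, y))) +
      (\<Sum>k<n. unit_vec (?v k, y) - pm_scale (lk x k) (unit_vec (unit_vec k, y))) -
      (\<Sum>k<n. unit_vec (unit_vec k, t (lk x k) y) - pm_scale (lk x k) (unit_vec (unit_vec k, y))) \<in> R"
      by (rule pm.subspace_diff[OF subspace_R pm.subspace_add[OF subspace_R]])
    then have "unit_vec (sum ?v {..<n}, y) - ?\<sigma> (\<lambda>k. t (lk x k) y) \<in> R"
      by (simp add: sum_subtractf)
    then show ?thesis using free_rank_expand[OF x] by (simp add: e)
  qed
  have "(\<Sum>p\<in>Poly_Mapping.keys z. Poly_Mapping.single p (lk z p)) \<in> ?Q"
  proof (rule pm.subspace_sum[OF Q])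
    fix p assume "p \<in> Poly_Mapping.keys z"
    then have "p \<in> free_rank n \<times> UNIV" using assms unfolding free_on_def[of "free_rank n \<times> UNIV"] by blast
    then have "unit_vec (fst p, snd p) \<in> ?Q" by (intro gen) auto
    then have "pm_scale (lk z p) (unit_vec p) \<in> ?Q" using pm.subspace_scale[OF Q] by simp
    moreover have "pm_scale (lk z p) (unit_vec p) = Poly_Mapping.single p (lk z p)"
      by (rule poly_mapping_eqI) (simp add: lookup_single when_def)
    ultimately show "Poly_Mapping.single p (lk z p) \<in> ?Q" by simp
  qed
  then show ?thesis using sum_single[of z] by simp
qed

end

end

context resolution_of begin

text \<open>Makes \<open>tens\<close> a chain map from the complex defining Tor to the matrix
  form.\<close>

lemma tens_tensor_lift:
  assumes "module t" and z: "z \<in> free_on (F (Suc i) \<times> UNIV)"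
  shows "tens t (tensor_lift (d (Suc i)) z) l = tdiff t X (Suc i) (tens t z) l"
proof -
  interpret t: tensor_power t using assms by (simp add: tensor_power_def ring_module.intro)
  interpret h: module_hom pm_scale t "\<lambda>z. tens t z l" by (rule t.tens_hom)
  let ?K = "Poly_Mapping.keys z"
  have "tens t (tensor_lift (d (Suc i)) z) l = (\<Sum>p\<in>?K. t (lk z p * lk (d (Suc i) (fst p)) l) (snd p))"
    unfolding tensor_lift_def h.sum by (rule sum.cong) (auto simp: t.tens_single)
  also have "\<dots> = (\<Sum>p\<in>?K. \<Sum>k<rk (Suc i). t (lk (d (Suc i) (unit_vec k)) l) (t (lk z p * lk (fst p) k) (snd p)))"
  proof (rule sum.cong[OF HOL.refl])
    fix p assume "p \<in> ?K"
    then have "fst p \<in> F (Suc i)" using z by (auto simp: free_on_def)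
    from lookup_d[OF this, of l]
    show "t (lk z p * lk (d (Suc i) (fst p)) l) (snd p) =
        (\<Sum>k<rk (Suc i). t (lk (d (Suc i) (unit_vec k)) l) (t (lk z p * lk (fst p) k) (snd p)))"
      by (simp add: sum_distrib_left t.scale_sum_left ac_simps)
  qed
  also have "\<dots> = (\<Sum>k<rk (Suc i). \<Sum>p\<in>?K. t (lk (d (Suc i) (unit_vec k)) l) (t (lk z p * lk (fst p) k) (snd p)))"
    by (rule sum.swap)
  also have "\<dots> = tdiff t X (Suc i) (tens t z) l"
    by (simp add: tdiff_def tens_def t.scale_sum_right)
  finally show ?thesis .
qed

lemma tens_pw: "module t \<Longrightarrow> z \<in> free_on (F i \<times> UNIV) \<Longrightarrow> tens t z \<in> pw UNIV (rk i)"
proof -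
  assume t: "module t" and z: "z \<in> free_on (F i \<times> UNIV)"
  interpret t: ring_module t using t by (simp add: ring_module.intro)
  have "tens t z k = 0" if "k \<ge> rk i" for k
    unfolding tens_def using z that
  proof (intro sum.neutral ballI)
    fix p assume "p \<in> Poly_Mapping.keys z"
    then have "fst p \<in> F i" using z by (auto simp: free_on_def)
    then show "t (lk z p * lk (fst p) k) (snd p) = 0" using that by (simp add: F_def free_on_iff)
  qed
  then show ?thesis by (simp add: pw_def)
qed

lemma tensor_lift_mem:
  assumes "z \<in> free_on (F (Suc i) \<times> UNIV)"
  shows "tensor_lift (d (Suc i)) z \<in> free_on (F i \<times> UNIV)"
  unfolding tensor_lift_def
proof (intro pm.subspace_sum[OF subspace_free_on])
  fix p assume "p \<in> Poly_Mapping.keys z"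
  then have "fst p \<in> F (Suc i)" using assms by (auto simp: free_on_def)
  from d_mem[OF this]
  show "(case p of (x, y) \<Rightarrow> Poly_Mapping.single (d (Suc i) x, y) (lk z (x, y))) \<in> free_on (F i \<times> UNIV)"
    by (cases p) (auto simp: free_on_iff lookup_single when_def)
qed

text \<open>A tuple \<open>Z\<close> is represented by the sum of the tensors of unit vectors with
  its coordinates. \<open>tens_section\<close> makes this a cycle in the sense of Tor, and
  \<open>tens\<close> translates the resulting boundary back.\<close>

lemma exact_at_of_cycles:
  assumes t: "module t"
    and sub: "tensor_cycles X t (Suc i) \<subseteq> tensor_boundaries X t (Suc i)"
  shows "exact_at t UNIV X (Suc i)"
  unfolding exact_at_def
proof (intro ballI impI)
  interpret t: tensor_power t using t by (simp add: tensor_power_def ring_module.intro)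
  interpret h: module_hom pm_scale t "\<lambda>z. tens t z l" for l by (rule t.tens_hom)
  fix Z :: "nat \<Rightarrow> 'c"
  assume Z: "Z \<in> pw UNIV (rk (Suc i))" "tdiff t X (Suc i) Z = (\<lambda>_. 0)"
  let ?z = "\<Sum>k<rk (Suc i). unit_vec (unit_vec k :: nat \<Rightarrow>\<^sub>0 'a, Z k)"
  have z: "?z \<in> free_on (F (Suc i) \<times> UNIV)"
    by (intro pm.subspace_sum[OF subspace_free_on] unit_vec_free_on) (simp add: F_def unit_vec_free_on)
  have tz: "tens t ?z = Z"
  proof
    fix l
    have "tens t ?z l = (\<Sum>k<rk (Suc i). if k = l then Z k else 0)"
      unfolding h.sum by (rule sum.cong) (auto simp: t.tens_single lookup_single when_def)
    also have "\<dots> = Z l" using Z(1) by (subst sum.delta) (auto simp: pw_def)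
    finally show "tens t ?z l = Z l" .
  qed
  let ?w = "tensor_lift (d (Suc i)) ?z"
  let ?R = "tensor_rels pm_scale (F i) t UNIV"
  have w: "?w \<in> free_on (F i \<times> UNIV)" by (rule tensor_lift_mem[OF z])
  have "tens t ?w = (\<lambda>_. 0)" using tens_tensor_lift[OF t z] tz Z(2) by auto
  then have "?w - (\<Sum>k<rk i. unit_vec (unit_vec k, 0)) \<in> ?R"
    using t.tens_section[of ?w "rk i"] w by (simp add: F_def)
  moreover have "(\<Sum>k<rk i. unit_vec (unit_vec k, 0)) \<in> ?R"
    unfolding F_def
    by (intro pm.subspace_sum[OF t.subspace_R] t.R_zero_right unit_vec_free_on) simp
  ultimately have "?w - (\<Sum>k<rk i. unit_vec (unit_vec k, 0)) + (\<Sum>k<rk i. unit_vec (unit_vec k, 0)) \<in> ?R"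
    unfolding F_def by (rule pm.subspace_add[OF t.subspace_R])
  then have "?z \<in> tensor_cycles X t (Suc i)"
    using z by (simp add: tensor_cycles_def)
  then obtain w r where wr: "?z = tensor_lift (d (Suc (Suc i))) w + r"
      "w \<in> free_on (F (Suc (Suc i)) \<times> UNIV)" "r \<in> tensor_rels pm_scale (F (Suc i)) t UNIV"
    using sub unfolding tensor_boundaries_def by blast
  have "Z l = tdiff t X (Suc (Suc i)) (tens t w) l" for l
    using tz t.tens_rels[OF wr(3)] tens_tensor_lift[OF t wr(2)] h.add unfolding wr(1)
    by (metis add.right_neutral)
  then show "\<exists>W\<in>pw UNIV (rk (Suc (Suc i))). Z = tdiff t X (Suc (Suc i)) W"
    using tens_pw[OF t wr(2)] by blast
qed

end

lemma exact_at_of_Tor: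
  assumes "resolution_of s (chosen_res s)" and t: "module t" and tor: "Tor_is_zero s t (Suc i)"
  shows "exact_at t UNIV (chosen_res s) (Suc i)"
proof -
  interpret X: resolution_of s "chosen_res s" by fact
  let ?B = "tensor_boundaries (chosen_res s) t (Suc i)" and ?C = "tensor_cycles (chosen_res s) t (Suc i)"
  have "0 \<in> tensor_rels pm_scale (res_mod (chosen_res s) (Suc i)) t UNIV"
    unfolding tensor_rels_def Let_def by (rule pm.span_zero)
  then have "tensor_lift (res_diff (chosen_res s) (Suc (Suc i))) 0 + 0 \<in> ?B"
    unfolding tensor_boundaries_def by (fastforce simp: free_on_iff)
  \<comment> \<open>As 0 is a boundary, a cycle lies in its own coset, which by assumption is the
    zero coset \<open>?B\<close>.\<close>
  then have 0: "0 \<in> ?B" by (simp add: tensor_lift_def)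
  have "?C \<subseteq> ?B"
  proof
    fix z assume "z \<in> ?C"
    then have "coset ?B z = coset ?B 0"
      using tor unfolding Tor_is_zero_def Tor_def quotient_set_def by blast
    moreover have "z \<in> coset ?B z" using 0 unfolding coset_def by force
    moreover have "coset ?B 0 = ?B" by (simp add: coset_def)
    ultimately show "z \<in> ?B" by simp
  qed
  then show ?thesis by (rule X.exact_at_of_cycles[OF t])
qed

section \<open>Minimal free resolutions\<close>

definition fun_scale :: "('a \<Rightarrow> 'v \<Rightarrow> 'v) \<Rightarrow> 'a \<Rightarrow> (nat \<Rightarrow> 'v) \<Rightarrow> nat \<Rightarrow> 'v"
  where "fun_scale s r Z = (\<lambda>k. s r (Z k))"

lemma module_fun_scale:
  assumes "module s" shows "module (fun_scale s)"
proof -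
  interpret ring_module s using assms by (simp add: ring_module.intro)
  show ?thesis
    by unfold_locales
      (simp_all add: fun_scale_def fun_eq_iff scale_right_distrib scale_left_distrib)
qed

context ring_module begin

interpretation fs: ring_module "fun_scale s"
  by (simp add: ring_module.intro module_fun_scale module_axioms)

lemma subspace_pw: "subspace V \<Longrightarrow> module.subspace (fun_scale s) (pw V n)"
  by (auto simp: fs.subspace_def pw_def fun_scale_def intro: subspace_0 subspace_add subspace_scale)

text \<open>Inserts \<open>?S\<close>, the tuples with last coordinate in \<open>U\<close>:
  evaluation at \<open>n\<close> pulls the chain for \<open>V / U\<close> back to the part above it,
  and erasing coordinate \<open>n\<close> pulls the induction hypothesis back to the part
  below.\<close>

lemma chain_length_pw:
  assumes l: "chain_length U V l"
  shows "ring_module.chain_length (fun_scale s) (pw U n) (pw V n) (n * l)"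
proof (induction n)
  have U: "subspace U" and V: "subspace V" and UV: "U \<subseteq> V"
    using chain_length_subspace[OF l] by auto
  {
    case 0
    have "pw U 0 = pw V 0" by (auto simp: pw_def)
    then show ?case using subspace_pw[OF V, of 0] by (auto simp: fs.chain_length_0_iff)
  next
    case (Suc n)
    let ?S = "{Z \<in> pw V (Suc n). Z n \<in> U}"
    have ev: "module_hom (fun_scale s) s (\<lambda>Z. Z n)"
      by (rule module_hom.intro[OF fs.module_axioms module_axioms], unfold_locales)
        (simp_all add: fun_scale_def)
    have up: "module_hom (fun_scale s) (fun_scale s) (\<lambda>Z. Z(n := 0))"
      by (rule module_hom.intro[OF fs.module_axioms fs.module_axioms], unfold_locales)
        (auto simp: fun_scale_def)
    have S: "fs.subspace ?S"
      by (rule module_hom_subspace_vimage[OF ev subspace_pw[OF V] U])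
    have "V \<subseteq> (\<lambda>Z. Z n) ` pw V (Suc n)"
    proof
      fix x assume "x \<in> V"
      then have "(\<lambda>k. if k = n then x else 0) \<in> pw V (Suc n)"
        using subspace_0[OF V] by (auto simp: pw_def)
      from image_eqI[OF _ this, of x "\<lambda>Z. Z n"] show "x \<in> (\<lambda>Z. Z n) ` pw V (Suc n)" by simp
    qed
    from chain_length_vimage[OF ev subspace_pw[OF V] l this]
    have "fs.chain_length ?S {Z \<in> pw V (Suc n). Z n \<in> V} l" .
    moreover have "{Z \<in> pw V (Suc n). Z n \<in> V} = pw V (Suc n)" by (auto simp: pw_def)
    ultimately have 1: "fs.chain_length ?S (pw V (Suc n)) l" by simp
    have "pw V n \<subseteq> (\<lambda>Z. Z(n := 0)) ` ?S"
    proof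
      fix Z assume "Z \<in> pw V n"
      then have "Z \<in> ?S" "Z = Z(n := 0)"
        using subspace_0[OF V] subspace_0[OF U] by (auto simp: pw_def less_Suc_eq fun_eq_iff)
      then show "Z \<in> (\<lambda>Z. Z(n := 0)) ` ?S" by blast
    qed
    from chain_length_vimage[OF up S Suc this]
    have "fs.chain_length {Z \<in> ?S. Z(n := 0) \<in> pw U n} {Z \<in> ?S. Z(n := 0) \<in> pw V n} (n * l)" .
    moreover have "{Z \<in> ?S. Z(n := 0) \<in> pw V n} = ?S"
      by (auto simp: pw_def)
    moreover have "{Z \<in> ?S. Z(n := 0) \<in> pw U n} = pw U (Suc n)"
      using UV by (auto simp: pw_def less_Suc_eq split: if_splits)
    ultimately have 2: "fs.chain_length (pw U (Suc n)) ?S (n * l)" by simp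
    show ?case using fs.chain_length_trans[OF 1 2] by (simp add: add.commute)
  }
qed

end

text \<open>The submodule \<open>I^n\<close> of \<open>R^n\<close>; for \<open>I = \<mm>\<close> it
  is \<open>\<mm> R^n\<close>, see \<open>mS_free\<close>.\<close>

definition coeffs_in :: "'a::comm_ring_1 set \<Rightarrow> nat \<Rightarrow> (nat \<Rightarrow>\<^sub>0 'a) set"
  where "coeffs_in I n = {v \<in> free_rank n. \<forall>k. lk v k \<in> I}"

lemma chain_length_coeffs_in:
  assumes l: "rg.chain_length I J l"
  shows "pm.chain_length (coeffs_in I n) (coeffs_in J n) (n * l)"
proof -
  have I: "0 \<in> I" "0 \<in> J"
    using rg.chain_length_subspace[OF l] rg.subspace_0 by auto
  interpret fs: ring_module "fun_scale ((*) :: 'a \<Rightarrow> 'a \<Rightarrow> 'a)"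
    by (simp add: ring_module.intro module_fun_scale module_mult)
  have h: "module_hom pm_scale (fun_scale (*)) (lk :: (nat \<Rightarrow>\<^sub>0 'a) \<Rightarrow> _)"
    by (rule module_hom.intro[OF module_pm_scale fs.module_axioms], unfold_locales)
      (simp_all add: fun_scale_def fun_eq_iff lookup_add)
  have "pw J n \<subseteq> lk ` free_rank n"
  proof
    fix Z assume Z: "Z \<in> pw J n"
    \<comment> \<open>Column 0 of a one-column matrix turns a coefficient function into a
      vector.\<close>
    have "lk (transp n (\<lambda>k. Poly_Mapping.single 0 (Z k)) 0) = Z"
      using Z by (auto simp: fun_eq_iff lookup_transp pw_def)
    then show "Z \<in> lk ` free_rank n" using image_eqI[OF _ transp_mem] by metis
  qed
  from chain_length_vimage[OF h subspace_free_on rg.chain_length_pw[OF l] this]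
  have "pm.chain_length {v \<in> free_rank n. lk v \<in> pw I n} {v \<in> free_rank n. lk v \<in> pw J n} (n * l)" .
  moreover have "{v \<in> free_rank n. lk v \<in> pw K n} = coeffs_in K n" if "0 \<in> K" for K :: "'a set"
    using that by (auto simp: coeffs_in_def pw_def free_on_iff not_less) (metis not_less)
  ultimately show ?thesis using I by simp
qed

lemma coeffs_in_0: "coeffs_in {0} n = {0}"
  by (auto simp: coeffs_in_def free_on_iff intro: poly_mapping_eqI)

lemma coeffs_in_UNIV: "coeffs_in UNIV n = free_rank n"
  by (simp add: coeffs_in_def)

context module_hom begin

lemma image_ideal_smult: "f ` ideal_smult s1 I S = ideal_smult s2 I (f ` S)"
proof -
  have "f ` {s1 r x |r x. r \<in> I \<and> x \<in> S} = {s2 r x |r x. r \<in> I \<and> x \<in> f ` S}"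
    by (force simp: scale)
  then show ?thesis by (simp add: ideal_smult_def span_image[symmetric])
qed

end

context cube_zero_ring begin

lemma mS_free: "P.mS (free_rank n) = coeffs_in \<mm> n"
proof
  show "P.mS (free_rank n) \<subseteq> coeffs_in \<mm> n"
  proof (rule P.mS_least)
    show "pm.subspace (coeffs_in \<mm> n)"
      using subspace_free_on[of "{..<n}"] zero_mm
      by (auto simp: pm.subspace_def coeffs_in_def lookup_add intro: add_mm mult_mm)
    fix r and x :: "nat \<Rightarrow>\<^sub>0 'a" assume "r \<in> \<mm>" "x \<in> free_rank n"
    then show "pm_scale r x \<in> coeffs_in \<mm> n"
      using pm.subspace_scale[OF subspace_free_on] by (auto simp: coeffs_in_def intro: mult_mm')
  qed
  show "coeffs_in \<mm> n \<subseteq> P.mS (free_rank n)"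
  proof
    fix v :: "nat \<Rightarrow>\<^sub>0 'a" assume v: "v \<in> coeffs_in \<mm> n"
    then have "(\<Sum>k<n. pm_scale (lk v k) (unit_vec k)) \<in> P.mS (free_rank n)"
      by (intro pm.subspace_sum[OF P.subspace_mS] P.mS_I unit_vec_free_on) (auto simp: coeffs_in_def)
    then show "v \<in> P.mS (free_rank n)"
      using free_rank_expand[of v n] v by (simp add: coeffs_in_def)
  qed
qed

text \<open>Together with \<open>embdim\<close> it determines the lengths of free modules. In the
  end \<open>embdim\<close> is \<open>e\<close>, and this number is \<open>a\<close> because the
  socle equals \<open>\<mm>2\<close>.\<close>

definition len_mm2 :: nat where "len_mm2 = (THE n. rg.chain_length {0} \<mm>2 n)"

definition embdim :: nat where "embdim = (THE n. rg.chain_length \<mm>2 \<mm> n)"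

lemma chain_length_mm2: "rg.chain_length {0} \<mm>2 len_mm2"
  unfolding len_mm2_def
  using chain_length_ring rg.chain_length_unique by (metis (mono_tags, lifting) theI)

lemma chain_length_mm: "rg.chain_length \<mm>2 \<mm> embdim"
  unfolding embdim_def
  using chain_length_ring rg.chain_length_unique by (metis (mono_tags, lifting) theI)

lemma chain_length_residue: "rg.chain_length \<mm> UNIV 1"
  using chain_length_ring by blast

lemma min_gens_mm: "min_gens (*) \<mm> = embdim"
  using R.min_gens_eq(1)[OF ideal_mm] chain_length_mm by (simp add: \<mm>2_def)

lemma chain_length_free: "pm.chain_length {0} (free_rank n :: (nat \<Rightarrow>\<^sub>0 'a) set) (n * (1 + embdim + len_mm2))"
proof -
  have "rg.chain_length {0} (UNIV :: 'a set) (len_mm2 + (embdim + 1))"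
    using rg.chain_length_trans chain_length_residue chain_length_mm chain_length_mm2 by blast
  from chain_length_coeffs_in[OF this, of n] show ?thesis
    by (simp add: coeffs_in_0 coeffs_in_UNIV algebra_simps)
qed

lemma submodule_free_finite:
  fixes K :: "(nat \<Rightarrow>\<^sub>0 'a) set"
  assumes "pm.subspace K" "K \<subseteq> free_rank n"
  obtains p q where "pm.chain_length {0} K p" "pm.chain_length K (free_rank n) q"
    "p + q = n * (1 + embdim + len_mm2)"
  using pm.chain_length_split[OF chain_length_free assms(1) _ assms(2)] pm.subspace_0[OF assms(1)]
  by auto

lemma submodule_free_finitely_generated:
  fixes K :: "(nat \<Rightarrow>\<^sub>0 'a) set"
  assumes "pm.subspace K" "K \<subseteq> free_rank n"
  shows "finitely_generated pm_scale K"
proof -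
  obtain p where "pm.chain_length {0} K p" using submodule_free_finite[OF assms] .
  from pm.chain_length_span[OF this] obtain B where "finite B" "K = pm.ssum {0} (pm.span B)"
    by blast
  then show ?thesis by (auto simp: finitely_generated_def pm.ssum_def)
qed

end

section \<open>Existence of minimal free resolutions\<close>

definition lin_comb :: "('a::comm_ring_1 \<Rightarrow> 'v::ab_group_add \<Rightarrow> 'v) \<Rightarrow> (nat \<Rightarrow> 'v) \<Rightarrow> nat \<Rightarrow> (nat \<Rightarrow>\<^sub>0 'a) \<Rightarrow> 'v"
  where "lin_comb s g n v = (\<Sum>k<n. s (lk v k) (g k))"

context cube_zero_module begin

lemma lin_comb_hom: "module_hom pm_scale s (lin_comb s g n)"
  by (rule module_hom.intro[OF module_pm_scale module_axioms], unfold_locales)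
    (simp_all add: lin_comb_def lookup_add scale_left_distrib sum.distrib scale_sum_right)

text \<open>Sends the unit vectors to a minimal generating set; \<open>min_gens_relation\<close>
  then forces every coefficient of a relation into \<open>\<mm>\<close>.\<close>

lemma minimal_presentation_exists:
  assumes S: "finitely_generated s S"
  shows "\<exists>n f. presentation s S n f {v \<in> free_rank n. f v = 0} \<and>
           {v \<in> free_rank n. f v = 0} \<subseteq> coeffs_in \<mm> n"
proof -
  obtain B where B: "finite B" "card B = min_gens s S" "span B = S"
    using min_gens_basis[OF S] by blast
  let ?n = "card B"
  obtain g where g: "bij_betw g {0..<?n} B" using ex_bij_betw_nat_finite[OF B(1)] by blast
  then have gB: "bij_betw g {..<?n} B" by (simp add: atLeast0LessThan)
  let ?h = "the_inv_into {..<?n} g"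
  let ?f = "lin_comb s g ?n"
  interpret f: module_hom pm_scale s ?f by (rule lin_comb_hom)
  have val: "?f v = (\<Sum>b\<in>B. lk v (?h b) *s b)" for v
  proof -
    have "(\<Sum>b\<in>B. lk v (?h b) *s b) = (\<Sum>k<?n. lk v (?h (g k)) *s g k)"
      using sum.reindex_bij_betw[OF gB, of "\<lambda>b. lk v (?h b) *s b"] by simp
    also have "\<dots> = ?f v"
      unfolding lin_comb_def using gB
      by (intro sum.cong) (auto simp: the_inv_into_f_f bij_betw_def)
    finally show ?thesis by simp
  qed
  have "?f ` free_rank ?n = S"
  proof
    show "?f ` free_rank ?n \<subseteq> S"
      unfolding B(3)[symmetric] by (auto simp: val intro!: span_sum intro: span_scale span_base)
    show "S \<subseteq> ?f ` free_rank ?n"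
    proof
      fix x assume "x \<in> S"
      then obtain u where u: "x = (\<Sum>b\<in>B. u b *s b)" using span_finite[OF B(1)] B(3) by auto
      let ?v = "transp ?n (\<lambda>k. Poly_Mapping.single 0 (u (g k))) 0"
      have "?f ?v = (\<Sum>k<?n. u (g k) *s g k)"
        by (simp add: lin_comb_def lookup_transp)
      also have "\<dots> = x"
        unfolding u using sum.reindex_bij_betw[OF gB, of "\<lambda>b. u b *s b"] by simp
      finally show "x \<in> ?f ` free_rank ?n" using transp_mem by blast
    qed
  qed
  moreover have "v \<in> coeffs_in \<mm> ?n" if v: "v \<in> free_rank ?n" "?f v = 0" for v
  proof -
    have "lk v k \<in> \<mm>" if "k < ?n" for k
    proof -
      have "lk v (?h (g k)) \<in> \<mm>"
        by (rule min_gens_relation[OF B(1), of "\<lambda>b. lk v (?h b)"])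
          (use B v(2)[unfolded val] gB that in \<open>auto simp: bij_betw_def\<close>)
      then show ?thesis using gB that by (simp add: the_inv_into_f_f bij_betw_def)
    qed
    then show ?thesis using v(1) zero_mm by (auto simp: coeffs_in_def free_on_iff) (metis not_less)
  qed
  ultimately show ?thesis
    using f.module_hom_axioms unfolding presentation_def by blast
qed

text \<open>Presents the kernels minimally again and again; they are finitely generated because they
  sit in free modules of finite length.\<close>

theorem minimal_free_resolution_exists:
  assumes fg: "finitely_generated s UNIV"
  shows "\<exists>X. minimal_free_resolution \<mm> s X"
proof -
  let ?ker = "\<lambda>n f. {v \<in> free_rank n. f v = 0}"
  obtain n0 f0 where f0: "presentation s UNIV n0 f0 (?ker n0 f0)" "?ker n0 f0 \<subseteq> coeffs_in \<mm> n0"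
    using minimal_presentation_exists[OF fg] by blast
  have sub: "pm.subspace (?ker n f)"
    if "module_hom pm_scale t f" for n and f :: "(nat \<Rightarrow>\<^sub>0 'a) \<Rightarrow> 'v::ab_group_add" and t
    using module_hom_subspace_vimage[OF that subspace_free_on, of "{0}" "{..<n}"]
      module.subspace_single_0[of t] that by (simp add: module_hom_def)
  let ?ok = "\<lambda>K. pm.subspace K \<and> (\<exists>m. K \<subseteq> free_rank m)"
  let ?Q = "\<lambda>K n f. presentation pm_scale K n f (?ker n f) \<and> ?ker n f \<subseteq> coeffs_in \<mm> n"
  have "\<exists>p. ?Q K (fst p) (snd p)" if K: "?ok K" for K :: "(nat \<Rightarrow>\<^sub>0 'a) set"
  proof -
    have "finitely_generated pm_scale K" using K submodule_free_finitely_generated by blast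
    from cube_zero_module.minimal_presentation_exists[OF module_cube_zero[OF module_pm_scale] this]
    obtain n f where "?Q K n f" by blast
    then show ?thesis by (intro exI[of _ "(n, f)"]) simp
  qed
  \<comment> \<open>One function picks minimal presentations for all admissible submodules at once,
    so that the resolution can be defined by recursion.\<close>
  then have "\<exists>P. \<forall>K. ?ok K \<longrightarrow> ?Q K (fst (P K)) (snd (P K))"
    by (intro choice) blast
  then obtain P where P: "\<And>K. ?ok K \<Longrightarrow> ?Q K (fst (P K)) (snd (P K))"
    by blast
  define N where "N K = fst (P K)" for K
  define G where "G K = snd (P K)" for K
  have NG: "?Q K (N K) (G K)" if "?ok K" for K
    using P[OF that] by (simp add: N_def G_def)
  \<comment> \<open>\<open>K i\<close> is the syzygy with index \<open>i + 1\<close>; hence the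
    shift \<open>i - 1\<close> in the differentials of \<open>X\<close>.\<close>
  define K where "K = rec_nat (?ker n0 f0) (\<lambda>_ K. ?ker (N K) (G K))"
  have K_Suc: "K (Suc i) = ?ker (N (K i)) (G (K i))" and K_0: "K 0 = ?ker n0 f0" for i
    by (simp_all add: K_def)
  have ok: "?ok (K i)" for i
  proof (induction i)
    case 0
    have "pm.subspace (?ker n0 f0)"
      using sub f0(1) unfolding presentation_def by blast
    then show ?case unfolding K_0 by blast
  next
    case (Suc i)
    have "pm.subspace (K (Suc i))"
      unfolding K_Suc using sub NG[OF Suc] unfolding presentation_def by blast
    then show ?case unfolding K_Suc by blast
  qed
  define X where "X = \<lparr>res_rank = (\<lambda>i. case i of 0 \<Rightarrow> n0 | Suc j \<Rightarrow> N (K j)), res_aug = f0,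
      res_diff = (\<lambda>i. G (K (i - 1)))\<rparr>"
  have rk: "res_mod X 0 = free_rank n0" "res_mod X (Suc i) = free_rank (N (K i))" for i
    by (simp_all add: X_def res_mod_def)
  have d: "res_diff X (Suc i) = G (K i)" "res_aug X = f0" for i
    by (simp_all add: X_def)
  have hom: "module_hom pm_scale pm_scale (G (K i))" and im: "G (K i) ` free_rank (N (K i)) = K i"
    and min: "K (Suc i) \<subseteq> coeffs_in \<mm> (N (K i))" for i
    using NG[OF ok, of i] by (auto simp: presentation_def K_Suc)
  have "free_resolution s X"
    unfolding free_resolution_def
  proof (intro conjI allI impI)
    show "module_hom pm_scale s (res_aug X)" "res_aug X ` res_mod X 0 = UNIV"
      using f0(1) by (simp_all add: presentation_def d rk)
    show "res_diff X 1 ` res_mod X 1 = {v \<in> res_mod X 0. res_aug X v = 0}"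
      using im[of 0] by (simp add: d rk K_0)
    fix i :: nat assume "1 \<le> i"
    then obtain j where i: "i = Suc j" by (cases i) auto
    show "module_hom pm_scale pm_scale (res_diff X i)" by (simp add: i d hom)
    show "res_diff X (Suc i) ` res_mod X (Suc i) = {v \<in> res_mod X i. res_diff X i v = 0}"
      using im[of "Suc j"] by (simp add: i d rk K_Suc)
  qed
  moreover have "res_diff X (Suc i) ` res_mod X (Suc i) \<subseteq> P.mS (res_mod X i)" for i
  proof (cases i)
    case 0
    then show ?thesis using f0(2) im[of 0] by (simp add: d rk mS_free K_0)
  next
    case (Suc j)
    then show ?thesis using im[of i] min[of j] by (simp add: d rk mS_free)
  qed
  ultimately show ?thesis unfolding minimal_free_resolution_def by blast
qed

end

section \<open>Lengths and ranks along a minimal resolution\<close>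

context cube_zero_module begin

lemma gamma_eq:
  assumes S: "subspace S" and m: "chain_length {0} (mS S) m" and n: "chain_length (mS S) S n"
    and "n > 0"
  shows "gamma s S = of_nat m / of_nat n"
proof -
  have "module_length s S = m + n"
    by (rule module_length_eq[OF chain_length_trans[OF n m]])
  then show ?thesis
    using min_gens_eq(1)[OF S n] \<open>n > 0\<close> by (simp add: gamma_def field_simps)
qed

text \<open>Minimality makes \<open>V / \<mm> V\<close> isomorphic to
  \<open>R^n / \<mm> R^n\<close>, of length \<open>n\<close>. The rest is additivity of length for
  \<open>K\<close>, \<open>R^n\<close> and \<open>V\<close>.\<close>

lemma presentation_lengths:
  assumes pres: "presentation s V n f K" and min: "K \<subseteq> coeffs_in \<mm> n"
  shows "\<exists>k m. pm.chain_length {0} K k \<and> chain_length {0} (mS V) m \<and>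
           chain_length (mS V) V n \<and> k + m + n = n * (1 + embdim + len_mm2)"
proof -
  interpret f: module_hom pm_scale s f using pres by (simp add: presentation_def)
  have V: "V = f ` free_rank n" and K: "K = {v \<in> free_rank n. f v = 0}"
    using pres by (auto simp: presentation_def)
  have subK: "pm.subspace K"
    using module_hom_subspace_vimage[OF f.module_hom_axioms subspace_free_on subspace_single_0, of "{..<n}"] K
    by simp
  obtain k q where kq: "pm.chain_length {0} K k" "pm.chain_length K (free_rank n) q"
      "k + q = n * (1 + embdim + len_mm2)"
    using submodule_free_finite[OF subK, of n] K by auto
  have "f ` K = {0}" using pm.subspace_0[OF subK] f.zero K by force
  then have q: "chain_length {0} V q"
    using chain_length_image[OF f.module_hom_axioms kq(2)] V K by auto
  have "pm.chain_length (coeffs_in \<mm> n) (coeffs_in UNIV n) (n * 1)"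
    by (rule chain_length_coeffs_in[OF chain_length_residue])
  then have "chain_length (f ` coeffs_in \<mm> n) (f ` free_rank n) (n * 1)"
    by (intro chain_length_image[OF f.module_hom_axioms]) (use min K in \<open>auto simp: coeffs_in_UNIV\<close>)
  moreover have "f ` coeffs_in \<mm> n = mS V"
    using f.image_ideal_smult[of \<mm> "free_rank n"] by (simp add: mS_free V)
  ultimately have n: "chain_length (mS V) V n" by (simp add: V)
  have sub: "subspace (mS V)" "{0} \<subseteq> mS V" "mS V \<subseteq> V"
    using chain_length_subspace[OF n] subspace_0 by auto
  obtain m n' where "chain_length {0} (mS V) m" "chain_length (mS V) V n'" "m + n' = q"
    using chain_length_split[OF q sub] by blast
  then show ?thesis using kq n chain_length_unique[OF n] by (metis add.assoc)
qed

end

text \<open>Any nonzero element of the last nonzero power of \<open>\<mm>\<close> will do.\<close>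

lemma (in cube_zero_ring) ring_nonzero_socle: "\<exists>z. z \<noteq> 0 \<and> (\<forall>r\<in>\<mm>. r * z = 0)"
proof (cases "\<mm>2 = {0}")
  case False
  then obtain z where "z \<in> \<mm>2" "z \<noteq> 0"
    using rg.subspace_0[OF R.subspace_mS] unfolding \<mm>2_def by blast
  then show ?thesis using mm2_mm by blast
next
  case True
  show ?thesis
  proof (cases "\<mm> = {0}")
    case True
    have "(1::'a) \<noteq> 0" using one_notin_mm zero_mm by metis
    then show ?thesis using True by (intro exI[of _ 1]) auto
  next
    case False
    then obtain z where "z \<in> \<mm>" "z \<noteq> 0" using zero_mm by blast
    then show ?thesis using R.mS_I[of _ z \<mm>] True unfolding \<mm>2_def by blast
  qed
qed

section \<open>Homology with coefficients for a minimal resolution\<close>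

locale minimal_resolution = cube_zero_module \<mm> s + resolution_of s X
  for \<mm> :: "'a::comm_ring_1 set" and s :: "'a \<Rightarrow> 'b::ab_group_add \<Rightarrow> 'b" (infixr "*s" 75)
    and X :: "('a, 'b) resolution" +
  assumes minimal: "res_diff X (Suc i) ` res_mod X (Suc i) \<subseteq> coeffs_in \<mm> (res_rank X i)"
    and square_zero: "r \<in> \<mm> \<Longrightarrow> q \<in> \<mm> \<Longrightarrow> r *s (q *s x) = 0"
    and not_free: "\<not> free_module s UNIV"
begin

lemma d_unit_vec_mm: "k < rk (Suc i) \<Longrightarrow> lk (d (Suc i) (unit_vec k)) l \<in> \<mm>"
  using minimal[of i] unit_vec_free_on[of k "{..<rk (Suc i)}"]
  by (auto simp: F_def coeffs_in_def image_subset_iff)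

lemma tdiff_mS:
  assumes "module t" "Z \<in> pw V (rk (Suc i))"
  shows "tdiff t X (Suc i) Z l \<in> ideal_smult t \<mm> V"
proof -
  interpret T: cube_zero_module \<mm> t using assms by (simp add: module_cube_zero)
  show ?thesis
    unfolding tdiff_def using assms(2)
    by (intro T.subspace_sum[OF T.subspace_mS] T.mS_I d_unit_vec_mm) (auto simp: pw_def)
qed

lemma tdiff_annihilated:
  assumes "module t" "\<And>r k. r \<in> \<mm> \<Longrightarrow> t r (Z k) = 0"
  shows "tdiff t X (Suc i) Z = (\<lambda>_. 0)"
  using assms d_unit_vec_mm by (auto simp: tdiff_def)

context
  fixes t :: "'a \<Rightarrow> 'v::ab_group_add \<Rightarrow> 'v" and V
  assumes t: "module t" and V: "module.subspace t V"
begin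

interpretation T: cube_zero_module \<mm> t
  using t by (rule module_cube_zero)

text \<open>Boundaries have coordinates in \<open>\<mm> V\<close>, as the matrices have entries in
  \<open>\<mm>\<close>; the positive rank provides a coordinate 0 to hold \<open>x\<close>.\<close>

lemma socle_subset_mS:
  assumes ex: "exact_at t V X (Suc i)" and pos: "rk (Suc i) > 0"
    and x: "x \<in> V" "\<And>r. r \<in> \<mm> \<Longrightarrow> t r x = 0"
  shows "x \<in> ideal_smult t \<mm> V"
proof -
  let ?Z = "\<lambda>k::nat. if k = 0 then x else 0"
  have "?Z \<in> pw V (rk (Suc i))" using x pos T.subspace_0[OF V] by (auto simp: pw_def)
  moreover have "tdiff t X (Suc i) ?Z = (\<lambda>_. 0)"
    by (rule tdiff_annihilated[OF t]) (use x in auto)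
  ultimately obtain W where W: "W \<in> pw V (rk (Suc (Suc i)))" "?Z = tdiff t X (Suc (Suc i)) W"
    using ex unfolding exact_at_def by blast
  show ?thesis using tdiff_mS[OF t W(1), of 0] fun_cong[OF W(2), of 0] by simp
qed

text \<open>With \<open>b\<close> and \<open>c\<close> the two ranks, exactness gives the
  differential \<open>?D\<close> the kernel \<open>(\<mm> V)^b\<close> and the image
  \<open>(\<mm> V)^c\<close>, so \<open>(V / \<mm> V)^b\<close> and \<open>(\<mm> V)^c\<close> have
  the same length.\<close>

lemma rank_ratio:
  assumes sq: "\<And>r q x. r \<in> \<mm> \<Longrightarrow> q \<in> \<mm> \<Longrightarrow> x \<in> V \<Longrightarrow> t r (t q x) = 0"
    and ex: "exact_at t V X (Suc i)" "exact_at t V X (Suc (Suc i))"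
    and m: "ring_module.chain_length t {0} (ideal_smult t \<mm> V) m"
    and n: "ring_module.chain_length t (ideal_smult t \<mm> V) V n"
  shows "rk (Suc (Suc i)) * n = rk (Suc i) * m"
proof -
  interpret fs: ring_module "fun_scale t"
    by (simp add: ring_module.intro module_fun_scale t)
  let ?b = "rk (Suc (Suc i))" and ?c = "rk (Suc i)" and ?D = "tdiff t X (Suc (Suc i))"
  have kill: "t r x = 0" if "r \<in> \<mm>" "x \<in> T.mS V" for r x
  proof -
    have "T.mS V \<subseteq> {x. t r x \<in> {0}}"
      by (rule T.mS_least[OF T.subspace_colon[OF T.subspace_single_0]]) (use sq that in auto)
    then show ?thesis using that by blast
  qed
  have sub: "T.mS V \<subseteq> V" by (rule T.mS_subset[OF V])
  have cyc: "tdiff t X (Suc k) Z = (\<lambda>_. 0)" if "Z \<in> pw (T.mS V) (rk (Suc k))" for k Z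
  proof (rule tdiff_annihilated[OF t])
    fix r l assume "r \<in> \<mm>"
    then show "t r (Z l) = 0"
      using that kill by (cases "l < rk (Suc k)") (auto simp: pw_def)
  qed
  have hom: "module_hom (fun_scale t) (fun_scale t) ?D"
    by (rule module_hom.intro[OF fs.module_axioms fs.module_axioms], unfold_locales)
      (simp_all add: fun_eq_iff tdiff_def fun_scale_def T.scale_right_distrib sum.distrib
        T.scale_sum_right mult.commute)
  have "pw (T.mS V) ?c \<subseteq> ?D ` pw V ?b"
  proof
    fix Z assume Z: "Z \<in> pw (T.mS V) ?c"
    then have "Z \<in> pw V ?c" using sub by (auto simp: pw_def)
    then show "Z \<in> ?D ` pw V ?b" using ex(1) cyc[OF Z] unfolding exact_at_def by blast
  qed
  note chain_length_vimage[OF hom T.subspace_pw[OF V] T.chain_length_pw[OF m] this]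
  moreover have "{Z \<in> pw V ?b. ?D Z \<in> pw {0} ?c} = pw (T.mS V) ?b"
  proof
    have z: "pw {0::'v} ?c = {\<lambda>_. 0}" by (auto simp: pw_def fun_eq_iff) (metis not_le)
    show "pw (T.mS V) ?b \<subseteq> {Z \<in> pw V ?b. ?D Z \<in> pw {0} ?c}"
      using cyc sub unfolding z by (auto simp: pw_def)
    show "{Z \<in> pw V ?b. ?D Z \<in> pw {0} ?c} \<subseteq> pw (T.mS V) ?b"
    proof
      fix Z assume Z: "Z \<in> {Z \<in> pw V ?b. ?D Z \<in> pw {0} ?c}"
      then obtain W where W: "W \<in> pw V (rk (Suc (Suc (Suc i))))" "Z = tdiff t X (Suc (Suc (Suc i))) W"
        using ex(2) unfolding exact_at_def z by blast
      have "Z k \<in> T.mS V" for k using tdiff_mS[OF t W(1)] W(2) by simp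
      then show "Z \<in> pw (T.mS V) ?b" using Z by (simp add: pw_def)
    qed
  qed
  moreover have "{Z \<in> pw V ?b. ?D Z \<in> pw (T.mS V) ?c} = pw V ?b"
    using tdiff_mS[OF t] tdiff_pw[OF t V] by (auto simp: pw_def)
  ultimately have "fs.chain_length (pw (T.mS V) ?b) (pw V ?b) (?c * m)" by simp
  then show ?thesis using fs.chain_length_unique T.chain_length_pw[OF n] by blast
qed

end

text \<open>If \<open>F 0\<close> is zero, so is the module; if \<open>F 1\<close> is zero, the
  augmentation is injective and the module free. Further up, a zero term would make the preceding
  differential injective, but that map, having entries in \<open>\<mm>\<close>, kills a nonzero
  socle element times a unit vector.\<close>

lemma rk_pos: "rk i > 0"
proof (induction i rule: induct_nat_012)
  case 0
  have "UNIV = {0::'b}" if "rk 0 = 0"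
  proof -
    have "F 0 = {0}" using that by (auto simp: F_def free_on_def)
    then show ?thesis using aug_surj module_hom.zero[OF hom_aug] by auto
  qed
  then have "free_module s UNIV" if "rk 0 = 0"
    unfolding free_module_def using that by (intro exI[of _ "{}"]) (auto simp: dependent_explicit)
  then show ?case using not_free by blast
next
  case 1
  interpret aug: module_hom pm_scale s aug by (rule hom_aug)
  interpret d1: module_hom pm_scale pm_scale "d (Suc 0)" by (rule hom_d)
  let ?u = "\<lambda>k. aug (unit_vec k)" and ?I = "{..<rk 0}"
  show ?case
  proof (rule ccontr)
    assume "\<not> 0 < rk (Suc 0)"
    then have "F (Suc 0) = {0}" by (auto simp: F_def free_on_def)
    then have ker: "v = 0" if "v \<in> F 0" "aug v = 0" for v
      using ker_aug that by (auto simp: d1.zero)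
    have "(1::'a) \<noteq> 0" using one_notin_mm zero_mm by metis
    have inj: "inj_on ?u ?I"
    proof (rule inj_onI)
      fix k l assume kl: "k \<in> ?I" "l \<in> ?I" "?u k = ?u l"
      have "unit_vec k - unit_vec l \<in> F 0"
        using kl unfolding F_def by (intro pm.subspace_diff[OF subspace_free_on] unit_vec_free_on)
      then have "unit_vec k - unit_vec l = (0 :: nat \<Rightarrow>\<^sub>0 'a)"
        by (rule ker) (simp add: aug.diff kl(3))
      then have "lk (unit_vec k :: nat \<Rightarrow>\<^sub>0 'a) k = lk (unit_vec l) k" by simp
      then show "k = l" using \<open>(1::'a) \<noteq> 0\<close> by (auto simp: lookup_single when_def split: if_splits)
    qed
    have "\<not> dependent (?u ` ?I)"
    proof
      assume "dependent (?u ` ?I)"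
      then obtain c v where c: "(\<Sum>w\<in>?u ` ?I. c w *s w) = 0" "v \<in> ?u ` ?I" "c v \<noteq> 0"
        using dependent_finite[of "?u ` ?I"] by auto
      then obtain k where k: "k \<in> ?I" "v = ?u k" by blast
      let ?v = "transp (rk 0) (\<lambda>k. Poly_Mapping.single 0 (c (?u k))) 0"
      have "aug ?v = (\<Sum>k\<in>?I. c (?u k) *s ?u k)"
        using module_hom_expand[OF hom_aug transp_mem] by (simp add: lookup_transp)
      also have "\<dots> = 0" using c(1) sum.reindex[OF inj, of "\<lambda>w. c w *s w"] by simp
      finally have "aug ?v = 0" .
      moreover have "?v \<in> F 0" unfolding F_def by (rule transp_mem)
      ultimately have "?v = 0" by (intro ker)
      then have "lk ?v k = 0" by simp
      then show False using k c(3) by (simp add: lookup_transp)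
    qed
    moreover have "span (?u ` ?I) = UNIV"
    proof -
      have "aug v \<in> span (?u ` ?I)" if "v \<in> F 0" for v
        using module_hom_expand[OF hom_aug, of v "rk 0"] that
        by (auto simp: F_def intro!: span_sum intro: span_scale span_base)
      then have "aug ` F 0 \<subseteq> span (?u ` ?I)" by blast
      then show ?thesis using aug_surj by auto
    qed
    ultimately have "free_module s UNIV" unfolding free_module_def by blast
    then show False using not_free by blast
  qed
next
  case (ge2 i)
  interpret di: module_hom pm_scale pm_scale "d (Suc i)" by (rule hom_d)
  interpret dSi: module_hom pm_scale pm_scale "d (Suc (Suc i))" by (rule hom_d)
  show ?case
  proof (rule ccontr)
    assume "\<not> 0 < rk (Suc (Suc i))"
    then have F0: "F (Suc (Suc i)) = {0}" by (auto simp: F_def free_on_def)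
    obtain z where z: "z \<noteq> 0" "\<And>r. r \<in> \<mm> \<Longrightarrow> r * z = 0" using ring_nonzero_socle by blast
    have u: "unit_vec 0 \<in> F (Suc i)"
      unfolding F_def by (rule unit_vec_free_on) (use ge2 in simp)
    have "pm_scale z (d (Suc i) (unit_vec 0)) = 0"
      using z(2) d_unit_vec_mm[of 0 i] ge2
      by (intro poly_mapping_eqI) (simp add: mult.commute[of z])
    then have "d (Suc i) (pm_scale z (unit_vec 0)) = 0" by (simp add: di.scale)
    moreover have "pm_scale z (unit_vec 0) \<in> F (Suc i)"
      using u pm.subspace_scale[OF subspace_free_on] by (simp add: F_def)
    ultimately have "pm_scale z (unit_vec 0) = (0 :: nat \<Rightarrow>\<^sub>0 'a)"
      using ker_d[of i] F0 by (auto simp: dSi.zero)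
    then have "lk (pm_scale z (unit_vec 0) :: nat \<Rightarrow>\<^sub>0 'a) 0 = 0" by simp
    then show False using z by simp
  qed
qed

section \<open>Syzygies of a minimal resolution\<close>

abbreviation syz :: "nat \<Rightarrow> (nat \<Rightarrow>\<^sub>0 'a) set" where "syz p \<equiv> d p ` F p"

text \<open>The length of \<open>\<mm> M\<^sub>p\<close>, so the numerator of \<gamma> for the
  \<open>p\<close>-th syzygy.\<close>

definition mu :: "nat \<Rightarrow> nat"
  where "mu p = (THE m. if p = 0 then chain_length {0} (mS UNIV) m
                        else pm.chain_length {0} (P.mS (syz p)) m)"

lemma lengths_0:
  "\<exists>k. pm.chain_length {0} (syz (Suc 0)) k \<and> chain_length {0} (mS UNIV) (mu 0) \<and>
     chain_length (mS UNIV) UNIV (rk 0) \<and> k + mu 0 + rk 0 = rk 0 * (1 + embdim + len_mm2)"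
proof -
  obtain k m where m: "pm.chain_length {0} (syz (Suc 0)) k" "chain_length {0} (mS UNIV) m"
      "chain_length (mS UNIV) UNIV (rk 0)" "k + m + rk 0 = rk 0 * (1 + embdim + len_mm2)"
    using presentation_lengths[OF presentation_0 minimal] by blast
  then have "mu 0 = m"
    unfolding mu_def using chain_length_unique by (auto intro!: the_equality)
  then show ?thesis using m by blast
qed

lemma lengths_Suc:
  "\<exists>k. pm.chain_length {0} (syz (Suc (Suc p))) k \<and> pm.chain_length {0} (P.mS (syz (Suc p))) (mu (Suc p)) \<and>
     pm.chain_length (P.mS (syz (Suc p))) (syz (Suc p)) (rk (Suc p)) \<and>
     k + mu (Suc p) + rk (Suc p) = rk (Suc p) * (1 + embdim + len_mm2)"
proof -
  obtain k m where m: "pm.chain_length {0} (syz (Suc (Suc p))) k" "pm.chain_length {0} (P.mS (syz (Suc p))) m"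
      "pm.chain_length (P.mS (syz (Suc p))) (syz (Suc p)) (rk (Suc p))"
      "k + m + rk (Suc p) = rk (Suc p) * (1 + embdim + len_mm2)"
    using P.presentation_lengths[OF presentation_Suc minimal] by blast
  then have "mu (Suc p) = m"
    unfolding mu_def using pm.chain_length_unique by (auto intro!: the_equality)
  then show ?thesis using m by blast
qed

text \<open>Additivity of length in \<open>0 \<rightarrow> M\<^sub>p\<^sub>+\<^sub>1 \<rightarrow>
  F\<^sub>p \<rightarrow> M\<^sub>p \<rightarrow> 0\<close>, where each \<open>M\<^sub>p\<close> has
  length \<open>mu p + rk p\<close>.\<close>

lemma length_count: "mu p + rk p + (mu (Suc p) + rk (Suc p)) = rk p * (1 + embdim + len_mm2)"
proof -
  have "pm.chain_length {0} (syz (Suc p)) (mu (Suc p) + rk (Suc p))"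
    using lengths_Suc[of p] pm.chain_length_trans by blast
  moreover obtain k where "pm.chain_length {0} (syz (Suc p)) k" "k + mu p + rk p = rk p * (1 + embdim + len_mm2)"
    using lengths_0 lengths_Suc by (cases p) blast+
  ultimately show ?thesis using pm.chain_length_unique by fastforce
qed

lemma subspace_syz: "pm.subspace (syz (Suc p))"
  using lengths_Suc[of p] pm.chain_length_subspace by blast

lemma gamma_0: "gamma s UNIV = of_nat (mu 0) / of_nat (rk 0)"
  using gamma_eq[OF subspace_UNIV] lengths_0 rk_pos by blast

lemma gamma_syz: "gamma pm_scale (syz (Suc p)) = of_nat (mu (Suc p)) / of_nat (rk (Suc p))"
  using P.gamma_eq[OF subspace_syz] lengths_Suc rk_pos by blast

lemma square_zero_syz:
  assumes "r \<in> \<mm>" "q \<in> \<mm>" "x \<in> syz (Suc p)"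
  shows "pm_scale r (pm_scale q x) = 0"
proof (rule poly_mapping_eqI)
  fix k
  have "lk x k \<in> \<mm>" using minimal[of p] assms(3) by (auto simp: coeffs_in_def image_subset_iff)
  then show "lk (pm_scale r (pm_scale q x)) k = lk 0 k" using mult3_eq_0 assms by simp
qed

lemma mm2_scale: "r \<in> \<mm>2 \<Longrightarrow> r *s x = 0"
proof -
  have "\<mm>2 \<subseteq> {r. r *s x = 0}"
    unfolding \<mm>2_def
  proof (rule R.mS_least)
    show "rg.subspace {r. r *s x = 0}"
    proof (rule rg.subspaceI)
      fix c r assume "r \<in> {r. r *s x = 0}"
      then have "c *s (r *s x) = 0" by simp
      then show "c * r \<in> {r. r *s x = 0}" by simp
    qed (simp_all add: scale_left_distrib)
    fix r q assume "r \<in> \<mm>" "q \<in> \<mm>"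
    then show "r * q \<in> {r. r *s x = 0}" using square_zero[of r q x] by simp
  qed
  then show "r \<in> \<mm>2 \<Longrightarrow> r *s x = 0" by blast
qed

lemma mS_syz_subset: "P.mS (syz (Suc p)) \<subseteq> coeffs_in \<mm>2 (rk p)"
proof (rule P.mS_least)
  show "pm.subspace (coeffs_in \<mm>2 (rk p))"
    using pm.chain_length_subspace[OF chain_length_coeffs_in[OF chain_length_mm2]] by blast
  fix r x assume r: "r \<in> \<mm>" and x: "x \<in> syz (Suc p)"
  then have x: "x \<in> free_rank (rk p)" "\<And>k. lk x k \<in> \<mm>"
    using minimal[of p] by (auto simp: coeffs_in_def image_subset_iff)
  show "pm_scale r x \<in> coeffs_in \<mm>2 (rk p)"
    using pm.subspace_scale[OF subspace_free_on x(1)] R.mS_I[OF r x(2)]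
    by (auto simp: coeffs_in_def \<mm>2_def)
qed

text \<open>\<open>\<mm>^2\<close> kills \<open>M\<^sub>p\<close>: for \<open>p = 0\<close> by the
  hypothesis on the module, otherwise because the differential has entries in \<open>\<mm>\<close>
  and the cube of \<open>\<mm>\<close> vanishes.\<close>

lemma coeffs_in_mm2_subset_syz: "coeffs_in \<mm>2 (rk p) \<subseteq> syz (Suc p)"
proof
  fix v assume v: "v \<in> coeffs_in \<mm>2 (rk p)"
  then have vF: "v \<in> F p" by (simp add: coeffs_in_def F_def)
  show "v \<in> syz (Suc p)"
  proof (cases p)
    case 0
    have "aug v = 0"
      using module_hom_expand[OF hom_aug, of v "rk 0"] vF v mm2_scale 0
      by (simp add: F_def coeffs_in_def)
    then show ?thesis using ker_aug vF 0 by blast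
  next
    case (Suc q)
    have "d (Suc q) v = 0"
    proof (rule poly_mapping_eqI)
      fix l
      have "lk v k * lk (d (Suc q) (unit_vec k)) l = 0" if "k < rk (Suc q)" for k
        using mm2_mm[OF d_unit_vec_mm[OF that, of l], of "lk v k"] v by (simp add: coeffs_in_def mult.commute)
      then show "lk (d (Suc q) v) l = lk 0 l"
        using lookup_d[of v q l] vF Suc by simp
    qed
    then show ?thesis using ker_d[of q] vF Suc by blast
  qed
qed

text \<open>Concerns \<open>M\<^sub>p\<^sub>+\<^sub>1\<close>, viewed inside
  \<open>F\<^sub>p\<close>; hence the shifted index.\<close>

definition socle_reduced :: "nat \<Rightarrow> bool"
  where "socle_reduced p \<longleftrightarrow>
     (\<forall>x\<in>syz (Suc p). (\<forall>r\<in>\<mm>. pm_scale r x = 0) \<longrightarrow> x \<in> P.mS (syz (Suc p)))"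

text \<open>\<open>\<mm>^2 F\<^sub>p\<close> lies in the socle of
  \<open>M\<^sub>p\<^sub>+\<^sub>1\<close>, hence in \<open>\<mm> M\<^sub>p\<^sub>+\<^sub>1\<close>;
  minimality gives the converse inclusion.\<close>

lemma mu_Suc:
  assumes "socle_reduced p" shows "mu (Suc p) = rk p * len_mm2"
proof -
  have "coeffs_in \<mm>2 (rk p) \<subseteq> P.mS (syz (Suc p))"
  proof
    fix v assume v: "v \<in> coeffs_in \<mm>2 (rk p)"
    have "pm_scale r v = 0" if "r \<in> \<mm>" for r
      using v mm2_mm[OF that] by (intro poly_mapping_eqI) (simp add: coeffs_in_def)
    moreover have "v \<in> syz (Suc p)" using subsetD[OF coeffs_in_mm2_subset_syz v] .
    ultimately show "v \<in> P.mS (syz (Suc p))"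
      using assms unfolding socle_reduced_def by (simp del: ball_simps)
  qed
  then have "P.mS (syz (Suc p)) = coeffs_in \<mm>2 (rk p)" using mS_syz_subset by blast
  then have "pm.chain_length {0} (P.mS (syz (Suc p))) (rk p * len_mm2)"
    using chain_length_coeffs_in[OF chain_length_mm2, of "rk p"] by (simp add: coeffs_in_0)
  then show ?thesis using lengths_Suc pm.chain_length_unique by blast
qed

text \<open>For \<open>z\<close> in the socle, \<open>z\<close> times a unit vector is a cycle in
  \<open>F\<^sub>p\<^sub>+\<^sub>1\<close>, hence in the socle of the next syzygy, hence in
  \<open>\<mm>^2 F\<^sub>p\<^sub>+\<^sub>1\<close>.\<close>

lemma socle_eq:
  assumes "socle_reduced (Suc p)" shows "socle \<mm> = \<mm>2"
proof
  show "\<mm>2 \<subseteq> socle \<mm>" using mm2_mm by (auto simp: socle_def)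
  show "socle \<mm> \<subseteq> \<mm>2"
  proof
    fix z assume z: "z \<in> socle \<mm>"
    let ?v = "pm_scale z (unit_vec 0) :: nat \<Rightarrow>\<^sub>0 'a"
    interpret dp: module_hom pm_scale pm_scale "d (Suc p)" by (rule hom_d)
    have u: "unit_vec 0 \<in> F (Suc p)"
      unfolding F_def by (rule unit_vec_free_on) (simp add: rk_pos)
    have "pm_scale z (d (Suc p) (unit_vec 0)) = 0"
      using z d_unit_vec_mm[OF rk_pos, of p]
      by (intro poly_mapping_eqI) (simp add: socle_def mult.commute[of z])
    then have "d (Suc p) ?v = 0" by (simp add: dp.scale)
    moreover have "?v \<in> F (Suc p)"
      using u pm.subspace_scale[OF subspace_free_on] by (simp add: F_def)
    ultimately have "?v \<in> syz (Suc (Suc p))" using ker_d[of p] by blast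
    moreover have "pm_scale r ?v = 0" if "r \<in> \<mm>" for r
      using z that by (intro poly_mapping_eqI) (simp add: socle_def lookup_single when_def)
    ultimately have "?v \<in> P.mS (syz (Suc (Suc p)))"
      using assms by (simp only: socle_reduced_def) blast
    then have "?v \<in> coeffs_in \<mm>2 (rk (Suc p))" by (rule subsetD[OF mS_syz_subset])
    then have "lk ?v 0 \<in> \<mm>2" unfolding coeffs_in_def by blast
    then show "z \<in> \<mm>2" by simp
  qed
qed

lemma rank_ratio_syz:
  assumes Y: "minimal_resolution \<mm> t Y"
    and ex: "exact_at s UNIV Y (Suc (i + p))" "exact_at s UNIV Y (Suc (Suc i + p))"
  shows "res_rank Y (Suc (Suc i)) * rk p = res_rank Y (Suc i) * mu p"
proof -
  interpret Y: minimal_resolution \<mm> t Y by fact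
  note shift = exact_at_syzygy[OF Y.resolution_of_axioms]
  show ?thesis
  proof (cases p)
    case 0
    then show ?thesis
      using Y.rank_ratio[OF module_axioms subspace_UNIV] square_zero ex lengths_0 by auto
  next
    case (Suc q)
    then have "exact_at pm_scale (syz (Suc q)) Y (Suc i)" "exact_at pm_scale (syz (Suc q)) Y (Suc (Suc i))"
      using ex shift[of i p] shift[of "Suc i" p] by simp_all
    then show ?thesis
      using Y.rank_ratio[OF module_pm_scale subspace_syz[of q], of i "mu p" "rk p"]
        square_zero_syz[of _ _ _ q] lengths_Suc[of q] Suc by blast
  qed
qed

lemma socle_reduced_of_exact:
  assumes Y: "minimal_resolution \<mm> t Y" and ex: "exact_at s UNIV Y (Suc (i + Suc p))"
  shows "socle_reduced p"
proof -
  interpret Y: minimal_resolution \<mm> t Y by fact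
  have "exact_at pm_scale (syz (Suc p)) Y (Suc i)"
    using ex exact_at_syzygy[OF Y.resolution_of_axioms, of i "Suc p"] by simp
  from Y.socle_subset_mS[OF module_pm_scale subspace_syz this Y.rk_pos]
  show ?thesis unfolding socle_reduced_def by blast
qed

end

section \<open>The vanishing theorem\<close>

text \<open>A fixed \<open>i < j\<close> admits two values of \<open>p\<close>, namely
  \<open>j - i\<close> and \<open>j - i - 1\<close>, which share the ratio of \<open>c\<close>; so
  neighbouring quotients \<open>m p / b p\<close> agree.\<close>

lemma ratios_constant:
  fixes b c m :: "nat \<Rightarrow> nat"
  assumes b: "\<And>p. b p > 0" and c: "\<And>i. c i > 0"
    and ratio: "\<And>i p. i + p = j \<or> Suc i + p = j \<Longrightarrow> c (Suc (Suc i)) * b p = c (Suc i) * m p"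
  shows "p \<le> j \<Longrightarrow> rat_of_nat (m p) / of_nat (b p) = of_nat (m 0) / of_nat (b 0)"
    and "i \<le> j \<Longrightarrow> rat_of_nat (c (Suc (Suc i))) / of_nat (c (Suc i)) = of_nat (m 0) / of_nat (b 0)"
proof -
  have r: "rat_of_nat (c (Suc (Suc i))) / of_nat (c (Suc i)) = of_nat (m p) / of_nat (b p)"
    if "i + p = j \<or> Suc i + p = j" for i p
    using ratio[OF that, THEN arg_cong, of rat_of_nat] b[of p] c[of "Suc i"]
    by (simp add: field_simps)
  have 1: "rat_of_nat (m p) / of_nat (b p) = of_nat (m 0) / of_nat (b 0)" if "p \<le> j" for p
    using that
  proof (induction p)
    case (Suc p)
    then show ?case using r[of "j - Suc p" p] r[of "j - Suc p" "Suc p"] by simp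
  qed simp
  show "p \<le> j \<Longrightarrow> rat_of_nat (m p) / of_nat (b p) = of_nat (m 0) / of_nat (b 0)" by (rule 1)
  show "i \<le> j \<Longrightarrow> rat_of_nat (c (Suc (Suc i))) / of_nat (c (Suc i)) = of_nat (m 0) / of_nat (b 0)"
    using r[of i "j - i"] 1[of "j - i"] by simp
qed

text \<open>The rational root theorem for \<open>X^2 - e X + a\<close>: in lowest terms the
  denominator divides the square of the numerator, so it is 1.\<close>

lemma rational_root_integer:
  fixes x y :: rat
  assumes "x + y = of_nat e" "x * y = of_nat a"
  shows "x \<in> \<int>"
proof -
  obtain p q where pq: "quotient_of x = (p, q)" by fastforce
  have q: "q > 0" and cop: "coprime p q" and x: "x = of_int p / of_int q"
    using quotient_of_denom_pos[OF pq] quotient_of_coprime[OF pq] quotient_of_div[OF pq] by auto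
  have "x * (of_nat e - x) = of_nat a"
    using assms(2) by (simp flip: assms(1))
  then have "of_int (p * (int e * q - p)) = (of_int (int a * q * q) :: rat)"
    using q by (simp add: x field_simps)
  then have "p * (int e * q - p) = int a * q * q" by (simp only: of_int_eq_iff)
  then have "p * p = q * (p * int e - int a * q)" by (simp add: algebra_simps)
  then have "q dvd p * p" by simp
  then have "q dvd 1"
    using cop by (metis coprime_common_divisor coprime_dvd_mult_left_iff dvd_refl coprime_commute)
  then have "q = 1" using q by simp
  then show ?thesis by (simp add: x)
qed

lemma minimal_resolution_min_res:
  assumes R: "cube_zero_ring \<mm>" and s: "module s" "finitely_generated s UNIV" "\<not> free_module s UNIV"
    and sq: "ideal_smult s (ideal_power \<mm> 2) UNIV = {0}"
  shows "minimal_resolution \<mm> s (min_res \<mm> s)" and "resolution_of s (chosen_res s)"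
proof -
  interpret cube_zero_ring \<mm> by fact
  interpret M: cube_zero_module \<mm> s by (rule module_cube_zero[OF s(1)])
  obtain X where X: "minimal_free_resolution \<mm> s X"
    using M.minimal_free_resolution_exists[OF s(2)] by blast
  then have min: "minimal_free_resolution \<mm> s (min_res \<mm> s)"
    unfolding min_res_def by (rule someI)
  have "free_resolution s X" using X by (simp add: minimal_free_resolution_def)
  then have "free_resolution s (chosen_res s)" unfolding chosen_res_def by (rule someI)
  then show "resolution_of s (chosen_res s)"
    using M.ring_module_axioms by (simp add: resolution_of_def resolution_of_axioms_def)
  have "resolution_of s (min_res \<mm> s)"
    using M.ring_module_axioms min
    by (simp add: resolution_of_def resolution_of_axioms_def minimal_free_resolution_def)
  moreover have "minimal_resolution_axioms \<mm> s (min_res \<mm> s)"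
  proof
    show "res_diff (min_res \<mm> s) (Suc i) ` res_mod (min_res \<mm> s) (Suc i)
        \<subseteq> coeffs_in \<mm> (res_rank (min_res \<mm> s) i)" for i
      using min by (simp add: minimal_free_resolution_def res_mod_def mS_free)
    show "\<not> free_module s UNIV" by fact
    fix r q x assume rq: "r \<in> \<mm>" "q \<in> \<mm>"
    have "r * q \<in> ideal_power \<mm> 2" unfolding ideal_power_2 \<mm>2_def by (rule R.mS_I[OF rq])
    then have "s (r * q) x \<in> ideal_smult s (ideal_power \<mm> 2) UNIV"
      unfolding ideal_smult_def by (blast intro: M.span_base)
    then show "s r (s q x) = 0" using sq by simp
  qed
  ultimately show "minimal_resolution \<mm> s (min_res \<mm> s)"
    using M.cube_zero_module_axioms by (simp add: minimal_resolution_def)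
qed

lemma gamma_syzygy_eq:
  assumes "minimal_resolution \<mm> s (min_res \<mm> s)"
  shows "gamma_syzygy \<mm> s i =
    of_nat (minimal_resolution.mu \<mm> s (min_res \<mm> s) i) / of_nat (betti \<mm> s i)"
proof -
  interpret minimal_resolution \<mm> s "min_res \<mm> s" by fact
  show ?thesis
    using gamma_0 gamma_syz by (cases i) (simp_all add: gamma_syzygy_def syzygy_def betti_def)
qed

text \<open>The conclusion seen from one side, for two arbitrary minimal resolutions, so that it can
  be applied with the modules in either order.\<close>

lemma vanishing_consequences:
  fixes \<mm> :: "'a::comm_ring_1 set"
  assumes "minimal_resolution \<mm> s X" "minimal_resolution \<mm> t Y"
    and j: "j > 0"
    and ex: "\<forall>i\<in>{j..j + 2}. exact_at s UNIV Y i"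
  defines "m \<equiv> minimal_resolution.mu \<mm> s X"
  shows "p \<le> j \<Longrightarrow> rat_of_nat (m p) / of_nat (res_rank X p) = of_nat (m 0) / of_nat (res_rank X 0)"
    and "i \<le> j \<Longrightarrow> rat_of_nat (res_rank Y (Suc (Suc i))) / of_nat (res_rank Y (Suc i)) =
           of_nat (m 0) / of_nat (res_rank X 0)"
    and "rat_of_nat (m 0) / of_nat (res_rank X 0) + of_nat (res_rank X 1) / of_nat (res_rank X 0) =
           of_nat (cube_zero_ring.embdim \<mm>)"
    and "rat_of_nat (m 0) / of_nat (res_rank X 0) * (of_nat (res_rank X 1) / of_nat (res_rank X 0)) =
           of_nat (cube_zero_ring.len_mm2 \<mm>)"
    and "rat_of_nat (res_rank X 2) / of_nat (res_rank X 1) = of_nat (res_rank X 1) / of_nat (res_rank X 0)"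
    and "socle \<mm> = cube_zero_ring.\<mm>2 \<mm>"
proof -
  interpret X: minimal_resolution \<mm> s X by fact
  interpret Y: minimal_resolution \<mm> t Y by fact
  have ratio: "Y.rk (Suc (Suc i)) * X.rk p = Y.rk (Suc i) * X.mu p"
    if "i + p = j \<or> Suc i + p = j" for i p
    by (rule X.rank_ratio_syz[OF Y.minimal_resolution_axioms]; rule bspec[OF ex]) (use that in auto)
  note const = ratios_constant[of X.rk Y.rk j X.mu, OF X.rk_pos Y.rk_pos ratio]
  show A: "p \<le> j \<Longrightarrow> rat_of_nat (m p) / of_nat (X.rk p) = of_nat (m 0) / of_nat (X.rk 0)" for p
    unfolding m_def by (rule const(1))
  show "i \<le> j \<Longrightarrow> rat_of_nat (Y.rk (Suc (Suc i))) / of_nat (Y.rk (Suc i)) = of_nat (m 0) / of_nat (X.rk 0)"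
    unfolding m_def by (rule const(2))
  \<comment> \<open>Both are exactness at \<open>j + 2\<close>, viewed as degree
    \<open>j + 1\<close> over the first syzygy and as degree \<open>j\<close> over the second; the
    latter needs \<open>j > 0\<close>.\<close>
  have "exact_at s UNIV Y (Suc (j + Suc 0))" "exact_at s UNIV Y (Suc ((j - 1) + Suc 1))"
    using j by (auto intro!: bspec[OF ex])
  then have red: "X.socle_reduced 0" "X.socle_reduced 1"
    using X.socle_reduced_of_exact[OF Y.minimal_resolution_axioms] by blast+
  show "socle \<mm> = X.\<mm>2" using X.socle_eq[of 0] red by simp
  have sum: "rat_of_nat (m p) / of_nat (X.rk p) + of_nat (X.rk (Suc p)) / of_nat (X.rk p) = of_nat X.embdim"
    if "X.socle_reduced p" for p
  proof -
    \<comment> \<open>Inserting \<open>mu (Suc p) = rk p * len_mm2\<close> into the length count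
      cancels all other terms.\<close>
    have "m p + X.rk (Suc p) = X.rk p * X.embdim"
      using X.length_count[of p] X.mu_Suc[OF that] by (simp add: m_def algebra_simps)
    then have "rat_of_nat (m p) + of_nat (X.rk (Suc p)) = of_nat (X.rk p) * of_nat X.embdim"
      by (metis of_nat_add of_nat_mult)
    then show ?thesis using X.rk_pos[of p] by (simp add: add_divide_distrib[symmetric])
  qed
  show "rat_of_nat (m 0) / of_nat (X.rk 0) + of_nat (X.rk 1) / of_nat (X.rk 0) = of_nat X.embdim"
    using sum[OF red(1)] by simp
  \<comment> \<open>The sums for \<open>p = 0\<close> and \<open>p = 1\<close> agree and have equal
    first terms, so the second terms are equal.\<close>
  then show "rat_of_nat (X.rk 2) / of_nat (X.rk 1) = of_nat (X.rk 1) / of_nat (X.rk 0)"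
    using sum[OF red(2)] A[of 1] j by (simp add: numeral_2_eq_2)
  \<comment> \<open>With the first factor rewritten in this way, \<open>X.rk 1\<close> cancels in
    the product.\<close>
  have "rat_of_nat (m 0) / of_nat (X.rk 0) = of_nat (m 1) / of_nat (X.rk 1)" using A[of 1] j by simp
  moreover have "rat_of_nat (m 1) = of_nat (X.rk 0) * of_nat X.len_mm2"
    using X.mu_Suc[OF red(1)] by (simp add: m_def)
  ultimately show "rat_of_nat (m 0) / of_nat (X.rk 0) * (of_nat (X.rk 1) / of_nat (X.rk 0)) = of_nat X.len_mm2"
    using X.rk_pos[of 0] X.rk_pos[of 1] by simp
qed

theorem theorem2p5:
  fixes \<mm> :: "'a::comm_ring_1 set"
    and sM :: "'a \<Rightarrow> 'b::ab_group_add \<Rightarrow> 'b"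
    and sN :: "'a \<Rightarrow> 'c::ab_group_add \<Rightarrow> 'c"
    and e a j :: nat
  assumes artinian: "artinian_ring TYPE('a)"
    and local: "local_ring \<mm>"
    and m3: "ideal_power \<mm> 3 = {0}"
    and e_def: "e = min_gens (*) \<mm>"
    and a_def: "a = residue_dim (*) \<mm> (socle \<mm>)"
    and M: "module sM" "finitely_generated sM UNIV" "\<not> free_module sM UNIV"
    and N: "module sN" "finitely_generated sN UNIV" "\<not> free_module sN UNIV"
    and m2M: "ideal_smult sM (ideal_power \<mm> 2) UNIV = {0}"
    and m2N: "ideal_smult sN (ideal_power \<mm> 2) UNIV = {0}"
    and j: "j > 0"
    and tor: "Tor_is_zero sM sN j" "Tor_is_zero sM sN (j + 1)" "Tor_is_zero sM sN (j + 2)"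
  shows "(gamma sM UNIV \<in> \<int> \<and> gamma sM UNIV > 0 \<and> gamma sN UNIV \<in> \<int> \<and> gamma sN UNIV > 0) \<and>
    (\<forall>i\<le>j + 1. of_nat (betti \<mm> sM (i + 1)) / of_nat (betti \<mm> sM i) = gamma sN UNIV \<and>
               of_nat (betti \<mm> sN (i + 1)) / of_nat (betti \<mm> sN i) = gamma sM UNIV) \<and>
    (\<forall>i\<le>j. gamma sM UNIV = gamma_syzygy \<mm> sM i \<and> gamma sN UNIV = gamma_syzygy \<mm> sN i) \<and>
    (gamma sM UNIV + gamma sN UNIV = of_nat e \<and> gamma sM UNIV * gamma sN UNIV = of_nat a)"
proof -
  interpret cube_zero_ring \<mm> by (rule cube_zero_ring.intro[OF artinian local m3])
  let ?X = "min_res \<mm> sM" and ?Y = "min_res \<mm> sN"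
  note minX = minimal_resolution_min_res(1)[OF cube_zero_ring_axioms M m2M]
    and minY = minimal_resolution_min_res(1)[OF cube_zero_ring_axioms N m2N]
  note C = minimal_resolution_min_res(2)[OF cube_zero_ring_axioms M m2M]
  interpret X: minimal_resolution \<mm> sM ?X by (rule minX)
  interpret Y: minimal_resolution \<mm> sN ?Y by (rule minY)
  \<comment> \<open>Balancing leads from the chosen resolution of \<open>M\<close> to the minimal
    one of \<open>N\<close>, and a second time to the minimal one of \<open>M\<close>.\<close>
  have ex: "exact_at sM UNIV ?Y i" "exact_at sN UNIV ?X i" if i: "i \<in> {j..j + 2}" for i
  proof -
    obtain p where p: "i = Suc p" using j i by (cases i) auto
    have "i = j \<or> i = j + 1 \<or> i = j + 2" using i by auto
    then have "Tor_is_zero sM sN (Suc p)" using tor p by auto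
    from exact_at_of_Tor[OF C N(1) this]
    have "exact_at sN UNIV (chosen_res sM) (Suc p)" .
    from exact_at_balanced[OF C Y.resolution_of_axioms this]
    show "exact_at sM UNIV ?Y i" by (simp add: p)
    then show "exact_at sN UNIV ?X i"
      using exact_at_balanced[OF Y.resolution_of_axioms X.resolution_of_axioms] by (simp add: p)
  qed
  then have exY: "\<forall>i\<in>{j..j + 2}. exact_at sM UNIV ?Y i" and exX: "\<forall>i\<in>{j..j + 2}. exact_at sN UNIV ?X i"
    by blast+
  note VX = vanishing_consequences[OF minX minY j exY]
    and VY = vanishing_consequences[OF minY minX j exX]
  have gM: "gamma sM UNIV = of_nat (X.mu 0) / of_nat (X.rk 0)"
    and gN: "gamma sN UNIV = of_nat (Y.mu 0) / of_nat (Y.rk 0)"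
    by (rule X.gamma_0, rule Y.gamma_0)
  \<comment> \<open>The first Betti ratio of \<open>M\<close> equals the second by the application
    to \<open>M\<close>, and the second is \<gamma>(N) by the application with the modules
    swapped.\<close>
  have rX: "of_nat (X.rk 1) / of_nat (X.rk 0) = gamma sN UNIV"
    using VX(5) VY(2)[of 0] gN by (simp add: numeral_2_eq_2)
  have rY: "of_nat (Y.rk 1) / of_nat (Y.rk 0) = gamma sM UNIV"
    using VY(5) VX(2)[of 0] gM by (simp add: numeral_2_eq_2)
  have pos: "gamma sM UNIV > 0" "gamma sN UNIV > 0"
    unfolding rX[symmetric] rY[symmetric] using X.rk_pos Y.rk_pos by simp_all
  have "a = len_mm2"
    unfolding a_def VX(6) \<mm>2_def
    using R.residue_dim_eq[OF R.subspace_mS _ chain_length_mm2[unfolded \<mm>2_def]] mm2_mm[unfolded \<mm>2_def]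
    by blast
  moreover have "e = embdim" unfolding e_def by (rule min_gens_mm)
  ultimately have sum: "gamma sM UNIV + gamma sN UNIV = of_nat e"
    and prod: "gamma sM UNIV * gamma sN UNIV = of_nat a"
    using VX(3,4) unfolding gM rX[unfolded One_nat_def] by (simp_all add: rX[unfolded One_nat_def])
  have int: "gamma sM UNIV \<in> \<int>" "gamma sN UNIV \<in> \<int>"
    using rational_root_integer[OF sum prod]
      rational_root_integer[of "gamma sN UNIV" "gamma sM UNIV" e a] sum prod
    by (simp_all add: add.commute mult.commute)
  have "of_nat (betti \<mm> sM (i + 1)) / of_nat (betti \<mm> sM i) = gamma sN UNIV \<and>
      of_nat (betti \<mm> sN (i + 1)) / of_nat (betti \<mm> sN i) = gamma sM UNIV" if "i \<le> j + 1" for i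
  \<comment> \<open>The ratios from \<open>VX(2)\<close> and \<open>VY(2)\<close> start with the
    second one, so index 0 is settled by \<open>rX\<close> and \<open>rY\<close>.\<close>
  proof (cases i)
    case 0
    then show ?thesis using rX rY by (simp add: betti_def)
  next
    case (Suc k)
    then show ?thesis using VX(2)[of k] VY(2)[of k] that gM gN by (simp add: betti_def)
  qed
  moreover have "gamma sM UNIV = gamma_syzygy \<mm> sM i \<and> gamma sN UNIV = gamma_syzygy \<mm> sN i"
    if "i \<le> j" for i
    using VX(1)[OF that] VY(1)[OF that] gM gN
    by (simp add: gamma_syzygy_eq[OF minX] gamma_syzygy_eq[OF minY] betti_def)
  ultimately show ?thesis using pos int sum prod by blast
qed

end
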